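(* Let the spectral density $f(\lambda)$ be known (fixed), let $$\mathcal D_\varepsilon=\left\{g(\lambda)\ \Big|\ g(\lambda)=(1-\varepsilon)g_1(\lambda)+\varepsilon w(\lambda),\ \frac1{2\pi}\int_{-\pi}^{\pi}g(\lambda)d\lambda\le P_2\right\},$$ where the spectral density $g_1$ is known and fixed, $P_2>0$, $0<\varepsilon<1$, and $w$ ranges over spectral densities. Suppose that $g^0\in\mathcal D_\varepsilon$, that $\int_{-\pi}^{\pi}\frac{d\lambda}{f(\lambda)+g^0(\lambda)}<\infty$, and that the function $$h_g(f,g^0)=\frac{\left|A(e^{i\lambda})f(\lambda)-\sum_{k=0}^\infty((\mathbf P^0)^{-1}\mathbf R^0\mathbf a)_ke^{i\lambda(k+1)}\right|}{f(\lambda)+g^0(\lambda)}$$ is bounded. If $g^0$ is of the form $$g^0(\lambda)=\max\left\{(1-\varepsilon)g_1(\lambda),\,f_1(\lambda)\right\},\qquad f_1(\lambda)=\alpha_2\left|A(e^{i\lambda})f(\lambda)-\sum_{k=0}^\infty((\mathbf P^0)^{-1}\mathbf R^0\mathbf a)_ke^{i\lambda(k+1)}\right|-f(\lambda),$$ for a constant $\alpha_2>0$, and the pair $(f,g^0)$ determines a solution of the optimization problem $$\max_{g\in\mathcal D_\varepsilon}\left(\langle\mathbf R\mathbf a,\mathbf P^{-1}\mathbf R\mathbf a\rangle+\langle\mathbf Q\mathbf a,\mathbf a\rangle\right)=\langle\mathbf R^0\mathbf a,(\mathbf P^0)^{-1}\mathbf R^0\mathbf a\rangle+\langle\mathbf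 Q^0\mathbf a,\mathbf a\rangle$$ (with $\mathbf P,\mathbf R,\mathbf Q$ built from $(f,g)$), then $g^0$ is least favorable in the class $\mathcal D_\varepsilon$ for the optimal linear filtering of $A\xi=\sum_{k=0}^\infty a(k)\xi(-k)$, and the function $h(f,g^0)$ is the minimax-robust spectral characteristic of the optimal estimate of $A\xi$.
   Context: Setting: $\xi,\eta$ are zero-mean, mutually uncorrelated (wide-sense) stationary sequences with spectral densities $f,g\ge0$, integrable on $[-\pi,\pi)$, normalized by $\mathsf E\,\xi(m+k)\overline{\xi(m)}=\frac1{2\pi}\int e^{ik\lambda}f\,d\lambda$ (similarly $\eta,g$); $\xi(m)=\int e^{im\lambda}dZ_\xi(\lambda)$, $\eta(m)=\int e^{im\lambda}dZ_\eta(\lambda)$, $Z_{\xi+\eta}=Z_\xi+Z_\eta$. The functional $A\xi=\sum_{k\ge0}a(k)\xi(-k)$ is estimated by $\int h(\lambda)dZ_{\xi+\eta}(\lambda)$ from observations of $\xi(m)+\eta(m)$, $m=0,-1,-2,\ldots$. The coefficients satisfy $\sum|a(k)|<\infty$, $\sum(k+1)|a(k)|^2<\infty$; $\mathbf a=(a(0),a(1),\ldots)'$, $A(e^{i\lambda})=\sum_{k\ge0}a(k)e^{-i\lambda k}$. Operators: $\langle x,y\rangle=\sum_{k\ge0}x_k\overline{y_k}$ on $\ell_2$. For a pair $(f,g)$ with $\int\frac{d\lambda}{f+g}<\infty$, $\mathbf P,\mathbf R,\mathbf Q$ are the linear operators on $\ell_2$ with matrices ($l,k,m\ge0$) $$(\mathbf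 P)_{l,k}=\frac1{2\pi}\int_{-\pi}^{\pi}\frac{e^{i\lambda(k-l)}}{f+g}d\lambda,\quad(\mathbf R)_{l,m}=\frac1{2\pi}\int_{-\pi}^{\pi}e^{-i\lambda(l+1+m)}\frac{f}{f+g}d\lambda,\quad(\mathbf Q)_{l,k}=\frac1{2\pi}\int_{-\pi}^{\pi}e^{i\lambda(l-k)}\frac{fg}{f+g}d\lambda ;$$ $\mathbf P^0,\mathbf R^0,\mathbf Q^0$ are those built from $(f,g^0)$. Expressions involving these operators are considered for pairs with $\int\frac{d\lambda}{f+g}<\infty$ for which the matrices define operators on $\ell_2$ and $\mathbf P$ is invertible. Spectral characteristic and error: the optimal spectral characteristic for $(f,g)$ is $$h(f,g)(\lambda)=A(e^{i\lambda})\frac{f(\lambda)}{f(\lambda)+g(\lambda)}-\frac{\sum_{k\ge0}(\mathbf P^{-1}\mathbf R\mathbf a)_ke^{i\lambda(k+1)}}{f(\lambda)+g(\lambda)},$$ and $\Delta(h;f,g)=\frac1{2\pi}\int_{-\pi}^{\pi}|A(e^{i\lambda})-h(\lambda)|^2f(\lambda)d\lambda+\frac1{2\pi}\int_{-\pi}^{\pi}|h(\lambda)|^2g(\lambda)d\lambda$ is the mean-square error of the estimate with spectral characteristic $h$. Definitions (with $f$ fixed, i.e. for the class $\mathcal D=\{f\}\times\mathcal D_\varepsilon$): $g^0\in\mathcal D_\varepsilon$ is least favorable in $\mathcal D_\varepsilon$ for the optimal linear filtering of $A\xi$ if $\Delta(h(f,g^0);f,g^0)=\max_{g\in\mathcal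 D_\varepsilon}\Delta(h(f,g);f,g)$. A spectral characteristic $h^0$ is minimax-robust if $h^0\in H_{\mathcal D}=\bigcap_{g\in\mathcal D_\varepsilon}L_2^0(f+g)$ and $\min_{h\in H_{\mathcal D}}\max_{g\in\mathcal D_\varepsilon}\Delta(h;f,g)=\sup_{g\in\mathcal D_\varepsilon}\Delta(h^0;f,g)$, where $L_2^0(f+g)$ is the closed subspace of $L_2(f+g)$ generated by $\{e^{im\lambda}:m=0,-1,-2,\ldots\}$. *)

theory Defs
  imports "HOL-Analysis.Analysis"
begin

text \<open>
  Functions of the frequency are considered on \<open>[-\<pi>, \<pi>)\<close> with Lebesgue measure
  and, as elements of \<open>L\<^sub>1\<close> or \<open>L\<^sub>2\<close>, are identified when they agree almost everywhere.
\<close>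

abbreviation freq :: "real measure" where
  "freq \<equiv> restrict_space lborel {-pi..<pi}"

definition spectral_density :: "(real \<Rightarrow> real) \<Rightarrow> bool" where
  "spectral_density f \<longleftrightarrow> integrable freq f \<and> (\<forall>t\<in>{-pi..<pi}. 0 \<le> f t)"


subsection \<open>Square-summable sequences and operators given by infinite matrices\<close>

definition ell2 :: "(nat \<Rightarrow> complex) set" where
  "ell2 = {x. summable (\<lambda>k. (cmod (x k))\<^sup>2)}"

definition ell2_inner :: "(nat \<Rightarrow> complex) \<Rightarrow> (nat \<Rightarrow> complex) \<Rightarrow> complex" where
  "ell2_inner x y = (\<Sum>k. x k * cnj (y k))"

definition mat_apply :: "(nat \<Rightarrow> nat \<Rightarrow> complex) \<Rightarrow> (nat \<Rightarrow> complex) \<Rightarrow> nat \<Rightarrow> complex" where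
  "mat_apply M x l = (\<Sum>k. M l k * x k)"

text \<open>
  Boundedness is not required here: by the closed graph theorem it is automatic for a matrix
  that acts on all of \<open>\<ell>\<^sub>2\<close>.
\<close>

definition acts_on_ell2 :: "(nat \<Rightarrow> nat \<Rightarrow> complex) \<Rightarrow> bool" where
  "acts_on_ell2 M \<longleftrightarrow>
     (\<forall>x\<in>ell2. (\<forall>l. summable (\<lambda>k. M l k * x k)) \<and> mat_apply M x \<in> ell2)"

definition invertible_on_ell2 :: "(nat \<Rightarrow> nat \<Rightarrow> complex) \<Rightarrow> bool" where
  "invertible_on_ell2 M \<longleftrightarrow> acts_on_ell2 M \<and> bij_betw (mat_apply M) ell2 ell2"

definition mat_inv_apply :: "(nat \<Rightarrow> nat \<Rightarrow> complex) \<Rightarrow> (nat \<Rightarrow> complex) \<Rightarrow> nat \<Rightarrow> complex" where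
  "mat_inv_apply M = inv_into ell2 (mat_apply M)"


subsection \<open>The operators of the filtering problem\<close>

definition P_mat :: "(real \<Rightarrow> real) \<Rightarrow> (real \<Rightarrow> real) \<Rightarrow> nat \<Rightarrow> nat \<Rightarrow> complex" where
  "P_mat f g l k =
     (LINT t|freq. cis (t * (real k - real l)) / of_real (f t + g t)) / of_real (2 * pi)"

definition R_mat :: "(real \<Rightarrow> real) \<Rightarrow> (real \<Rightarrow> real) \<Rightarrow> nat \<Rightarrow> nat \<Rightarrow> complex" where
  "R_mat f g l m =
     (LINT t|freq. cis (- t * (real l + 1 + real m)) * of_real (f t / (f t + g t))) / of_real (2 * pi)"

definition Q_mat :: "(real \<Rightarrow> real) \<Rightarrow> (real \<Rightarrow> real) \<Rightarrow> nat \<Rightarrow> nat \<Rightarrow> complex" where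
  "Q_mat f g l k =
     (LINT t|freq. cis (t * (real l - real k)) * of_real (f t * g t / (f t + g t))) / of_real (2 * pi)"

text \<open>
  The quotient is taken in \<^typ>\<open>ennreal\<close>, where \<open>1 / 0 = \<infinity>\<close>; hence the condition forces
  \<open>f + g > 0\<close> almost everywhere. A real-valued quotient would silently allow \<open>f + g\<close> to
  vanish on a set of positive measure.
\<close>

definition inverse_integrable :: "(real \<Rightarrow> real) \<Rightarrow> (real \<Rightarrow> real) \<Rightarrow> bool" where
  "inverse_integrable f g \<longleftrightarrow> (\<integral>\<^sup>+t. 1 / ennreal (f t + g t) \<partial>freq) < \<infinity>"

text \<open>The pairs for which the expressions involving the operators are considered.\<close>

definition admissible :: "(real \<Rightarrow> real) \<Rightarrow> (real \<Rightarrow> real) \<Rightarrow> bool" where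
  "admissible f g \<longleftrightarrow> inverse_integrable f g \<and>
     acts_on_ell2 (P_mat f g) \<and> acts_on_ell2 (R_mat f g) \<and> acts_on_ell2 (Q_mat f g) \<and>
     invertible_on_ell2 (P_mat f g)"

text \<open>
  The value of \<open>\<langle>R a, P\<inverse> R a\<rangle> + \<langle>Q a, a\<rangle>\<close>. It is a real number, since \<open>P\<close> and \<open>Q\<close> are Hermitian;
  \<^const>\<open>Re\<close> only changes its type.
\<close>

definition operator_objective :: "(nat \<Rightarrow> complex) \<Rightarrow> (real \<Rightarrow> real) \<Rightarrow> (real \<Rightarrow> real) \<Rightarrow> real" where
  "operator_objective a f g =
     Re (ell2_inner (mat_apply (R_mat f g) a)
           (mat_inv_apply (P_mat f g) (mat_apply (R_mat f g) a))
         + ell2_inner (mat_apply (Q_mat f g) a) a)"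


subsection \<open>Spectral characteristic and mean-square error\<close>

definition A_fun :: "(nat \<Rightarrow> complex) \<Rightarrow> real \<Rightarrow> complex" where
  "A_fun a t = (\<Sum>k. a k * cis (- t * real k))"

text \<open>
  The coefficients of the series \<open>\<Sum>k\<ge>0. c k * e^(i t (k+1))\<close> below are only square summable, so
  its sum is the mean-square limit of the partial sums. The function is one representative of
  this limit, which is unique up to null sets; it is meaningful for \<open>c \<in> \<ell>\<^sub>2\<close>.
\<close>

definition fourier_sum :: "(nat \<Rightarrow> complex) \<Rightarrow> real \<Rightarrow> complex" where
  "fourier_sum c = (SOME \<psi>. \<psi> \<in> borel_measurable freq \<and>
     (\<lambda>n. \<integral>\<^sup>+t. ennreal ((cmod (\<psi> t - (\<Sum>k<n. c k * cis (t * (real k + 1)))))\<^sup>2) \<partial>freq)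
       \<longlonglongrightarrow> 0)"

definition correction :: "(nat \<Rightarrow> complex) \<Rightarrow> (real \<Rightarrow> real) \<Rightarrow> (real \<Rightarrow> real) \<Rightarrow> real \<Rightarrow> complex" where
  "correction a f g =
     fourier_sum (mat_inv_apply (P_mat f g) (mat_apply (R_mat f g) a))"

definition spectral_char :: "(nat \<Rightarrow> complex) \<Rightarrow> (real \<Rightarrow> real) \<Rightarrow> (real \<Rightarrow> real) \<Rightarrow> real \<Rightarrow> complex" where
  "spectral_char a f g t =
     A_fun a t * of_real (f t / (f t + g t)) - correction a f g t / of_real (f t + g t)"

definition mse ::
  "(nat \<Rightarrow> complex) \<Rightarrow> (real \<Rightarrow> complex) \<Rightarrow> (real \<Rightarrow> real) \<Rightarrow> (real \<Rightarrow> real) \<Rightarrow> ennreal" where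
  "mse a h f g =
     (\<integral>\<^sup>+t. ennreal ((cmod (A_fun a t - h t))\<^sup>2 * f t) \<partial>freq) / ennreal (2 * pi)
     + (\<integral>\<^sup>+t. ennreal ((cmod (h t))\<^sup>2 * g t) \<partial>freq) / ennreal (2 * pi)"


subsection \<open>Least favorable densities and minimax-robust characteristics\<close>

text \<open>
  The closed linear span of \<open>{e^(i m t) | m \<le> 0}\<close> in the weighted space \<open>L\<^sub>2(u)\<close>.
\<close>

definition L2_past :: "(real \<Rightarrow> real) \<Rightarrow> (real \<Rightarrow> complex) set" where
  "L2_past u = {h. h \<in> borel_measurable freq \<and>
     (\<integral>\<^sup>+t. ennreal ((cmod (h t))\<^sup>2 * u t) \<partial>freq) < \<infinity> \<and>
     (\<forall>e>0. \<exists>n c. (\<integral>\<^sup>+t. ennreal ((cmod (h t - (\<Sum>k<n. c k * cis (- t * real k))))\<^sup>2 * u t) \<partial>freq)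
        < e)}"

definition H_class :: "(real \<Rightarrow> real) \<Rightarrow> (real \<Rightarrow> real) set \<Rightarrow> (real \<Rightarrow> complex) set" where
  "H_class f D = (\<Inter>g\<in>D. L2_past (\<lambda>t. f t + g t))"

text \<open>
  The characteristic \<open>h(f, g)\<close> is given by the inverse of \<open>P\<close>, so the maximum defining a least
  favorable density ranges over the admissible members of the class.
\<close>

definition least_favorable ::
  "(nat \<Rightarrow> complex) \<Rightarrow> (real \<Rightarrow> real) \<Rightarrow> (real \<Rightarrow> real) set \<Rightarrow> (real \<Rightarrow> real) \<Rightarrow> bool" where
  "least_favorable a f D g0 \<longleftrightarrow> g0 \<in> D \<and> admissible f g0 \<and>
     (\<forall>g\<in>D. admissible f g \<longrightarrow>
        mse a (spectral_char a f g) f g \<le> mse a (spectral_char a f g0) f g0)"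

text \<open>
  The errors are suprema in \<^typ>\<open>ennreal\<close> and need not be attained by some \<open>g\<close>. The minimum
  over \<open>h\<close> is attained, namely at \<open>h0\<close>, which itself lies in the class.
\<close>

definition minimax_robust ::
  "(nat \<Rightarrow> complex) \<Rightarrow> (real \<Rightarrow> real) \<Rightarrow> (real \<Rightarrow> real) set \<Rightarrow> (real \<Rightarrow> complex) \<Rightarrow> bool" where
  "minimax_robust a f D h0 \<longleftrightarrow> h0 \<in> H_class f D \<and>
     (INF h\<in>H_class f D. SUP g\<in>D. mse a h f g) = (SUP g\<in>D. mse a h0 f g)"

definition contamination_class :: "(real \<Rightarrow> real) \<Rightarrow> real \<Rightarrow> real \<Rightarrow> (real \<Rightarrow> real) set" where
  "contamination_class g1 \<epsilon> P2 = {g.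
     (\<exists>w. spectral_density w \<and> (\<forall>t\<in>{-pi..<pi}. g t = (1 - \<epsilon>) * g1 t + \<epsilon> * w t)) \<and>
     (LINT t|freq. g t) / (2 * pi) \<le> P2}"

end

theory Submission imports Defs begin

text \<open>
  Let \<open>u = 1 / (f + g)\<close> and let \<open>C\<close> be the Fourier series with coefficients \<open>c = P\<inverse> R a\<close> at the
  frequencies \<open>1, 2, \<dots>\<close>, so that \<open>h(f, g) = (A f - C) u\<close>. The equation \<open>P c = R a\<close> says that \<open>h\<close> has
  no Fourier coefficients at positive frequencies (\<open>h_coeff\<close>). Since \<open>(A - h) f - h g = C\<close>, the
  residual of \<open>h\<close> is orthogonal to the past, which makes \<open>h\<close> the best characteristic for the pair
  (\<open>mse_h_minimal\<close>). Expanding the squares, its error is the integral of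
  \<open>|A|\<^sup>2 f g u + |C|\<^sup>2 u\<close> over \<open>2 * pi\<close>, which is the value of the operator objective (\<open>mse_h\<close>). A maximum of the
  objective is therefore a least favorable density.

  For robustness, let \<open>h\<^sub>0\<close> belong to \<open>g\<^sub>0\<close>. It suffices to show the saddle point inequality
  \<open>\<Delta>(h\<^sub>0; f, g) \<le> \<Delta>(h\<^sub>0; f, g\<^sub>0)\<close>, that is, that the integral of \<open>|h\<^sub>0|\<^sup>2 (g - g\<^sub>0)\<close> is not positive. The
  form of \<open>g\<^sub>0\<close> means that \<open>|h\<^sub>0| \<le> 1 / \<alpha>\<^sub>2\<close>, with equality wherever \<open>g\<^sub>0\<close> exceeds the minimal
  value \<open>(1 - \<epsilon>) g\<^sub>1\<close> of the class. So \<open>|h\<^sub>0|\<^sup>2 (g - g\<^sub>0) \<le> (g - g\<^sub>0) / \<alpha>\<^sub>2\<^sup>2\<close> pointwise, and integration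
  settles the case in which \<open>g\<^sub>0\<close> exhausts the power \<open>P\<^sub>2\<close>. If it does not, then
  \<open>g\<^sub>0 + s (f + g\<^sub>0)\<close> is in the class for small \<open>s > 0\<close>; passing to it rescales \<open>P\<close> and \<open>R\<close>, leaves \<open>C\<close> alone
  and increases the objective by \<open>s / (1 + s)\<close> times the integral of \<open>|h\<^sub>0|\<^sup>2 (f + g\<^sub>0)\<close> over \<open>2 * pi\<close>
  (\<open>objective_perturbed\<close>). Maximality then forces \<open>h\<^sub>0 = 0\<close>, and the inequality is trivial.

  Two pieces of analysis carry this. First, the invertibility of \<open>P\<close> on \<open>\<ell>\<^sub>2\<close> bounds its symbol \<open>u\<close>
  from both sides (\<open>toeplitz_symbol_bounded\<close>, \<open>toeplitz_symbol_bounded_below\<close>). This makes the integrals above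
  finite, and it makes the perturbed pair admissible, because \<open>f\<close> is then bounded. Behind it are the uniform
  boundedness principle in \<open>\<ell>\<^sub>2\<close> and the fact that a weight with a nonnegative quadratic form on
  trigonometric polynomials is nonnegative. Second, \<open>h\<^sub>0\<close> has to lie in the space generated by the past
  for every density of the class, however irregular (\<open>L2_past_of_bounded\<close>). Both rest on the
  convergence of Fejer means in \<open>L\<^sub>1\<close> (\<open>fejer_L1\<close>).
\<close>

section \<open>Uniform boundedness in the space of square-summable sequences\<close>

definition ell2_norm :: "(nat \<Rightarrow> complex) \<Rightarrow> real" where
  "ell2_norm x = sqrt (\<Sum>k. (cmod (x k))\<^sup>2)"

lemma ell2_norm_nonneg: "0 \<le> ell2_norm x" if "x \<in> ell2"
  using that by (auto simp: ell2_norm_def ell2_def intro!: suminf_nonneg)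

lemma ell2_norm_power2: "(ell2_norm x)\<^sup>2 = (\<Sum>k. (cmod (x k))\<^sup>2)" if "x \<in> ell2"
  using that by (auto simp: ell2_norm_def ell2_def intro!: suminf_nonneg)

lemma L2_set_le_ell2_norm: "L2_set (\<lambda>k. cmod (x k)) {..<n} \<le> ell2_norm x" if "x \<in> ell2"
  using that unfolding L2_set_def ell2_norm_def ell2_def
  by (intro real_sqrt_le_mono sum_le_suminf) auto

lemma ell2_of_L2_set_bounded:
  assumes "\<And>n. L2_set (\<lambda>k. cmod (x k)) {..<n} \<le> B"
  shows "x \<in> ell2" "ell2_norm x \<le> B"
proof -
  have B: "0 \<le> B" using assms[of 0] by simp
  have le: "(\<Sum>k<n. (cmod (x k))\<^sup>2) \<le> B\<^sup>2" for n
    using assms[of n] unfolding L2_set_def by (simp add: sqrt_le_D)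
  show "x \<in> ell2" unfolding ell2_def
    by (auto intro!: summableI_nonneg_bounded le)
  then have "(\<Sum>k. (cmod (x k))\<^sup>2) \<le> B\<^sup>2"
    unfolding ell2_def by (auto intro!: suminf_le_const le)
  then show "ell2_norm x \<le> B"
    unfolding ell2_norm_def using B by (simp add: real_le_lsqrt)
qed

lemma ell2_add: "(\<lambda>k. x k + y k) \<in> ell2" if "x \<in> ell2" "y \<in> ell2"
proof (rule ell2_of_L2_set_bounded)
  fix n
  have "L2_set (\<lambda>k. cmod (x k + y k)) {..<n} \<le> L2_set (\<lambda>k. cmod (x k) + cmod (y k)) {..<n}"
    by (intro L2_set_mono norm_triangle_ineq) auto
  also have "\<dots> \<le> L2_set (\<lambda>k. cmod (x k)) {..<n} + L2_set (\<lambda>k. cmod (y k)) {..<n}"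
    by (rule L2_set_triangle_ineq)
  also have "\<dots> \<le> ell2_norm x + ell2_norm y"
    by (intro add_mono L2_set_le_ell2_norm that)
  finally show "L2_set (\<lambda>k. cmod (x k + y k)) {..<n} \<le> ell2_norm x + ell2_norm y" .
qed

lemma ell2_scale: "(\<lambda>k. c * x k) \<in> ell2" if "x \<in> ell2"
  using that unfolding ell2_def by (auto simp: norm_mult power_mult_distrib intro: summable_mult)

lemma ell2_norm_scale: "ell2_norm (\<lambda>k. c * x k) = cmod c * ell2_norm x" if "x \<in> ell2"
  using that unfolding ell2_def ell2_norm_def
  by (simp add: norm_mult power_mult_distrib suminf_mult real_sqrt_mult)

lemma ell2_finite_support: "x \<in> ell2" if "\<And>k. n \<le> k \<Longrightarrow> x k = 0"
  unfolding ell2_def using that by (auto intro!: summable_finite[of "{..<n}"] simp: not_le[symmetric])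

lemma ell2_cnj: "(\<lambda>k. cnj (x k)) \<in> ell2" if "x \<in> ell2"
  using that unfolding ell2_def by simp

lemma ell2_summable_cmod: "x \<in> ell2" if "summable (\<lambda>k. cmod (x k))"
  unfolding ell2_def
proof (rule CollectI, rule summable_comparison_test_ev)
  have "\<forall>\<^sub>F k in sequentially. cmod (x k) < 1"
    using summable_LIMSEQ_zero[OF that] by (rule order_tendstoD) simp
  then show "\<forall>\<^sub>F k in sequentially. norm ((cmod (x k))\<^sup>2) \<le> cmod (x k)"
    by eventually_elim (simp add: power2_eq_square mult_le_one mult_left_le)
qed (rule that)

lemma ell2_Cauchy_Schwarz:
  assumes "x \<in> ell2" "y \<in> ell2"
  shows "summable (\<lambda>k. cmod (x k * cnj (y k)))"
    and "cmod (ell2_inner x y) \<le> ell2_norm x * ell2_norm y"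
proof -
  have le: "(\<Sum>k<n. cmod (x k * cnj (y k))) \<le> ell2_norm x * ell2_norm y" for n
  proof -
    have "(\<Sum>k<n. cmod (x k * cnj (y k))) \<le>
        L2_set (\<lambda>k. cmod (x k)) {..<n} * L2_set (\<lambda>k. cmod (y k)) {..<n}"
      using L2_set_mult_ineq[of "\<lambda>k. cmod (x k)" "\<lambda>k. cmod (y k)" "{..<n}"]
      by (simp add: norm_mult)
    also have "\<dots> \<le> ell2_norm x * ell2_norm y"
      by (intro mult_mono L2_set_le_ell2_norm L2_set_nonneg ell2_norm_nonneg assms)
    finally show ?thesis .
  qed
  show s: "summable (\<lambda>k. cmod (x k * cnj (y k)))"
    by (rule summableI_nonneg_bounded) (auto intro: le)
  show "cmod (ell2_inner x y) \<le> ell2_norm x * ell2_norm y"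
    unfolding ell2_inner_def
    using summable_norm[OF s] suminf_le_const[OF s le] by linarith
qed

lemma ell2_inner_add_right:
  assumes "x \<in> ell2" "y \<in> ell2" "z \<in> ell2"
  shows "ell2_inner x (\<lambda>k. y k + z k) = ell2_inner x y + ell2_inner x z"
  unfolding ell2_inner_def
  using suminf_add[OF summable_norm_cancel[OF ell2_Cauchy_Schwarz(1)[OF assms(1,2)]]
      summable_norm_cancel[OF ell2_Cauchy_Schwarz(1)[OF assms(1,3)]]]
  by (simp add: algebra_simps)

lemma ell2_inner_scale_self:
  assumes "x \<in> ell2"
  shows "ell2_inner x (\<lambda>k. complex_of_real c * x k) = of_real (c * (ell2_norm x)\<^sup>2)"
proof -
  have s: "summable (\<lambda>k. (cmod (x k))\<^sup>2)" using assms by (simp add: ell2_def)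
  have "ell2_inner x (\<lambda>k. complex_of_real c * x k) = (\<Sum>k. of_real (c * (cmod (x k))\<^sup>2))"
    unfolding ell2_inner_def by (simp add: complex_norm_square mult_ac del: of_real_power)
  also have "\<dots> = of_real (\<Sum>k. c * (cmod (x k))\<^sup>2)"
    by (rule suminf_of_real[symmetric]) (use s in \<open>auto intro: summable_mult\<close>)
  also have "(\<Sum>k. c * (cmod (x k))\<^sup>2) = c * (ell2_norm x)\<^sup>2"
    using s by (simp add: ell2_norm_power2[OF assms] suminf_mult)
  finally show ?thesis .
qed

text \<open>
  If the norms on \<open>S\<close> were unbounded, one could pick \<open>x\<^sub>0, x\<^sub>1, \<dots>\<close> in \<open>S\<close> one after the other
  and add up steps of length \<open>3^-n\<close> in their directions. The weak bound at the sum reached so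
  far limits \<open>\<langle>x\<^sub>n, \<cdot>\<rangle>\<close> on the earlier steps before \<open>x\<^sub>n\<close> has to be chosen, and the later steps
  have total length at most \<open>3^-n / 2\<close>, so they cancel at most half of the \<open>n\<close>-th step. The limit
  \<open>y\<close> therefore has unbounded products with \<open>S\<close>.
\<close>
lemma ell2_uniform_boundedness:
  assumes S: "S \<subseteq> ell2"
    and weak: "\<And>y. y \<in> ell2 \<Longrightarrow> \<exists>B. \<forall>x\<in>S. cmod (ell2_inner x y) \<le> B"
  shows "\<exists>K. \<forall>x\<in>S. ell2_norm x \<le> K"
proof (rule ccontr)
  assume "\<not> ?thesis"
  then have big: "\<exists>x\<in>S. K < ell2_norm x" for K by (auto simp: not_le)
  have "\<forall>y\<in>ell2. \<exists>B. \<forall>x\<in>S. cmod (ell2_inner x y) \<le> B" using weak by blast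
  from bchoice[OF this] obtain B where B: "\<And>y x. y \<in> ell2 \<Longrightarrow> x \<in> S \<Longrightarrow> cmod (ell2_inner x y) \<le> B y"
    by blast
  have B0: "0 \<le> B y" if "y \<in> ell2" for y
    using B[OF that] big[of 0] by (meson norm_ge_zero order_trans)
  \<comment> \<open>\<open>y\<close> stands for the sum reached so far; the factor \<open>2 * 3 ^ n\<close> makes half of a step of length \<open>3^-n\<close> count for more than \<open>B y + n\<close>.\<close>
  have "\<forall>y n. \<exists>x. x \<in> S \<and> 2 * 3 ^ n * (B y + real n) < ell2_norm x"
    using big by blast
  then obtain X where X': "\<And>y n. X y n \<in> S \<and> 2 * 3 ^ n * (B y + real n) < ell2_norm (X y n)"
    by metis
  then have X: "X y n \<in> S" "2 * 3 ^ n * (B y + real n) < ell2_norm (X y n)" for y n by blast+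
  define d where "d y n = (\<lambda>k. complex_of_real ((1/3)^n / ell2_norm (X y n)) * X y n k)" for y n
  define Y where "Y = rec_nat (\<lambda>_. 0) (\<lambda>n y k. y k + d y n k)"
  have Y0: "Y 0 = (\<lambda>_. 0)" by (simp add: Y_def)
  have YS: "Y (Suc n) = (\<lambda>k. Y n k + d (Y n) n k)" for n by (simp add: Y_def)
  have Xe: "X y n \<in> ell2" for y n using X(1) S by blast
  have de: "d y n \<in> ell2" for y n
    unfolding d_def by (rule ell2_scale[OF Xe])
  have Ye: "Y n \<in> ell2" for n
  proof (induction n)
    case 0
    show ?case by (simp add: Y0 ell2_def)
  next
    case (Suc n)
    then show ?case by (simp add: YS ell2_add de)
  qed
  have Xpos: "0 < ell2_norm (X (Y n) n)" for n
  proof -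
    have "0 \<le> 2 * 3 ^ n * (B (Y n) + real n)" using B0[OF Ye[of n]] by simp
    then show ?thesis using X(2)[of n "Y n"] by linarith
  qed
  have dn: "ell2_norm (d (Y n) n) = (1/3)^n" for n
    unfolding d_def using Xpos[of n] by (subst ell2_norm_scale[OF Xe]) (simp add: norm_divide norm_power)
  have step: "L2_set (\<lambda>k. cmod (Y (n + m) k - Y n k)) {..<N} \<le> 3/2 * ((1/3)^n - (1/3)^(n+m))" for n m N
  proof (induction m)
    case (Suc m)
    have "L2_set (\<lambda>k. cmod (Y (n + Suc m) k - Y n k)) {..<N} \<le>
        L2_set (\<lambda>k. cmod (Y (n + m) k - Y n k) + cmod (d (Y (n+m)) (n+m) k)) {..<N}"
    proof (intro L2_set_mono)
      fix k
      have "Y (n + Suc m) k - Y n k = (Y (n + m) k - Y n k) + d (Y (n+m)) (n+m) k"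
        by (simp add: YS)
      then show "cmod (Y (n + Suc m) k - Y n k) \<le> cmod (Y (n + m) k - Y n k) + cmod (d (Y (n+m)) (n+m) k)"
        by (metis norm_triangle_ineq)
    qed auto
    also have "\<dots> \<le> L2_set (\<lambda>k. cmod (Y (n + m) k - Y n k)) {..<N} + L2_set (\<lambda>k. cmod (d (Y (n+m)) (n+m) k)) {..<N}"
      by (rule L2_set_triangle_ineq)
    also have "\<dots> \<le> 3/2 * ((1/3)^n - (1/3)^(n+m)) + (1/3)^(n+m)"
      using Suc L2_set_le_ell2_norm[OF de] dn by (metis add_mono)
    finally show ?case by (simp add: field_simps)
  qed (simp add: L2_set_def)
  have step': "L2_set (\<lambda>k. cmod (Y (n + m) k - Y n k)) {..<N} \<le> 3/2 * (1/3)^n" for n m N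
    by (rule order_trans[OF step]) simp
  have coord: "cmod (Y (n + m) k - Y n k) \<le> 3/2 * (1/3)^n" for n m k
    using member_le_L2_set[of "{..<Suc k}" k "\<lambda>k. cmod (Y (n + m) k - Y n k)"] step'[of n m "Suc k"]
    by (simp add: order_trans)
  have "Cauchy (\<lambda>n. Y n k)" for k
  proof (rule CauchyI')
    fix e :: real assume "0 < e"
    have "(\<lambda>n. (1/3)^n :: real) \<longlonglongrightarrow> 0" by (rule LIMSEQ_power_zero) simp
    from tendsto_mult_left[OF this, of "3/2"]
    have lim: "(\<lambda>n. 3/2 * (1/3)^n :: real) \<longlonglongrightarrow> 0" by (simp only: mult_zero_right)
    have "\<forall>\<^sub>F n in sequentially. 3/2 * (1/3)^n < e"
      by (rule order_tendstoD(2)[OF lim \<open>0 < e\<close>])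
    then obtain M where M: "\<And>n. M \<le> n \<Longrightarrow> 3/2 * (1/3)^n < e" by (auto simp: eventually_sequentially)
    have "norm (Y m k - Y n k) < e" if "M \<le> m" "m < n" for m n
      using coord[of m "n - m" k] M[OF that(1)] that(2) by (simp add: norm_minus_commute)
    then show "\<exists>M. \<forall>m\<ge>M. \<forall>n>m. dist (Y m k) (Y n k) < e" by (auto simp: dist_norm)
  qed
  then obtain y where y: "\<And>k. (\<lambda>n. Y n k) \<longlonglongrightarrow> y k"
    unfolding Cauchy_convergent_iff convergent_def by metis
  have tail: "L2_set (\<lambda>k. cmod (y k - Y n k)) {..<N} \<le> 3/2 * (1/3)^n" for n N
  proof (rule tendsto_upperbound)
    have "(\<lambda>m. Y (n + m) k) \<longlonglongrightarrow> y k" for k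
      using LIMSEQ_ignore_initial_segment[OF y[of k], of n] by (simp add: add.commute)
    then show "(\<lambda>m. L2_set (\<lambda>k. cmod (Y (n + m) k - Y n k)) {..<N}) \<longlonglongrightarrow> L2_set (\<lambda>k. cmod (y k - Y n k)) {..<N}"
      unfolding L2_set_def by (intro tendsto_intros)
  qed (use step' in auto)
  have re: "(\<lambda>k. y k - Y n k) \<in> ell2" and rn: "ell2_norm (\<lambda>k. y k - Y n k) \<le> 3/2 * (1/3)^n" for n
    using ell2_of_L2_set_bounded[OF tail] by blast+
  have ye: "y \<in> ell2" using re[of 0] by (simp add: Y0)
  have "real n \<le> B y" for n
  proof -
    let ?x = "X (Y n) n"
    let ?r = "\<lambda>k. y k - Y (Suc n) k"
    have "y = (\<lambda>k. (Y n k + d (Y n) n k) + ?r k)" by (simp add: YS)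
    then have "ell2_inner ?x y = ell2_inner ?x (\<lambda>k. (Y n k + d (Y n) n k) + ?r k)" by simp
    also have "\<dots> = ell2_inner ?x (Y n) + ell2_inner ?x (d (Y n) n) + ell2_inner ?x ?r"
      using ell2_inner_add_right[OF Xe ell2_add[OF Ye de] re, of "Y n" n n "Y n" n "Suc n"]
        ell2_inner_add_right[OF Xe Ye de, of "Y n" n n "Y n" n] by simp
    finally have eq: "ell2_inner ?x (d (Y n) n) = ell2_inner ?x y - ell2_inner ?x (Y n) - ell2_inner ?x ?r"
      by simp
    have "ell2_inner ?x (d (Y n) n) = of_real ((1/3)^n * ell2_norm ?x)"
      unfolding d_def using Xpos[of n]
      by (subst ell2_inner_scale_self[OF Xe]) (simp add: power2_eq_square)
    then have "(1/3)^n * ell2_norm ?x = cmod (ell2_inner ?x (d (Y n) n))"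
      using Xpos[of n] by (simp add: norm_mult norm_power)
    also have "\<dots> \<le> cmod (ell2_inner ?x y) + cmod (ell2_inner ?x (Y n)) + cmod (ell2_inner ?x ?r)"
      unfolding eq by (intro order_trans[OF norm_triangle_ineq4] add_right_mono norm_triangle_ineq4)
    also have "\<dots> \<le> B y + B (Y n) + ell2_norm ?x * (3/2 * (1/3)^Suc n)"
      using B[OF ye X(1)] B[OF Ye X(1)] ell2_Cauchy_Schwarz(2)[OF Xe re, of "Y n" n "Suc n"]
        mult_left_mono[OF rn[of "Suc n"] ell2_norm_nonneg[OF Xe[of "Y n" n]]]
      by (meson add_mono order_trans)
    finally have "(1/3)^n * ell2_norm ?x / 2 \<le> B y + B (Y n)" by (simp add: algebra_simps)
    moreover have "B (Y n) + real n < (1/3)^n * ell2_norm ?x / 2"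
      using X(2)[of n "Y n"] by (simp add: field_simps)
    ultimately show ?thesis by linarith
  qed
  then show False using reals_Archimedean2[of "B y"] by (meson not_le)
qed

section \<open>Fejer means of integrable functions\<close>

lemma cis_measurable [measurable]: "cis \<in> borel_measurable borel"
  by (intro borel_measurable_continuous_onI continuous_on_cis continuous_on_id)

lemma cnj_measurable [measurable]: "cnj \<in> borel_measurable borel"
  by (intro borel_measurable_continuous_onI continuous_intros)

lemma borel_measurable_freqI: "g \<in> borel_measurable freq" if "g \<in> borel_measurable borel"
  by (rule measurable_restrict_space1) (use that in simp)

lemma freq_cis_measurable [measurable]:
  "(\<lambda>t. cis (t * x)) \<in> borel_measurable freq" "(\<lambda>t. cis (- t * x)) \<in> borel_measurable freq"
  "(\<lambda>t. cis (- (t * x))) \<in> borel_measurable freq" "(\<lambda>t. cis (- (x * t))) \<in> borel_measurable freq"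
  by ((rule borel_measurable_freqI; measurable))+

lemma space_freq: "space freq = {-pi..<pi}"
  by (simp add: space_restrict_space)

lemma emeasure_freq: "emeasure freq (space freq) = ennreal (2 * pi)"
  by (simp add: space_freq emeasure_restrict_space)

lemma finite_measure_freq: "finite_measure freq"
  by (rule finite_measureI) (simp only: emeasure_freq infinity_ennreal_def ennreal_neq_top not_False_eq_True)

interpretation freq: finite_measure freq
  by (rule finite_measure_freq)

lemma measure_freq: "measure freq (space freq) = 2 * pi"
  unfolding measure_def by (simp only: emeasure_freq) simp

lemma freq_measurable_continuous:
  assumes "continuous_on UNIV g"
  shows "g \<in> borel_measurable freq"
  by (rule measurable_restrict_space1) (use assms in \<open>simp add: borel_measurable_continuous_onI\<close>)

lemma AE_freq_iff: "(AE t in freq. P t) \<longleftrightarrow> (AE t in lborel. t \<in> {-pi..<pi} \<longrightarrow> P t)"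
  by (subst AE_restrict_space_iff) auto

lemma AE_freq_interior: "AE t in freq. -pi < t \<and> t < pi"
  unfolding AE_freq_iff using AE_lborel_singleton[of "-pi"] by eventually_elim auto

lemma freq_integrable_bounded:
  fixes \<phi> :: "real \<Rightarrow> 'b::{banach, second_countable_topology}"
  assumes "\<phi> \<in> borel_measurable freq" "AE t in freq. norm (\<phi> t) \<le> B"
  shows "integrable freq \<phi>"
  using assms by (rule freq.integrable_const_bound[rotated])

lemma integrable_mult_bounded:
  fixes \<phi> :: "'a \<Rightarrow> 'b::{banach, second_countable_topology, real_normed_algebra}"
  assumes "integrable M \<phi>" and [measurable]: "\<psi> \<in> borel_measurable M"
    and "AE t in M. norm (\<psi> t) \<le> B"
  shows "integrable M (\<lambda>t. \<psi> t * \<phi> t)"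
proof (rule Bochner_Integration.integrable_bound)
  show "integrable M (\<lambda>t. B *\<^sub>R norm (\<phi> t))" using assms(1) by simp
  show "(\<lambda>t. \<psi> t * \<phi> t) \<in> borel_measurable M" using assms(1) by simp
  show "AE t in M. norm (\<psi> t * \<phi> t) \<le> norm (B *\<^sub>R norm (\<phi> t))"
    using assms(3)
  proof eventually_elim
    case (elim t)
    have "norm (\<psi> t * \<phi> t) \<le> norm (\<psi> t) * norm (\<phi> t)" by (rule norm_mult_ineq)
    also have "\<dots> \<le> B * norm (\<phi> t)" using elim by (rule mult_right_mono) simp
    finally show ?case by (simp add: abs_le_iff)
  qed
qed

lemma integral_cis_int: "(LINT t|freq. cis (t * of_int m)) = (if m = 0 then 2 * of_real pi else 0)"
proof (cases "m = 0")
  case True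
  then show ?thesis using measure_freq by (simp add: scaleR_conv_of_real)
next
  case False
  let ?F = "\<lambda>t. cis (t * of_int m) / (\<i> * of_int m)"
  have der: "(?F has_vector_derivative cis (t * of_int m)) (at t within A)" for t A
  proof -
    have "((\<lambda>z. exp (\<i> * of_int m * z) / (\<i> * of_int m)) has_field_derivative exp (\<i> * of_int m * of_real t)) (at (of_real t))"
      by (auto intro!: derivative_eq_intros simp: False)
    from has_vector_derivative_real_field[OF this, of A] show ?thesis
      by (simp add: cis_conv_exp mult_ac)
  qed
  have "(LINT t|freq. cis (t * of_int m)) = (LINT t|lborel. indicator {-pi..<pi} t *\<^sub>R cis (t * of_int m))"
    by (rule integral_restrict_space) simp
  also have "\<dots> = (LINT t|lborel. indicator {-pi..pi} t *\<^sub>R cis (t * of_int m))"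
  proof (rule integral_cong_AE)
    show "AE t in lborel. indicat_real {-pi..<pi} t *\<^sub>R cis (t * of_int m) = indicator {-pi..pi} t *\<^sub>R cis (t * of_int m)"
      using AE_lborel_singleton[of pi] by eventually_elim (auto simp: indicator_def)
  qed (simp_all add: measurable_lborel1)
  also have "\<dots> = ?F pi - ?F (-pi)"
    by (rule integral_FTC_Icc) (auto intro!: der continuous_intros)
  also have "cis (- (pi * of_int m)) = cis (pi * of_int m)"
  proof -
    have "sin (pi * of_int m) = 0" by (simp add: sin_zero_iff_int2 mult.commute)
    then show ?thesis by (simp add: complex_eq_iff)
  qed
  then have "?F pi - ?F (-pi) = 0" by simp
  finally show ?thesis using False by simp
qed

lemma integral_cis_diff:
  "(LINT t|freq. cis (t * real j) * cnj (cis (t * real k))) = (if j = k then 2 * of_real pi else 0)"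
proof -
  have "cis (t * real j) * cnj (cis (t * real k)) = cis (t * of_int (int j - int k))" for t
    by (simp add: cis_cnj cis_mult algebra_simps)
  then show ?thesis using integral_cis_int[of "int j - int k"] by simp
qed

lemma integrable_cis_prod: "integrable freq (\<lambda>t. cis (t * x) * cnj (cis (t * y)))"
  by (rule freq_integrable_bounded[where B = 1]) (measurable, simp add: norm_mult)

lemma trig_poly_integrable: "integrable freq (\<lambda>t. (cmod (\<Sum>k<n. c k * cis (t * real k)))\<^sup>2)"
proof (rule freq_integrable_bounded[where B = "(\<Sum>k<n. cmod (c k))\<^sup>2"])
  show "AE t in freq. norm ((cmod (\<Sum>k<n. c k * cis (t * real k)))\<^sup>2) \<le> (\<Sum>k<n. cmod (c k))\<^sup>2"
    by (intro always_eventually allI) (auto simp: norm_mult intro!: power_mono order_trans[OF norm_sum])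
qed measurable

lemma Parseval_finite:
  "(LINT t|freq. (cmod (\<Sum>k<n. c k * cis (t * real k)))\<^sup>2) = 2 * pi * (\<Sum>k<n. (cmod (c k))\<^sup>2)"
proof -
  have "complex_of_real (LINT t|freq. (cmod (\<Sum>k<n. c k * cis (t * real k)))\<^sup>2)
      = (LINT t|freq. of_real ((cmod (\<Sum>k<n. c k * cis (t * real k)))\<^sup>2))"
    by (rule integral_of_real[OF trig_poly_integrable, symmetric])
  also have "\<dots> = (LINT t|freq. (\<Sum>j<n. \<Sum>k<n. (c j * cnj (c k)) * (cis (t * real j) * cnj (cis (t * real k)))))"
    by (rule Bochner_Integration.integral_cong)
      (simp_all add: complex_norm_square sum_product cnj_sum mult_ac del: of_real_power)
  also have "\<dots> = (\<Sum>j<n. \<Sum>k<n. (c j * cnj (c k)) * (LINT t|freq. cis (t * real j) * cnj (cis (t * real k))))"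
    by (simp add: integrable_cis_prod Bochner_Integration.integral_sum
        del: complex_cnj_mult cis_cnj)
  also have "\<dots> = (\<Sum>j<n. \<Sum>k<n. if j = k then 2 * of_real pi * (c j * cnj (c k)) else 0)"
    by (intro sum.cong refl) (simp add: integral_cis_diff)
  also have "\<dots> = of_real (2 * pi * (\<Sum>k<n. (cmod (c k))\<^sup>2))"
    by (simp add: sum.delta complex_norm_square sum_distrib_left del: of_real_power)
  finally show ?thesis by (simp only: of_real_eq_iff)
qed

text \<open>
  The Fejer kernel, with integral \<open>2 * pi\<close> over a period when \<open>n > 0\<close>. As a squared modulus of a trigonometric
  polynomial it is a nonnegative test function, which is how it enters the proof that the sign of
  a symbol can be read off a quadratic form.
\<close>
definition fejer :: "nat \<Rightarrow> real \<Rightarrow> real" where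
  "fejer n x = (cmod (\<Sum>k<n. cis (x * real k)))\<^sup>2 / real n"

definition fejer_mean :: "nat \<Rightarrow> (real \<Rightarrow> complex) \<Rightarrow> real \<Rightarrow> complex" where
  "fejer_mean n h s = (LINT t|freq. of_real (fejer n (s - t)) * h t) / of_real (2 * pi)"

lemma fejer_nonneg: "0 \<le> fejer n x"
  by (simp add: fejer_def)

lemma fejer_measurable [measurable]: "fejer n \<in> borel_measurable borel"
  unfolding fejer_def by measurable

lemma freq_fejer_measurable [measurable]:
  "(\<lambda>t. fejer n (s - t)) \<in> borel_measurable freq" "(\<lambda>t. fejer n (t - s)) \<in> borel_measurable freq"
  by ((rule borel_measurable_freqI; measurable))+

lemma fejer_le: "fejer n x \<le> real n"
proof (cases "n = 0")
  case False
  have "cmod (\<Sum>k<n. cis (x * real k)) \<le> (\<Sum>k<n. cmod (cis (x * real k)))" by (rule norm_sum)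
  then have "cmod (\<Sum>k<n. cis (x * real k)) \<le> real n" by simp
  then have "(cmod (\<Sum>k<n. cis (x * real k)))\<^sup>2 \<le> (real n)\<^sup>2" by (intro power_mono) auto
  then show ?thesis using False unfolding fejer_def by (simp add: field_simps power2_eq_square)
qed (simp add: fejer_def)

lemma fejer_minus: "fejer n (- x) = fejer n x"
proof -
  have "(\<Sum>k<n. cis (- x * real k)) = cnj (\<Sum>k<n. cis (x * real k))"
    by (simp add: cnj_sum cis_cnj)
  then show ?thesis unfolding fejer_def by (metis complex_mod_cnj)
qed

text \<open>
  For fixed \<open>s\<close> the kernel is, in the variable \<open>t\<close>, again a squared modulus of a trigonometric
  polynomial, with unimodular coefficients depending on \<open>s\<close>.
\<close>
lemma fejer_shift: "fejer n (s - t) = (cmod (\<Sum>k<n. cis (- s * real k) * cis (t * real k)))\<^sup>2 / real n"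
proof -
  have "fejer n (s - t) = fejer n (t - s)" using fejer_minus[of n "t - s"] by simp
  then show ?thesis by (simp add: fejer_def cis_mult algebra_simps)
qed

lemma fejer_integral:
  assumes "0 < n"
  shows "(LINT t|freq. fejer n (s - t)) = 2 * pi" "(LINT t|freq. fejer n (t - s)) = 2 * pi"
proof -
  show 1: "(LINT t|freq. fejer n (s - t)) = 2 * pi"
    unfolding fejer_shift using Parseval_finite[of "\<lambda>k. cis (- s * real k)" n] assms by simp
  have "fejer n (t - s) = fejer n (s - t)" for t using fejer_minus[of n "s - t"] by simp
  then show "(LINT t|freq. fejer n (t - s)) = 2 * pi" using 1 by presburger
qed

text \<open>
  Summing the geometric series shows that the kernel is of order \<open>1 / n\<close> away from the origin.
\<close>
lemma fejer_le_away:
  assumes "cis x \<noteq> 1"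
  shows "fejer n x \<le> 4 / (real n * (cmod (cis x - 1))\<^sup>2)"
proof (cases "n = 0")
  case False
  have "(cis x - 1) * (\<Sum>k<n. cis (x * real k)) = cis x ^ n - 1"
    using power_diff_1_eq[of "cis x" n] by (simp add: Complex.DeMoivre mult.commute)
  then have "cmod (cis x - 1) * cmod (\<Sum>k<n. cis (x * real k)) = cmod (cis x ^ n - 1)"
    by (metis norm_mult)
  also have "\<dots> \<le> 2"
    using norm_triangle_ineq4[of "cis x ^ n" 1] by (simp add: norm_power)
  finally have "(cmod (cis x - 1) * cmod (\<Sum>k<n. cis (x * real k)))\<^sup>2 \<le> 2\<^sup>2"
    by (intro power_mono) auto
  then show ?thesis using False assms unfolding fejer_def
    by (simp add: field_simps power_mult_distrib)
qed (simp add: fejer_def)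

lemma fejer_integrable: "integrable freq (\<lambda>t. fejer n (s - t))"
  by (rule freq_integrable_bounded[where B = "real n"])
    (auto simp: fejer_nonneg fejer_le)

lemma fejer_mult_integrable:
  fixes h :: "real \<Rightarrow> complex"
  shows "integrable freq h \<Longrightarrow> integrable freq (\<lambda>t. of_real (fejer n (s - t)) * h t)"
  by (rule integrable_mult_bounded[where B = "real n"])
    (auto simp: fejer_nonneg fejer_le)

text \<open>
  The kernel has total mass one and is of order \<open>1 / n\<close> away from \<open>s\<close>. Closeness of \<open>t\<close> to \<open>s\<close> is
  measured on the circle, by \<open>cis\<close>, since the kernel only sees the points of the circle.
\<close>
lemma fejer_mean_tendsto:
  assumes [measurable]: "h \<in> borel_measurable freq"
    and B: "AE t in freq. cmod (h t) \<le> B" "cmod (h s) \<le> B"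
    and cont: "\<And>e. 0 < e \<Longrightarrow> \<exists>d>0. AE t in freq. cmod (cis t - cis s) < d \<longrightarrow> cmod (h t - h s) \<le> e"
  shows "(\<lambda>n. fejer_mean n h s) \<longlonglongrightarrow> h s"
proof (rule LIMSEQ_I)
  fix r :: real assume r: "0 < r"
  have B0: "0 \<le> B" using B(2) by (meson norm_ge_zero order_trans)
  obtain d where d: "0 < d" "AE t in freq. cmod (cis t - cis s) < d \<longrightarrow> cmod (h t - h s) \<le> r / 2"
    using cont[of "r/2"] r by auto
  obtain N where N: "16 * B / (r * d\<^sup>2) < real N" using reals_Archimedean2 by blast
  have "cmod (fejer_mean n h s - h s) < r" if n: "max 1 N \<le> n" for n
  proof -
    have n0: "0 < n" using n by simp
    have ih: "integrable freq h" using B(1) by (rule freq_integrable_bounded[rotated]) measurable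
    let ?g = "\<lambda>t. of_real (fejer n (s - t)) * (h t - h s)"
    have ig: "integrable freq ?g" using ih by (intro fejer_mult_integrable) simp
    have "(LINT t|freq. ?g t) = (LINT t|freq. of_real (fejer n (s - t)) * h t) - (LINT t|freq. of_real (fejer n (s - t)) * h s)"
      using fejer_mult_integrable[OF ih, of n s] fejer_mult_integrable[of "\<lambda>_. h s" n s]
      by (simp add: right_diff_distrib)
    also have "(LINT t|freq. of_real (fejer n (s - t)) * h s) = of_real (2 * pi) * h s"
      using fejer_integral(1)[OF n0, of s] by (simp add: integral_of_real)
    finally have eq: "fejer_mean n h s - h s = (LINT t|freq. ?g t) / of_real (2 * pi)"
      by (simp add: fejer_mean_def field_simps)
    let ?c = "8 * B / (real n * d\<^sup>2)"
    have "cmod (LINT t|freq. ?g t) \<le> (LINT t|freq. cmod (?g t))" by (rule integral_norm_bound)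
    also have "\<dots> \<le> (LINT t|freq. fejer n (s - t) * (r / 2) + ?c)"
    proof (rule integral_mono_AE)
      show "integrable freq (\<lambda>t. cmod (?g t))" using ig by simp
      show "integrable freq (\<lambda>t. fejer n (s - t) * (r / 2) + ?c)"
        using fejer_integrable[of n s] by simp
      show "AE t in freq. cmod (?g t) \<le> fejer n (s - t) * (r / 2) + ?c"
        using d(2) B(1)
      proof eventually_elim
        case (elim t)
        have g: "cmod (?g t) = fejer n (s - t) * cmod (h t - h s)"
          by (simp add: norm_mult fejer_nonneg)
        have c0: "0 \<le> ?c" using B0 by simp
        show ?case
        proof (cases "cmod (cis t - cis s) < d")
          case True
          then show ?thesis using elim c0 fejer_nonneg[of n "s - t"] g
                mult_left_mono[of "cmod (h t - h s)" "r/2" "fejer n (s - t)"] by linarith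
        next
          case False
          have "cis (s - t) - 1 = cis (- t) * (cis s - cis t)"
            by (simp add: right_diff_distrib cis_mult)
          then have eq: "cmod (cis (s - t) - 1) = cmod (cis t - cis s)"
            by (simp add: norm_mult norm_minus_commute)
          then have ge: "d \<le> cmod (cis (s - t) - 1)" using False by simp
          then have ne: "cis (s - t) \<noteq> 1" using d(1) by auto
          have "fejer n (s - t) \<le> 4 / (real n * (cmod (cis (s - t) - 1))\<^sup>2)" by (rule fejer_le_away[OF ne])
          also have "\<dots> \<le> 4 / (real n * d\<^sup>2)"
            using ge d(1) n0 by (intro divide_left_mono mult_left_mono power_mono mult_pos_pos zero_less_power) auto
          finally have F: "fejer n (s - t) \<le> 4 / (real n * d\<^sup>2)" .
          have "cmod (h t - h s) \<le> 2 * B"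
            using norm_triangle_ineq4[of "h t" "h s"] elim B(2) by linarith
          then have "fejer n (s - t) * cmod (h t - h s) \<le> 4 / (real n * d\<^sup>2) * (2 * B)"
            by (intro mult_mono F) auto
          moreover have "0 \<le> fejer n (s - t) * (r / 2)" using fejer_nonneg[of n "s - t"] r by simp
          ultimately show ?thesis using g by simp
        qed
      qed
    qed
    also have "\<dots> = 2 * pi * (r / 2) + 2 * pi * ?c"
      using fejer_integrable[of n s] fejer_integral(1)[OF n0, of s] measure_freq
      by (subst Bochner_Integration.integral_add) auto
    also have "\<dots> < 2 * pi * (r / 2) + 2 * pi * (r / 2)"
    proof -
      have "16 * B < r * d\<^sup>2 * real n"
      proof -
        have "16 * B / (r * d\<^sup>2) < real n" using N n by linarith
        then show ?thesis using r d(1) by (simp add: field_simps)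
      qed
      then have "?c < r / 2" using n0 d(1) by (simp add: field_simps)
      then show ?thesis by (intro add_strict_left_mono mult_strict_left_mono) auto
    qed
    finally have "cmod (LINT t|freq. ?g t) < r * (2 * pi)" by (simp add: mult_ac)
    then show ?thesis unfolding eq by (simp add: norm_divide pos_divide_less_eq mult_ac)
  qed
  then show "\<exists>no. \<forall>n\<ge>no. norm (fejer_mean n h s - h s) < r" by blast
qed

text \<open>
  At an interior point of the interval, \<open>Arg\<close> recovers \<open>t\<close> from \<open>cis t\<close> continuously, so closeness
  on the circle gives closeness on the line.
\<close>
lemma fejer_mean_tendsto_continuous:
  assumes g: "continuous_on UNIV g" and B: "\<And>t. cmod (g t) \<le> B" and s: "-pi < s" "s < pi"
  shows "(\<lambda>n. fejer_mean n g s) \<longlonglongrightarrow> g s"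
proof (rule fejer_mean_tendsto)
  fix e :: real assume e: "0 < e"
  have "cis s \<notin> \<real>\<^sub>\<le>\<^sub>0"
  proof
    assume "cis s \<in> \<real>\<^sub>\<le>\<^sub>0"
    then have "Im (cis s) = 0" "Re (cis s) < 0"
      using cis_neq_zero[of s] by (auto simp: complex_nonpos_Reals_iff complex_eq_iff less_eq_real_def)
    then have "Arg (cis s) = pi" by (simp only: Arg_eq_pi)
    then show False using Arg_cis[of s] s by simp
  qed
  then have "isCont Arg (cis s)" by (rule continuous_at_Arg)
  moreover have "isCont g (Arg (cis s))" using g by (simp add: continuous_on_eq_continuous_at)
  ultimately have "isCont (\<lambda>z. g (Arg z)) (cis s)" by (rule isCont_o2)
  then obtain d where d: "0 < d" "\<And>z. dist z (cis s) < d \<Longrightarrow> dist (g (Arg z)) (g (Arg (cis s))) < e"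
    unfolding continuous_at_eps_delta using e by blast
  have "AE t in freq. cmod (cis t - cis s) < d \<longrightarrow> cmod (g t - g s) \<le> e"
    using AE_freq_interior
  proof eventually_elim
    case (elim t)
    then show ?case using d(2)[of "cis t"] s by (auto simp: Arg_cis dist_norm)
  qed
  then show "\<exists>d>0. AE t in freq. cmod (cis t - cis s) < d \<longrightarrow> cmod (g t - g s) \<le> e"
    using d(1) by blast
qed (use B g in \<open>auto intro: freq_measurable_continuous\<close>)

text \<open>
  Radial projection onto the disc of radius \<open>m\<close>; it makes functions bounded and keeps continuity.
\<close>
definition clip :: "real \<Rightarrow> complex \<Rightarrow> complex" where
  "clip m z = z / of_real (max 1 (cmod z / m))"

lemma clip_continuous: "continuous_on UNIV (clip m)" if "0 < m"
  unfolding clip_def using that by (intro continuous_intros) (auto simp: max_def)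

lemma cmod_clip_le: "cmod (clip m z) \<le> m" "cmod (clip m z) \<le> cmod z" if "0 < m"
  using that by (auto simp: clip_def norm_divide max_def field_simps)

lemma clip_eq: "clip m z = z" if "0 < m" "cmod z \<le> m"
  using that by (auto simp: clip_def max_def field_simps)

lemma clip_measurable [measurable]: "0 < m \<Longrightarrow> clip m \<in> borel_measurable borel"
  by (intro borel_measurable_continuous_onI clip_continuous)

text \<open>
  A measurable function is almost everywhere a limit of continuous functions. Clipping these
  functions, and \<open>h\<close> itself, at a high level \<open>m\<close> supplies the constant needed for dominated
  convergence.
\<close>
lemma L1_approx_bounded_continuous:
  fixes h :: "real \<Rightarrow> complex"
  assumes h: "integrable freq h" and e: "0 < e"
  shows "\<exists>g B. continuous_on UNIV g \<and> (\<forall>t. cmod (g t) \<le> B) \<and> (LINT t|freq. cmod (h t - g t)) < e"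
proof -
  have hm [measurable]: "h \<in> borel_measurable freq" using h by simp
  have "(\<lambda>m. LINT t|freq. cmod (h t - clip (real (Suc m)) (h t))) \<longlonglongrightarrow> (LINT t|freq. 0)"
  proof (rule integral_dominated_convergence[where w = "\<lambda>t. 2 * cmod (h t)"])
    show "AE t in freq. (\<lambda>m. cmod (h t - clip (real (Suc m)) (h t))) \<longlonglongrightarrow> 0"
    proof (rule AE_I2)
      fix t
      obtain N where "cmod (h t) < real N" using reals_Archimedean2 by blast
      then have "\<forall>\<^sub>F m in sequentially. cmod (h t - clip (real (Suc m)) (h t)) = 0"
        unfolding eventually_sequentially by (intro exI[of _ N]) (auto intro!: clip_eq[symmetric])
      then show "(\<lambda>m. cmod (h t - clip (real (Suc m)) (h t))) \<longlonglongrightarrow> 0"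
        by (rule tendsto_eventually)
    qed
    show "AE t in freq. norm (cmod (h t - clip (real (Suc m)) (h t))) \<le> 2 * cmod (h t)" for m
    proof (rule AE_I2)
      fix t
      show "norm (cmod (h t - clip (real (Suc m)) (h t))) \<le> 2 * cmod (h t)"
        using cmod_clip_le(2)[of "real (Suc m)" "h t"] norm_triangle_ineq4[of "h t" "clip (real (Suc m)) (h t)"]
        by simp
    qed
  qed (use h in auto)
  then have "(\<lambda>m. LINT t|freq. cmod (h t - clip (real (Suc m)) (h t))) \<longlonglongrightarrow> 0" by simp
  then have "\<forall>\<^sub>F m in sequentially. (LINT t|freq. cmod (h t - clip (real (Suc m)) (h t))) < e / 2"
    using e by (intro order_tendstoD(2)) auto
  then obtain m0 where "(LINT t|freq. cmod (h t - clip (real (Suc m0)) (h t))) < e / 2"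
    using eventually_happens' by force
  then obtain m :: real where m: "0 < m" and em: "(LINT t|freq. cmod (h t - clip m (h t))) < e / 2"
    by (metis of_nat_0_less_iff zero_less_Suc)
  have "h measurable_on {-pi..<pi}"
  proof -
    have "(\<lambda>t. indicator {-pi..<pi} t *\<^sub>R h t) \<in> borel_measurable borel"
      using h integrable_restrict_space[of "{-pi..<pi}" lborel h] by (auto dest: borel_measurable_integrable)
    then have "(\<lambda>t. indicator {-pi..<pi} t *\<^sub>R h t) \<in> borel_measurable lebesgue"
      by (simp add: measurable_completion)
    moreover have "(\<lambda>t. indicator {-pi..<pi} t *\<^sub>R h t) = (\<lambda>t. if t \<in> {-pi..<pi} then h t else 0)"
      by (auto simp: fun_eq_iff)
    ultimately have "(\<lambda>t. if t \<in> {-pi..<pi} then h t else 0) measurable_on UNIV"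
      using lebesgue_measurable_imp_measurable_on by force
    then show ?thesis by (simp only: measurable_on_UNIV)
  qed
  then obtain N G where N: "negligible N" and G: "\<And>n. continuous_on UNIV (G n)"
    and lim: "\<And>x. x \<notin> N \<Longrightarrow> (\<lambda>n. G n x) \<longlonglongrightarrow> (if x \<in> {-pi..<pi} then h x else 0)"
    unfolding measurable_on_def by blast
  have "AE x in lebesgue. x \<notin> N"
    using N AE_not_in by (auto simp: negligible_iff_null_sets)
  then have "AE x in lborel. x \<notin> N" by (simp add: AE_completion_iff)
  then have AElim: "AE t in freq. (\<lambda>n. G n t) \<longlonglongrightarrow> h t"
    unfolding AE_freq_iff by eventually_elim (use lim in force)
  have Gm [measurable]: "G n \<in> borel_measurable freq" for n
    by (rule freq_measurable_continuous[OF G])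
  have "(\<lambda>n. LINT t|freq. cmod (clip m (h t) - clip m (G n t))) \<longlonglongrightarrow> (LINT t|freq. 0)"
  proof (rule integral_dominated_convergence[where w = "\<lambda>t. 2 * m"])
    show "AE t in freq. (\<lambda>n. cmod (clip m (h t) - clip m (G n t))) \<longlonglongrightarrow> 0"
      using AElim
    proof eventually_elim
      case (elim t)
      have "isCont (clip m) (h t)"
        using clip_continuous[OF m] by (simp add: continuous_on_eq_continuous_at)
      then have "(\<lambda>n. clip m (G n t)) \<longlonglongrightarrow> clip m (h t)" using elim by (rule isCont_tendsto_compose)
      then have "(\<lambda>n. cmod (clip m (h t) - clip m (G n t))) \<longlonglongrightarrow> cmod (clip m (h t) - clip m (h t))"
        by (intro tendsto_intros)
      then show ?case by simp
    qed
    show "AE t in freq. norm (cmod (clip m (h t) - clip m (G n t))) \<le> 2 * m" for n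
    proof (rule AE_I2)
      fix t
      show "norm (cmod (clip m (h t) - clip m (G n t))) \<le> 2 * m"
        using cmod_clip_le(1)[OF m, of "h t"] cmod_clip_le(1)[OF m, of "G n t"]
          norm_triangle_ineq4[of "clip m (h t)" "clip m (G n t)"] by simp
    qed
  qed (use m in measurable)
  then have "(\<lambda>n. LINT t|freq. cmod (clip m (h t) - clip m (G n t))) \<longlonglongrightarrow> 0" by simp
  then have "\<forall>\<^sub>F n in sequentially. (LINT t|freq. cmod (clip m (h t) - clip m (G n t))) < e / 2"
    using e by (intro order_tendstoD(2)) auto
  then obtain n where en: "(LINT t|freq. cmod (clip m (h t) - clip m (G n t))) < e / 2"
    using eventually_happens' by force
  let ?g = "\<lambda>t. clip m (G n t)"
  have gm [measurable]: "?g \<in> borel_measurable freq" "(\<lambda>t. clip m (h t)) \<in> borel_measurable freq"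
    using m by measurable
  have ig: "integrable freq ?g" "integrable freq (\<lambda>t. clip m (h t))"
    by (rule freq_integrable_bounded[where B = m]; use m cmod_clip_le in simp)+
  have "(LINT t|freq. cmod (h t - ?g t)) \<le> (LINT t|freq. cmod (h t - clip m (h t)) + cmod (clip m (h t) - ?g t))"
  proof (rule integral_mono)
    show "cmod (h t - ?g t) \<le> cmod (h t - clip m (h t)) + cmod (clip m (h t) - ?g t)" for t
      using norm_triangle_ineq[of "h t - clip m (h t)" "clip m (h t) - ?g t"] by simp
  qed (use h ig in auto)
  also have "\<dots> < e"
    using h ig em en by (subst Bochner_Integration.integral_add) auto
  finally have "(LINT t|freq. cmod (h t - ?g t)) < e" .
  moreover have "continuous_on UNIV ?g"
    using continuous_on_compose2[OF clip_continuous[OF m] G] by auto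
  ultimately show ?thesis using cmod_clip_le(1)[OF m] by blast
qed

definition fourier_coeff :: "(real \<Rightarrow> complex) \<Rightarrow> real \<Rightarrow> complex" where
  "fourier_coeff h x = (LINT t|freq. cis (- t * x) * h t) / of_real (2 * pi)"

lemma cis_mult_integrable:
  "integrable freq (\<lambda>t. cis (- t * x) * h t)" "integrable freq (\<lambda>t. cis (t * x) * h t)"
  if "integrable freq h"
  by (rule integrable_mult_bounded[where B = 1]; use that in simp)+

text \<open>
  Shows that a Fejer mean is a trigonometric polynomial and which coefficients of \<open>h\<close> enter it.
\<close>
lemma fejer_mean_eq:
  assumes h: "integrable freq h"
  shows "fejer_mean n h s =
    (\<Sum>j<n. \<Sum>k<n. cis (s * (real j - real k)) * fourier_coeff h (real j - real k)) / of_nat n"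
proof -
  have F: "complex_of_real (fejer n x) = (\<Sum>j<n. \<Sum>k<n. cis (x * (real j - real k))) / of_nat n" for x
    unfolding fejer_def
    by (simp add: complex_norm_square sum_product cnj_sum cis_cnj cis_mult right_diff_distrib
        del: of_real_power)
  have "(LINT t|freq. of_real (fejer n (s - t)) * h t)
      = (LINT t|freq. (\<Sum>j<n. \<Sum>k<n. cis (s * (real j - real k)) / of_nat n * (cis (- t * (real j - real k)) * h t)))"
    by (rule Bochner_Integration.integral_cong)
      (simp_all add: F sum_divide_distrib sum_distrib_right cis_mult mult.assoc[symmetric] left_diff_distrib)
  also have "\<dots> = (\<Sum>j<n. \<Sum>k<n. cis (s * (real j - real k)) / of_nat n * (LINT t|freq. cis (- t * (real j - real k)) * h t))"
    using cis_mult_integrable(1)[OF h]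
    by (simp add: Bochner_Integration.integral_sum del: mult_minus_left)
  finally show ?thesis unfolding fejer_mean_def fourier_coeff_def
    by (simp add: sum_divide_distrib mult.commute)
qed

lemma fejer_mean_measurable [measurable]:
  "integrable freq h \<Longrightarrow> fejer_mean n h \<in> borel_measurable freq"
  by (rule measurable_cong[THEN iffD2, OF fejer_mean_eq]) measurable

lemma fejer_mean_bounded:
  assumes h: "integrable freq h" and B: "AE t in freq. cmod (h t) \<le> B" "0 \<le> B"
  shows "cmod (fejer_mean n h s) \<le> B"
proof (cases "n = 0")
  case False
  have "cmod (LINT t|freq. of_real (fejer n (s - t)) * h t) \<le> (LINT t|freq. cmod (of_real (fejer n (s - t)) * h t))"
    by (rule integral_norm_bound)
  also have "\<dots> \<le> (LINT t|freq. fejer n (s - t) * B)"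
  proof (rule integral_mono_AE)
    show "AE t in freq. cmod (of_real (fejer n (s - t)) * h t) \<le> fejer n (s - t) * B"
      using B(1) by eventually_elim (simp add: norm_mult fejer_nonneg mult_left_mono)
  qed (use fejer_mult_integrable[OF h] fejer_integrable in auto)
  also have "\<dots> = 2 * pi * B" using fejer_integral(1)[of n s] False by simp
  finally show ?thesis unfolding fejer_mean_def by (simp add: norm_divide pos_divide_le_eq mult_ac)
qed (use B in \<open>simp add: fejer_mean_def fejer_def\<close>)

lemma fejer_mean_integrable: "integrable freq h \<Longrightarrow> integrable freq (fejer_mean n h)"
proof (subst Bochner_Integration.integrable_cong[OF refl fejer_mean_eq])
  show "integrable freq (\<lambda>s. (\<Sum>j<n. \<Sum>k<n. cis (s * (real j - real k)) * fourier_coeff h (real j - real k)) / of_nat n)"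
    using freq_integrable_bounded[of "\<lambda>t. cis (t * x)" 1 for x] by (intro integrable_divide integrable_sum integrable_mult_left) simp
qed

text \<open>
  By Tonelli the integral over \<open>s\<close> falls on the kernel alone, whose integral is \<open>2 * pi\<close>.
\<close>
lemma fejer_mean_L1_contraction:
  assumes h: "integrable freq h"
  shows "(LINT s|freq. cmod (fejer_mean n h s)) \<le> (LINT t|freq. cmod (h t))"
proof (cases "n = 0")
  case False
  have hm [measurable]: "h \<in> borel_measurable freq" using h by simp
  interpret pair_sigma_finite freq freq ..
  have id [measurable]: "(\<lambda>t. t) \<in> freq \<rightarrow>\<^sub>M borel" by (rule borel_measurable_freqI) simp
  have [measurable]: "(\<lambda>p. fejer n (fst p - snd p)) \<in> borel_measurable (freq \<Otimes>\<^sub>M freq)"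
  proof -
    have "fst \<in> freq \<Otimes>\<^sub>M freq \<rightarrow>\<^sub>M borel" "snd \<in> freq \<Otimes>\<^sub>M freq \<rightarrow>\<^sub>M borel"
      using measurable_compose[OF measurable_fst id] measurable_compose[OF measurable_snd id] by auto
    then have "(\<lambda>p. fst p - snd p) \<in> borel_measurable (freq \<Otimes>\<^sub>M freq)" by (rule borel_measurable_diff)
    then show ?thesis by (rule measurable_compose[OF _ fejer_measurable])
  qed
  have "ennreal (LINT s|freq. cmod (fejer_mean n h s)) = (\<integral>\<^sup>+ s. ennreal (cmod (fejer_mean n h s)) \<partial>freq)"
    using fejer_mean_integrable[OF h] by (intro nn_integral_eq_integral[symmetric]) auto
  also have "\<dots> \<le> (\<integral>\<^sup>+ s. (\<integral>\<^sup>+ t. ennreal (fejer n (s - t) * cmod (h t) / (2 * pi)) \<partial>freq) \<partial>freq)"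
  proof (rule nn_integral_mono)
    fix s
    have i: "integrable freq (\<lambda>t. fejer n (s - t) * cmod (h t) / (2 * pi))"
      using integrable_norm[OF fejer_mult_integrable[OF h, of n s]] by (simp add: norm_mult fejer_nonneg)
    have "cmod (fejer_mean n h s) = cmod (LINT t|freq. of_real (fejer n (s - t)) * h t) / (2 * pi)"
      by (simp add: fejer_mean_def norm_divide)
    also have "\<dots> \<le> (LINT t|freq. cmod (of_real (fejer n (s - t)) * h t)) / (2 * pi)"
      by (intro divide_right_mono integral_norm_bound) simp
    also have "\<dots> = (LINT t|freq. fejer n (s - t) * cmod (h t) / (2 * pi))"
      by (simp add: norm_mult fejer_nonneg)
    finally show "ennreal (cmod (fejer_mean n h s)) \<le> (\<integral>\<^sup>+ t. ennreal (fejer n (s - t) * cmod (h t) / (2 * pi)) \<partial>freq)"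
      using i by (subst nn_integral_eq_integral) (auto simp: fejer_nonneg intro: ennreal_leI)
  qed
  also have "\<dots> = (\<integral>\<^sup>+ t. (\<integral>\<^sup>+ s. ennreal (fejer n (s - t) * cmod (h t) / (2 * pi)) \<partial>freq) \<partial>freq)"
    by (rule Fubini'[symmetric]) (simp add: split_beta')
  also have "\<dots> = (\<integral>\<^sup>+ t. ennreal (cmod (h t)) \<partial>freq)"
  proof (rule nn_integral_cong)
    fix t
    have i: "integrable freq (\<lambda>s. fejer n (s - t))"
      by (rule freq_integrable_bounded[where B = "real n"]) (auto simp: fejer_nonneg fejer_le)
    then have "(\<integral>\<^sup>+ s. ennreal (fejer n (s - t) * cmod (h t) / (2 * pi)) \<partial>freq)
        = ennreal (LINT s|freq. fejer n (s - t) * cmod (h t) / (2 * pi))"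
      by (intro nn_integral_eq_integral) (auto simp: fejer_nonneg)
    also have "(LINT s|freq. fejer n (s - t) * cmod (h t) / (2 * pi)) = cmod (h t)"
      using fejer_integral(2)[of n t] False by simp
    finally show "(\<integral>\<^sup>+ s. ennreal (fejer n (s - t) * cmod (h t) / (2 * pi)) \<partial>freq) = ennreal (cmod (h t))" .
  qed
  also have "\<dots> = ennreal (LINT t|freq. cmod (h t))"
    using h by (intro nn_integral_eq_integral) auto
  finally show ?thesis by (simp add: Bochner_Integration.integral_nonneg)
qed (simp add: fejer_mean_def fejer_def)

lemma fejer_mean_diff:
  assumes "integrable freq h" "integrable freq g"
  shows "fejer_mean n (\<lambda>t. h t - g t) s = fejer_mean n h s - fejer_mean n g s"
  unfolding fejer_mean_def
  using fejer_mult_integrable[OF assms(1), of n s] fejer_mult_integrable[OF assms(2), of n s]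
  by (simp add: right_diff_distrib diff_divide_distrib)

text \<open>
  For bounded continuous functions this is pointwise convergence under a constant bound. The
  contraction property carries it over to their \<open>L\<^sub>1\<close>-closure, which is everything.
\<close>
theorem fejer_L1:
  assumes h: "integrable freq h"
  shows "(\<lambda>n. LINT s|freq. cmod (fejer_mean n h s - h s)) \<longlonglongrightarrow> 0"
proof (rule LIMSEQ_I)
  fix r :: real assume r: "0 < r"
  obtain g B where g: "continuous_on UNIV g" "\<And>t. cmod (g t) \<le> B"
    and hg: "(LINT t|freq. cmod (h t - g t)) < r / 3"
    using L1_approx_bounded_continuous[OF h, of "r/3"] r by auto
  have B: "0 \<le> B" using g(2)[of 0] by (meson norm_ge_zero order_trans)
  have gm [measurable]: "g \<in> borel_measurable freq" by (rule freq_measurable_continuous[OF g(1)])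
  have ig: "integrable freq g" by (rule freq_integrable_bounded[where B = B]) (use g in auto)
  have "(\<lambda>n. LINT s|freq. cmod (fejer_mean n g s - g s)) \<longlonglongrightarrow> (LINT s|freq. 0)"
  proof (rule integral_dominated_convergence[where w = "\<lambda>t. 2 * B"])
    show "AE s in freq. (\<lambda>n. cmod (fejer_mean n g s - g s)) \<longlonglongrightarrow> 0"
      using AE_freq_interior
    proof eventually_elim
      case (elim s)
      then have "(\<lambda>n. fejer_mean n g s) \<longlonglongrightarrow> g s" using fejer_mean_tendsto_continuous[OF g] by blast
      then show ?case by (intro tendsto_norm_zero LIM_zero)
    qed
    show "AE s in freq. norm (cmod (fejer_mean n g s - g s)) \<le> 2 * B" for n
    proof (rule AE_I2)
      fix s
      have "cmod (fejer_mean n g s) \<le> B" using g(2) by (intro fejer_mean_bounded ig B) simp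
      then show "norm (cmod (fejer_mean n g s - g s)) \<le> 2 * B"
        using norm_triangle_ineq4[of "fejer_mean n g s" "g s"] g(2)[of s] by simp
    qed
  qed (use ig in measurable)
  then have "(\<lambda>n. LINT s|freq. cmod (fejer_mean n g s - g s)) \<longlonglongrightarrow> 0" by simp
  then have "\<forall>\<^sub>F n in sequentially. (LINT s|freq. cmod (fejer_mean n g s - g s)) < r / 3"
    using r by (intro order_tendstoD(2)) auto
  then obtain N where N: "\<And>n. N \<le> n \<Longrightarrow> (LINT s|freq. cmod (fejer_mean n g s - g s)) < r / 3"
    by (auto simp: eventually_sequentially)
  have "(LINT s|freq. cmod (fejer_mean n h s - h s)) < r" if "N \<le> n" for n
  proof -
    note i = fejer_mean_integrable[OF h, of n] fejer_mean_integrable[OF ig, of n] h ig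
    let ?d = "\<lambda>t. h t - g t"
    have "(LINT s|freq. cmod (fejer_mean n h s - h s)) \<le>
        (LINT s|freq. cmod (fejer_mean n ?d s) + cmod (fejer_mean n g s - g s) + cmod (?d s))"
    proof (rule integral_mono)
      fix s
      have "fejer_mean n h s - h s = fejer_mean n ?d s + (fejer_mean n g s - g s) - ?d s"
        by (simp add: fejer_mean_diff[OF h ig])
      then show "cmod (fejer_mean n h s - h s) \<le>
          cmod (fejer_mean n ?d s) + cmod (fejer_mean n g s - g s) + cmod (?d s)"
        by (simp only:) (intro order_trans[OF norm_triangle_ineq4] add_right_mono norm_triangle_ineq)
    qed (use i fejer_mean_integrable[of ?d n] in auto)
    also have "\<dots> = (LINT s|freq. cmod (fejer_mean n ?d s)) + (LINT s|freq. cmod (fejer_mean n g s - g s))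
        + (LINT s|freq. cmod (?d s))"
      using i fejer_mean_integrable[of ?d n] by simp
    also have "\<dots> < r / 3 + r / 3 + r / 3"
      using fejer_mean_L1_contraction[of ?d n] h ig hg N[OF that] by (intro add_strict_mono) auto
    finally show ?thesis by simp
  qed
  then show "\<exists>no. \<forall>n\<ge>no. norm ((LINT s|freq. cmod (fejer_mean n h s - h s)) - 0) < r"
    by (auto simp: Bochner_Integration.integral_nonneg)
qed

lemma fejer_AE_subseq:
  assumes h: "integrable freq h"
  shows "\<exists>r. strict_mono r \<and> (AE s in freq. (\<lambda>n. fejer_mean (r n) h s) \<longlonglongrightarrow> h s)"
proof -
  have "integrable freq (\<lambda>s. fejer_mean n h s - h s)" for n
    using fejer_mean_integrable[OF h] h by simp
  from tendsto_L1_AE_subseq[of freq "\<lambda>n s. fejer_mean n h s - h s", OF this fejer_L1[OF h]]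
  show ?thesis by (simp only: LIM_zero_iff)
qed

text \<open>
  The quadratic form of \<open>w\<close>, evaluated at the coefficients \<open>cis (- s * k)\<close>, is a positive multiple
  of the Fejer mean of \<open>w\<close> at \<open>s\<close>. Hence all Fejer means are nonnegative, and so is their limit.
\<close>
lemma AE_nonneg_of_trig_poly:
  assumes w: "integrable freq w"
    and pos: "\<And>c n. 0 \<le> (LINT t|freq. (cmod (\<Sum>k<n. c k * cis (t * real k)))\<^sup>2 * w t)"
  shows "AE t in freq. 0 \<le> w t"
proof -
  let ?h = "\<lambda>t. complex_of_real (w t)"
  have h: "integrable freq ?h" using w by simp
  have "0 \<le> Re (fejer_mean n ?h s)" for n s
  proof -
    have "fejer_mean n ?h s = of_real ((LINT t|freq. fejer n (s - t) * w t) / (2 * pi))"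
      unfolding fejer_mean_def by (simp flip: of_real_mult)
    then have "Re (fejer_mean n ?h s) = (LINT t|freq. fejer n (s - t) * w t) / (2 * pi)" by simp
    moreover have "0 \<le> (LINT t|freq. fejer n (s - t) * w t)"
      unfolding fejer_shift using pos[of "\<lambda>k. cis (- s * real k)" n] by simp
    ultimately show ?thesis by simp
  qed
  moreover obtain r where "AE s in freq. (\<lambda>n. fejer_mean (r n) ?h s) \<longlonglongrightarrow> ?h s"
    using fejer_AE_subseq[OF h] by blast
  ultimately show ?thesis
  proof (elim AE_mp, intro AE_I2 impI)
    fix s assume nn: "\<And>n s. 0 \<le> Re (fejer_mean n ?h s)" and "(\<lambda>n. fejer_mean (r n) ?h s) \<longlonglongrightarrow> ?h s"
    then have "(\<lambda>n. Re (fejer_mean (r n) ?h s)) \<longlonglongrightarrow> w s" using tendsto_Re by fastforce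
    then show "0 \<le> w s" by (rule LIMSEQ_le_const) (use nn in auto)
  qed
qed

text \<open>
  With no coefficients at positive frequencies, only the pairs with \<open>j \<le> k\<close> remain in the double
  sum; they are collected by \<open>m = k - j\<close>.
\<close>
lemma fejer_mean_past_poly:
  assumes h: "integrable freq h" and co: "\<And>l. fourier_coeff h (real l + 1) = 0"
  shows "\<exists>c. \<forall>s. fejer_mean n h s = (\<Sum>m<n. c m * cis (- s * real m))"
proof -
  let ?c = "\<lambda>m. \<Sum>j<n. if j + m < n then fourier_coeff h (- real m) / of_nat n else 0"
  have "fejer_mean n h s = (\<Sum>m<n. ?c m * cis (- s * real m))" for s
  proof -
    have "(\<Sum>k<n. cis (s * (real j - real k)) * fourier_coeff h (real j - real k) / of_nat n)
        = (\<Sum>m<n. (if j + m < n then fourier_coeff h (- real m) / of_nat n else 0) * cis (- s * real m))"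
      if j: "j < n" for j
    proof -
      have z: "fourier_coeff h (real j - real k) = 0" if "k < j" for k
        using co[of "j - k - 1"] that by (simp add: of_nat_diff)
      have "(\<Sum>k<n. cis (s * (real j - real k)) * fourier_coeff h (real j - real k) / of_nat n)
          = (\<Sum>k\<in>{j..<n}. cis (s * (real j - real k)) * fourier_coeff h (real j - real k) / of_nat n)"
        by (rule sum.mono_neutral_right) (auto simp: z)
      also have "\<dots> = (\<Sum>m\<in>{..<n-j}. fourier_coeff h (- real m) / of_nat n * cis (- s * real m))"
        by (rule sum.reindex_bij_witness[of _ "\<lambda>m. j + m" "\<lambda>k. k - j"])
          (auto simp: of_nat_diff algebra_simps)
      also have "\<dots> = (\<Sum>m\<in>{..<n-j}. (if j + m < n then fourier_coeff h (- real m) / of_nat n else 0) * cis (- s * real m))"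
        by (rule sum.cong) auto
      also have "\<dots> = (\<Sum>m<n. (if j + m < n then fourier_coeff h (- real m) / of_nat n else 0) * cis (- s * real m))"
        by (rule sum.mono_neutral_left) auto
      finally show ?thesis .
    qed
    then have "fejer_mean n h s = (\<Sum>j<n. \<Sum>m<n. (if j + m < n then fourier_coeff h (- real m) / of_nat n else 0) * cis (- s * real m))"
      unfolding fejer_mean_eq[OF h] sum_divide_distrib by (rule sum.cong[OF refl]) (simp only: lessThan_iff)
    also have "\<dots> = (\<Sum>m<n. ?c m * cis (- s * real m))"
      by (subst sum.swap) (simp add: sum_distrib_right)
    finally show ?thesis .
  qed
  then show ?thesis by (intro exI[of _ ?c] allI)
qed

section \<open>Fourier series of square-integrable functions\<close>

definition square_integrable :: "(real \<Rightarrow> complex) \<Rightarrow> bool" where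
  "square_integrable \<phi> \<longleftrightarrow> \<phi> \<in> borel_measurable freq \<and> integrable freq (\<lambda>t. (cmod (\<phi> t))\<^sup>2)"

lemma square_integrable_measurable: "square_integrable \<phi> \<Longrightarrow> \<phi> \<in> borel_measurable freq"
  by (simp add: square_integrable_def)

lemma square_integrable_prod:
  assumes "square_integrable \<phi>" "square_integrable \<psi>"
  shows "integrable freq (\<lambda>t. \<phi> t * \<psi> t)"
proof (rule Bochner_Integration.integrable_bound)
  show "integrable freq (\<lambda>t. (cmod (\<phi> t))\<^sup>2 + (cmod (\<psi> t))\<^sup>2)"
    using assms by (simp add: square_integrable_def)
  show "(\<lambda>t. \<phi> t * \<psi> t) \<in> borel_measurable freq"
    using assms by (intro borel_measurable_times square_integrable_measurable)
  show "AE t in freq. norm (\<phi> t * \<psi> t) \<le> norm ((cmod (\<phi> t))\<^sup>2 + (cmod (\<psi> t))\<^sup>2)"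
  proof (rule AE_I2)
    fix t
    have "2 * cmod (\<phi> t) * cmod (\<psi> t) \<le> (cmod (\<phi> t))\<^sup>2 + (cmod (\<psi> t))\<^sup>2" by (rule sum_squares_bound)
    moreover have "0 \<le> cmod (\<phi> t) * cmod (\<psi> t)" by simp
    ultimately have "cmod (\<phi> t) * cmod (\<psi> t) \<le> (cmod (\<phi> t))\<^sup>2 + (cmod (\<psi> t))\<^sup>2" by linarith
    then show "norm (\<phi> t * \<psi> t) \<le> norm ((cmod (\<phi> t))\<^sup>2 + (cmod (\<psi> t))\<^sup>2)"
      by (simp add: norm_mult)
  qed
qed

lemma square_integrable_cnj: "square_integrable \<phi> \<Longrightarrow> square_integrable (\<lambda>t. cnj (\<phi> t))"
  using measurable_compose[OF _ cnj_measurable] by (auto simp: square_integrable_def)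

lemma square_integrable_bounded:
  assumes [measurable]: "\<phi> \<in> borel_measurable freq" and B: "AE t in freq. cmod (\<phi> t) \<le> B"
  shows "square_integrable \<phi>"
  unfolding square_integrable_def
proof (intro conjI freq_integrable_bounded[where B = "B\<^sup>2"])
  show "AE t in freq. norm ((cmod (\<phi> t))\<^sup>2) \<le> B\<^sup>2"
    using B by eventually_elim (auto intro: power_mono)
qed measurable

lemma square_integrable_mult_bounded:
  assumes "square_integrable \<phi>" and [measurable]: "\<psi> \<in> borel_measurable freq"
    and B: "AE t in freq. cmod (\<psi> t) \<le> B"
  shows "square_integrable (\<lambda>t. \<psi> t * \<phi> t)"
proof -
  have [measurable]: "\<phi> \<in> borel_measurable freq" using assms(1) by (simp add: square_integrable_def)
  have "integrable freq (\<lambda>t. (cmod (\<psi> t))\<^sup>2 * (cmod (\<phi> t))\<^sup>2)"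
  proof (rule integrable_mult_bounded[where B = "B\<^sup>2"])
    show "AE t in freq. norm ((cmod (\<psi> t))\<^sup>2) \<le> B\<^sup>2"
      using B by eventually_elim (auto intro: power_mono)
  qed (use assms(1) in \<open>auto simp: square_integrable_def\<close>)
  then show ?thesis by (simp add: square_integrable_def norm_mult power_mult_distrib)
qed

lemma cmod_add_power2_le: "(cmod (x + y))\<^sup>2 \<le> 2 * ((cmod x)\<^sup>2 + (cmod y)\<^sup>2)"
proof -
  have "(cmod (x + y))\<^sup>2 \<le> (cmod x + cmod y)\<^sup>2" by (intro power_mono norm_triangle_ineq) simp
  also have "\<dots> \<le> 2 * ((cmod x)\<^sup>2 + (cmod y)\<^sup>2)"
    using sum_squares_bound[of "cmod x" "cmod y"] by (simp add: power2_sum)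
  finally show ?thesis .
qed

lemma cmod_diff_power2: "(cmod (x - y))\<^sup>2 = (cmod x)\<^sup>2 - 2 * Re (x * cnj y) + (cmod y)\<^sup>2"
  unfolding cmod_power2 by (simp add: power2_diff algebra_simps)

lemma square_integrable_add:
  assumes "square_integrable \<phi>" "square_integrable \<psi>"
  shows "square_integrable (\<lambda>t. \<phi> t + \<psi> t)"
proof -
  have [measurable]: "\<phi> \<in> borel_measurable freq" "\<psi> \<in> borel_measurable freq"
    using assms by (auto simp: square_integrable_def)
  have "integrable freq (\<lambda>t. (cmod (\<phi> t + \<psi> t))\<^sup>2)"
  proof (rule Bochner_Integration.integrable_bound)
    show "integrable freq (\<lambda>t. 2 * ((cmod (\<phi> t))\<^sup>2 + (cmod (\<psi> t))\<^sup>2))"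
      using assms by (simp add: square_integrable_def)
  qed (use cmod_add_power2_le in auto)
  then show ?thesis by (simp add: square_integrable_def)
qed

lemma square_integrable_diff:
  assumes "square_integrable \<phi>" "square_integrable \<psi>"
  shows "square_integrable (\<lambda>t. \<phi> t - \<psi> t)"
  using square_integrable_add[OF assms(1) square_integrable_mult_bounded[OF assms(2), of "\<lambda>_. -1" 1]]
  by simp

lemma integral_Cauchy_Schwarz:
  assumes \<phi>: "square_integrable \<phi>" and \<psi>: "square_integrable \<psi>"
  shows "(LINT t|freq. cmod (\<phi> t * \<psi> t))\<^sup>2 \<le> (LINT t|freq. (cmod (\<phi> t))\<^sup>2) * (LINT t|freq. (cmod (\<psi> t))\<^sup>2)"
proof -
  have [measurable]: "\<phi> \<in> borel_measurable freq" "\<psi> \<in> borel_measurable freq"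
    using assms by (auto simp: square_integrable_def)
  have "(ennreal (LINT t|freq. cmod (\<phi> t * \<psi> t)))\<^sup>2 = (\<integral>\<^sup>+t. ennreal (cmod (\<phi> t)) * ennreal (cmod (\<psi> t)) \<partial>freq)\<^sup>2"
    using nn_integral_eq_integral[OF integrable_norm[OF square_integrable_prod[OF assms]]]
    by (simp add: norm_mult ennreal_mult)
  also have "\<dots> \<le> (\<integral>\<^sup>+t. (ennreal (cmod (\<phi> t)))\<^sup>2 \<partial>freq) * (\<integral>\<^sup>+t. (ennreal (cmod (\<psi> t)))\<^sup>2 \<partial>freq)"
    by (rule Cauchy_Schwarz_nn_integral) measurable
  also have "\<dots> = ennreal (LINT t|freq. (cmod (\<phi> t))\<^sup>2) * ennreal (LINT t|freq. (cmod (\<psi> t))\<^sup>2)"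
    using assms by (simp add: ennreal_power nn_integral_eq_integral square_integrable_def)
  finally show ?thesis
    by (simp add: ennreal_power Bochner_Integration.integral_nonneg flip: ennreal_mult)
qed

lemma integral_prod_tendsto:
  assumes \<phi>: "square_integrable \<phi>" and \<psi>: "square_integrable \<psi>" and \<psi>n: "\<And>n. square_integrable (\<Psi> n)"
    and lim: "(\<lambda>n. LINT t|freq. (cmod (\<psi> t - \<Psi> n t))\<^sup>2) \<longlonglongrightarrow> 0"
  shows "(\<lambda>n. LINT t|freq. \<phi> t * \<Psi> n t) \<longlonglongrightarrow> (LINT t|freq. \<phi> t * \<psi> t)"
proof (rule LIM_zero_cancel, rule Lim_null_comparison)
  show "\<forall>\<^sub>F n in sequentially. norm ((LINT t|freq. \<phi> t * \<Psi> n t) - (LINT t|freq. \<phi> t * \<psi> t))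
      \<le> sqrt ((LINT t|freq. (cmod (\<phi> t))\<^sup>2) * (LINT t|freq. (cmod (\<psi> t - \<Psi> n t))\<^sup>2))"
  proof (rule always_eventually, rule allI)
    fix n
    have "(LINT t|freq. \<phi> t * \<psi> t) - (LINT t|freq. \<phi> t * \<Psi> n t) = (LINT t|freq. \<phi> t * (\<psi> t - \<Psi> n t))"
      using square_integrable_prod[OF \<phi> \<psi>] square_integrable_prod[OF \<phi> \<psi>n, of n]
      by (simp add: right_diff_distrib)
    then have "norm ((LINT t|freq. \<phi> t * \<Psi> n t) - (LINT t|freq. \<phi> t * \<psi> t)) = cmod (LINT t|freq. \<phi> t * (\<psi> t - \<Psi> n t))"
      by (metis norm_minus_commute)
    also have "\<dots> \<le> (LINT t|freq. cmod (\<phi> t * (\<psi> t - \<Psi> n t)))" by (rule integral_norm_bound)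
    also have "\<dots> \<le> sqrt ((LINT t|freq. (cmod (\<phi> t))\<^sup>2) * (LINT t|freq. (cmod (\<psi> t - \<Psi> n t))\<^sup>2))"
      using integral_Cauchy_Schwarz[OF \<phi> square_integrable_diff[OF \<psi> \<psi>n[of n]]] by (rule real_le_rsqrt)
    finally show "norm ((LINT t|freq. \<phi> t * \<Psi> n t) - (LINT t|freq. \<phi> t * \<psi> t)) \<le> \<dots>" .
  qed
  show "(\<lambda>n. sqrt ((LINT t|freq. (cmod (\<phi> t))\<^sup>2) * (LINT t|freq. (cmod (\<psi> t - \<Psi> n t))\<^sup>2))) \<longlonglongrightarrow> 0"
    using tendsto_real_sqrt[OF tendsto_mult_left[OF lim, of "LINT t|freq. (cmod (\<phi> t))\<^sup>2"]] by simp
qed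

text \<open>
  The partial sums by which \<^const>\<open>fourier_sum\<close> is defined; the frequencies start at \<open>1\<close>.
\<close>
definition partial_sum :: "(nat \<Rightarrow> complex) \<Rightarrow> nat \<Rightarrow> real \<Rightarrow> complex" where
  "partial_sum c n t = (\<Sum>k<n. c k * cis (t * (real k + 1)))"

lemma partial_sum_measurable [measurable]: "partial_sum c n \<in> borel_measurable freq"
  unfolding partial_sum_def by measurable

lemma partial_sum_square_integrable: "square_integrable (partial_sum c n)"
proof (rule square_integrable_bounded[where B = "\<Sum>k<n. cmod (c k)"])
  show "AE t in freq. cmod (partial_sum c n t) \<le> (\<Sum>k<n. cmod (c k))"
    unfolding partial_sum_def
    by (intro AE_I2 order_trans[OF norm_sum] sum_mono) (simp add: norm_mult)
qed measurable

lemma cmod_partial_sum: "cmod (partial_sum c n t) = cmod (\<Sum>k<n. c k * cis (t * real k))"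
proof -
  have "partial_sum c n t = cis t * (\<Sum>k<n. c k * cis (t * real k))"
    by (simp add: partial_sum_def sum_distrib_left distrib_left add.commute flip: cis_mult)
      (simp add: mult_ac)
  then show ?thesis by (simp add: norm_mult)
qed

lemma Parseval_partial_sum: "(LINT t|freq. (cmod (partial_sum c n t))\<^sup>2) = 2 * pi * (\<Sum>k<n. (cmod (c k))\<^sup>2)"
  unfolding cmod_partial_sum by (rule Parseval_finite)

lemma Parseval_partial_sum_diff:
  assumes "n \<le> m"
  shows "(LINT t|freq. (cmod (partial_sum c m t - partial_sum c n t))\<^sup>2) = 2 * pi * (\<Sum>k\<in>{n..<m}. (cmod (c k))\<^sup>2)"
proof -
  have "partial_sum c m t - partial_sum c n t = partial_sum (\<lambda>k. if k < n then 0 else c k) m t" for t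
  proof -
    have "{..<m} = {..<n} \<union> {n..<m}" using assms by auto
    then have "partial_sum c m t - partial_sum c n t = (\<Sum>k\<in>{n..<m}. c k * cis (t * (real k + 1)))"
      unfolding partial_sum_def by (simp add: sum.union_disjoint ivl_disj_int)
    also have "\<dots> = partial_sum (\<lambda>k. if k < n then 0 else c k) m t"
      unfolding partial_sum_def by (rule sum.mono_neutral_cong_left) auto
    finally show ?thesis .
  qed
  then have "(LINT t|freq. (cmod (partial_sum c m t - partial_sum c n t))\<^sup>2)
      = 2 * pi * (\<Sum>k<m. (cmod (if k < n then 0 else c k))\<^sup>2)"
    by (simp only: Parseval_partial_sum)
  also have "(\<Sum>k<m. (cmod (if k < n then 0 else c k))\<^sup>2) = (\<Sum>k\<in>{n..<m}. (cmod (c k))\<^sup>2)"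
    by (rule sum.mono_neutral_cong_right) auto
  finally show ?thesis .
qed

lemma nn_integral_partial_sum_diff:
  assumes "n \<le> m"
  shows "(\<integral>\<^sup>+t. ennreal ((cmod (partial_sum c m t - partial_sum c n t))\<^sup>2) \<partial>freq)
    = ennreal (2 * pi * (\<Sum>k\<in>{n..<m}. (cmod (c k))\<^sup>2))"
  unfolding Parseval_partial_sum_diff[OF assms, symmetric]
  using square_integrable_diff[OF partial_sum_square_integrable partial_sum_square_integrable, of c m c n]
  by (intro nn_integral_eq_integral) (auto simp: square_integrable_def)

text \<open>
  Along a sparse subsequence \<open>r\<close> the successive differences have \<open>L\<^sub>1\<close>-norms of order \<open>2^-j\<close>, so the
  partial sums converge absolutely almost everywhere along \<open>r\<close>. Fatou's lemma then bounds the distance of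
  the limit from each partial sum by the tail of the coefficients.
\<close>
lemma Riesz_Fischer:
  assumes c: "c \<in> ell2"
  shows "\<exists>\<psi>. \<psi> \<in> borel_measurable freq \<and>
     (\<lambda>n. \<integral>\<^sup>+t. ennreal ((cmod (\<psi> t - partial_sum c n t))\<^sup>2) \<partial>freq) \<longlonglongrightarrow> 0"
proof -
  define \<tau> where "\<tau> n = (\<Sum>k. (cmod (c (k + n)))\<^sup>2)" for n
  have s: "summable (\<lambda>k. (cmod (c k))\<^sup>2)" using c by (simp add: ell2_def)
  have \<tau>: "\<tau> \<longlonglongrightarrow> 0"
    using suminf_exist_split2[OF s] by (simp add: \<tau>_def[abs_def])
  have block: "(\<Sum>k\<in>{n..<m}. (cmod (c k))\<^sup>2) \<le> \<tau> n" for n m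
  proof -
    have "(\<Sum>k\<in>{n..<m}. (cmod (c k))\<^sup>2) = (\<Sum>k<m-n. (cmod (c (k + n)))\<^sup>2)"
      by (rule sum.reindex_bij_witness[of _ "\<lambda>k. k + n" "\<lambda>k. k - n"]) auto
    also have "\<dots> \<le> \<tau> n" unfolding \<tau>_def
      by (rule sum_le_suminf) (use summable_ignore_initial_segment[OF s] in auto)
    finally show ?thesis .
  qed
  have "\<exists>M. \<forall>n\<ge>M. \<tau> n < (1/4)^j" for j :: nat
  proof -
    have "\<forall>\<^sub>F n in sequentially. \<tau> n < (1/4)^j" by (rule order_tendstoD(2)[OF \<tau>]) simp
    then show ?thesis by (simp add: eventually_sequentially)
  qed
  then obtain M where M: "\<And>j n. M j \<le> n \<Longrightarrow> \<tau> n < (1/4)^(j::nat)" by metis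
  \<comment> \<open>The summand \<open>j\<close> makes \<open>r\<close> unbounded, the sum makes it increasing and large enough.\<close>
  define r where "r j = (\<Sum>i\<le>j. M i) + j" for j
  have r_mono: "r j \<le> r (Suc j)" for j by (simp add: r_def)
  have r_ge: "M j \<le> r j" "j \<le> r j" for j
    by (auto simp: r_def intro: trans_le_add1 member_le_sum)
  let ?d = "\<lambda>j t. partial_sum c (r (Suc j)) t - partial_sum c (r j) t"
  have d2: "(\<integral>\<^sup>+t. ennreal ((cmod (?d j t))\<^sup>2) \<partial>freq) \<le> ennreal (2 * pi * (1/4)^j)" for j
    unfolding nn_integral_partial_sum_diff[OF r_mono]
    using block[of "r j" "r (Suc j)"] M[OF r_ge(1), of j]
    by (intro ennreal_leI mult_left_mono) auto
  have d1: "(\<integral>\<^sup>+t. ennreal (cmod (?d j t)) \<partial>freq) \<le> ennreal (4 * pi * (1/2)^j)" for j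
  proof -
    \<comment> \<open>Arithmetic-geometric mean with weights matched to the squared norm \<open>4^-j\<close>.\<close>
    have "cmod (?d j t) \<le> (1/2)^j + 2^j * (cmod (?d j t))\<^sup>2" for t
    proof -
      have "2 * ((1/2)^j * (2^j * cmod (?d j t))) \<le> ((1/2)^j)\<^sup>2 * 2 ^ j + 2^j * (cmod (?d j t))\<^sup>2"
      proof -
        have "0 \<le> 2^j * ((1/2)^j - cmod (?d j t))\<^sup>2" by simp
        also have "\<dots> = ((1/2)^j)\<^sup>2 * 2 ^ j + 2^j * (cmod (?d j t))\<^sup>2 - 2 * ((1/2)^j * (2^j * cmod (?d j t)))"
          by (simp add: power2_diff algebra_simps)
        finally show ?thesis by simp
      qed
      moreover have h: "(1/2)^j * (2::real)^j = 1" by (simp flip: power_mult_distrib)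
      moreover have "((1/2)^j)\<^sup>2 * 2 ^ j = ((1/2)^j :: real)"
        using h by (simp only: power2_eq_square mult.assoc mult_1_right)
      moreover have "(1/2)^j * (2^j * cmod (?d j t)) = cmod (?d j t)"
        using h by (simp only: mult.assoc[symmetric] mult_1_left)
      ultimately have "2 * cmod (?d j t) \<le> (1/2)^j + 2^j * (cmod (?d j t))\<^sup>2" by linarith
      then show ?thesis using norm_ge_zero[of "?d j t"] by linarith
    qed
    then have "(\<integral>\<^sup>+t. ennreal (cmod (?d j t)) \<partial>freq)
        \<le> (\<integral>\<^sup>+t. ennreal ((1/2)^j) + ennreal (2^j) * ennreal ((cmod (?d j t))\<^sup>2) \<partial>freq)"
      by (intro nn_integral_mono) (simp add: ennreal_mult[symmetric] ennreal_plus[symmetric] del: ennreal_plus)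
    also have "\<dots> = ennreal ((1/2)^j) * ennreal (2 * pi) + ennreal (2^j) * (\<integral>\<^sup>+t. ennreal ((cmod (?d j t))\<^sup>2) \<partial>freq)"
      by (subst nn_integral_add) (auto simp: nn_integral_cmult emeasure_freq[unfolded space_freq])
    also have "\<dots> \<le> ennreal ((1/2)^j) * ennreal (2 * pi) + ennreal (2^j) * ennreal (2 * pi * (1/4)^j)"
      by (intro add_left_mono mult_left_mono d2) auto
    also have "\<dots> = ennreal ((1/2)^j * (2 * pi) + 2^j * (2 * pi * (1/4)^j))"
      by (simp add: ennreal_mult[symmetric] ennreal_plus[symmetric] del: ennreal_plus)
    also have "(1/2)^j * (2 * pi) + 2^j * (2 * pi * (1/4)^j) = 4 * pi * (1/2)^j"
    proof -
      have "(2::real)^j * (1/4)^j = (1/2)^j" by (simp flip: power_mult_distrib)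
      then show ?thesis by (simp add: algebra_simps)
    qed
    finally show ?thesis .
  qed
  have "(\<integral>\<^sup>+t. (\<Sum>j. ennreal (cmod (?d j t))) \<partial>freq) = (\<Sum>j. \<integral>\<^sup>+t. ennreal (cmod (?d j t)) \<partial>freq)"
    by (rule nn_integral_suminf) measurable
  also have "\<dots> \<le> (\<Sum>j. ennreal (4 * pi * (1/2)^j))"
    by (intro suminf_le d1) auto
  also have "\<dots> < \<infinity>"
    by (subst suminf_ennreal_eq[OF _ sums_mult[OF geometric_sums]]) auto
  finally have "AE t in freq. (\<Sum>j. ennreal (cmod (?d j t))) \<noteq> \<infinity>"
    by (intro nn_integral_PInf_AE) auto
  then have conv: "AE t in freq. convergent (\<lambda>j. partial_sum c (r j) t)"
  proof eventually_elim
    case (elim t)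
    then have "summable (\<lambda>j. cmod (?d j t))" by (intro summable_suminf_not_top) auto
    then have "summable (\<lambda>j. ?d j t)" by (rule summable_norm_cancel)
    then obtain s where "(\<lambda>n. \<Sum>j<n. ?d j t) \<longlonglongrightarrow> s" unfolding summable_def sums_def by blast
    then have "(\<lambda>n. partial_sum c (r n) t - partial_sum c (r 0) t) \<longlonglongrightarrow> s"
      by (simp only: sum_lessThan_telescope[of "\<lambda>j. partial_sum c (r j) t"])
    from tendsto_add[OF this tendsto_const[of "partial_sum c (r 0) t"]]
    show ?case unfolding convergent_def by auto
  qed
  define \<psi> where "\<psi> t = lim (\<lambda>j. partial_sum c (r j) t)" for t
  have [measurable]: "\<psi> \<in> borel_measurable freq"
    unfolding \<psi>_def by measurable
  have le: "(\<integral>\<^sup>+t. ennreal ((cmod (\<psi> t - partial_sum c n t))\<^sup>2) \<partial>freq) \<le> ennreal (2 * pi * \<tau> n)" for n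
  proof -
    have "(\<integral>\<^sup>+t. ennreal ((cmod (\<psi> t - partial_sum c n t))\<^sup>2) \<partial>freq)
        = (\<integral>\<^sup>+t. liminf (\<lambda>j. ennreal ((cmod (partial_sum c (r j) t - partial_sum c n t))\<^sup>2)) \<partial>freq)"
    proof (rule nn_integral_cong_AE)
      show "AE t in freq. ennreal ((cmod (\<psi> t - partial_sum c n t))\<^sup>2)
          = liminf (\<lambda>j. ennreal ((cmod (partial_sum c (r j) t - partial_sum c n t))\<^sup>2))"
        using conv
      proof eventually_elim
        case (elim t)
        then have "(\<lambda>j. partial_sum c (r j) t) \<longlonglongrightarrow> \<psi> t" by (simp add: \<psi>_def convergent_LIMSEQ_iff)
        then have "(\<lambda>j. ennreal ((cmod (partial_sum c (r j) t - partial_sum c n t))\<^sup>2))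
            \<longlonglongrightarrow> ennreal ((cmod (\<psi> t - partial_sum c n t))\<^sup>2)"
          by (intro tendsto_intros)
        then show ?case by (rule lim_imp_Liminf[OF trivial_limit_sequentially, symmetric])
      qed
    qed
    also have "\<dots> \<le> liminf (\<lambda>j. \<integral>\<^sup>+t. ennreal ((cmod (partial_sum c (r j) t - partial_sum c n t))\<^sup>2) \<partial>freq)"
      by (rule nn_integral_liminf) measurable
    also have "\<dots> \<le> ennreal (2 * pi * \<tau> n)"
    proof (rule order_trans[OF Liminf_le_Limsup])
      show "limsup (\<lambda>j. \<integral>\<^sup>+t. ennreal ((cmod (partial_sum c (r j) t - partial_sum c n t))\<^sup>2) \<partial>freq)
          \<le> ennreal (2 * pi * \<tau> n)"
      proof (rule Limsup_bounded)
        show "\<forall>\<^sub>F j in sequentially. (\<integral>\<^sup>+t. ennreal ((cmod (partial_sum c (r j) t - partial_sum c n t))\<^sup>2) \<partial>freq)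
            \<le> ennreal (2 * pi * \<tau> n)"
          using eventually_ge_at_top[of n]
        proof eventually_elim
          case (elim j)
          then have "n \<le> r j" using r_ge(2)[of j] by simp
          then show ?case using block[of n "r j"]
            by (simp only: nn_integral_partial_sum_diff) (intro ennreal_leI mult_left_mono, auto)
        qed
      qed
    qed simp
    finally show ?thesis .
  qed
  have "(\<lambda>n. ennreal (2 * pi * \<tau> n)) \<longlonglongrightarrow> ennreal (2 * pi * 0)"
    by (intro tendsto_ennrealI tendsto_mult_left \<tau>)
  then have lim: "(\<lambda>n. ennreal (2 * pi * \<tau> n)) \<longlonglongrightarrow> 0" by simp
  have "(\<lambda>n. \<integral>\<^sup>+t. ennreal ((cmod (\<psi> t - partial_sum c n t))\<^sup>2) \<partial>freq) \<longlonglongrightarrow> 0"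
  proof (rule tendsto_sandwich[OF _ _ tendsto_const lim])
    show "\<forall>\<^sub>F n in sequentially. (\<integral>\<^sup>+t. ennreal ((cmod (\<psi> t - partial_sum c n t))\<^sup>2) \<partial>freq) \<le> ennreal (2 * pi * \<tau> n)"
      by (rule always_eventually) (rule allI, rule le)
  qed simp
  then show ?thesis by (intro exI[of _ \<psi>]) simp
qed

lemma fourier_sum_props:
  assumes c: "c \<in> ell2"
  shows "fourier_sum c \<in> borel_measurable freq"
    and "(\<lambda>n. \<integral>\<^sup>+t. ennreal ((cmod (fourier_sum c t - partial_sum c n t))\<^sup>2) \<partial>freq) \<longlonglongrightarrow> 0"
  using someI_ex[OF Riesz_Fischer[OF c]] unfolding fourier_sum_def partial_sum_def by auto

lemma fourier_sum_square_integrable: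
  assumes c: "c \<in> ell2"
  shows "square_integrable (fourier_sum c)"
proof -
  note [measurable] = fourier_sum_props(1)[OF c]
  have "\<forall>\<^sub>F n in sequentially. (\<integral>\<^sup>+t. ennreal ((cmod (fourier_sum c t - partial_sum c n t))\<^sup>2) \<partial>freq) < 1"
    by (rule order_tendstoD(2)[OF fourier_sum_props(2)[OF c]]) simp
  then obtain n where "(\<integral>\<^sup>+t. ennreal ((cmod (fourier_sum c t - partial_sum c n t))\<^sup>2) \<partial>freq) < 1"
    using eventually_happens' by force
  then have "square_integrable (\<lambda>t. fourier_sum c t - partial_sum c n t)"
    unfolding square_integrable_def by (auto intro!: integrableI_bounded simp: order.strict_trans[OF _ ennreal_one_less_top])
  from square_integrable_add[OF this partial_sum_square_integrable[of c n]] show ?thesis by simp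
qed

lemma fourier_sum_L2_limit:
  assumes c: "c \<in> ell2"
  shows "(\<lambda>n. LINT t|freq. (cmod (fourier_sum c t - partial_sum c n t))\<^sup>2) \<longlonglongrightarrow> 0"
proof -
  have "(\<integral>\<^sup>+t. ennreal ((cmod (fourier_sum c t - partial_sum c n t))\<^sup>2) \<partial>freq)
      = ennreal (LINT t|freq. (cmod (fourier_sum c t - partial_sum c n t))\<^sup>2)" for n
    using square_integrable_diff[OF fourier_sum_square_integrable[OF c] partial_sum_square_integrable[of c n]]
    by (intro nn_integral_eq_integral) (auto simp: square_integrable_def)
  then have "(\<lambda>n. ennreal (LINT t|freq. (cmod (fourier_sum c t - partial_sum c n t))\<^sup>2)) \<longlonglongrightarrow> ennreal 0"
    using fourier_sum_props(2)[OF c] by simp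
  then show ?thesis by (rule tendsto_ennrealD) (auto intro!: always_eventually Bochner_Integration.integral_nonneg)
qed

lemma integral_fourier_sum_limit:
  assumes "c \<in> ell2" "square_integrable \<phi>"
  shows "(\<lambda>n. LINT t|freq. \<phi> t * partial_sum c n t) \<longlonglongrightarrow> (LINT t|freq. \<phi> t * fourier_sum c t)"
    and "(\<lambda>n. LINT t|freq. \<phi> t * cnj (partial_sum c n t)) \<longlonglongrightarrow> (LINT t|freq. \<phi> t * cnj (fourier_sum c t))"
proof -
  note si = fourier_sum_square_integrable[OF assms(1)] partial_sum_square_integrable
  show "(\<lambda>n. LINT t|freq. \<phi> t * partial_sum c n t) \<longlonglongrightarrow> (LINT t|freq. \<phi> t * fourier_sum c t)"
    by (rule integral_prod_tendsto[OF assms(2) si fourier_sum_L2_limit[OF assms(1)]])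
  show "(\<lambda>n. LINT t|freq. \<phi> t * cnj (partial_sum c n t)) \<longlonglongrightarrow> (LINT t|freq. \<phi> t * cnj (fourier_sum c t))"
    by (rule integral_prod_tendsto[OF assms(2) square_integrable_cnj[OF si(1)] square_integrable_cnj[OF si(2)]])
      (use fourier_sum_L2_limit[OF assms(1)] in \<open>simp flip: complex_cnj_diff\<close>)
qed

lemma square_integrable_imp_integrable:
  assumes "square_integrable \<phi>" shows "integrable freq \<phi>"
  using square_integrable_prod[OF assms square_integrable_bounded[of "\<lambda>_. 1" 1]] by simp

lemma integral_cnj_partial_sum:
  assumes "integrable freq \<phi>"
  shows "(LINT t|freq. \<phi> t * cnj (partial_sum c n t)) = of_real (2 * pi) * (\<Sum>k<n. fourier_coeff \<phi> (real k + 1) * cnj (c k))"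
proof -
  have "(LINT t|freq. \<phi> t * cnj (partial_sum c n t)) = (LINT t|freq. (\<Sum>k<n. cnj (c k) * (cis (- t * (real k + 1)) * \<phi> t)))"
    by (rule Bochner_Integration.integral_cong) (simp_all add: partial_sum_def cnj_sum cis_cnj sum_distrib_left mult_ac)
  also have "\<dots> = (\<Sum>k<n. cnj (c k) * (LINT t|freq. cis (- t * (real k + 1)) * \<phi> t))"
    using cis_mult_integrable(1)[OF assms]
    by (simp add: Bochner_Integration.integral_sum del: mult_minus_left)
  also have "\<dots> = of_real (2 * pi) * (\<Sum>k<n. fourier_coeff \<phi> (real k + 1) * cnj (c k))"
    by (simp add: fourier_coeff_def sum_distrib_left mult_ac)
  finally show ?thesis .
qed

text \<open>
  The square of the distance from \<open>\<phi>\<close> to its own partial sum is nonnegative.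
\<close>
lemma Bessel:
  assumes \<phi>: "square_integrable \<phi>"
  shows "2 * pi * (\<Sum>k<n. (cmod (fourier_coeff \<phi> (real k + 1)))\<^sup>2) \<le> (LINT t|freq. (cmod (\<phi> t))\<^sup>2)"
proof -
  define b where "b k = fourier_coeff \<phi> (real k + 1)" for k :: nat
  let ?p = "partial_sum b n"
  let ?s = "\<Sum>k<n. (cmod (b k))\<^sup>2"
  have i: "integrable freq (\<lambda>t. \<phi> t * cnj (?p t))"
    by (rule square_integrable_prod[OF \<phi> square_integrable_cnj[OF partial_sum_square_integrable]])
  have "(LINT t|freq. \<phi> t * cnj (?p t)) = of_real (2 * pi) * (\<Sum>k<n. b k * cnj (b k))"
    unfolding b_def by (rule integral_cnj_partial_sum[OF square_integrable_imp_integrable[OF \<phi>]])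
  also have "\<dots> = of_real (2 * pi * ?s)"
    by (simp add: complex_norm_square del: of_real_power)
  finally have cross: "Re (LINT t|freq. \<phi> t * cnj (?p t)) = 2 * pi * ?s" by (metis Re_complex_of_real)
  have "0 \<le> (LINT t|freq. (cmod (\<phi> t - ?p t))\<^sup>2)" by simp
  also have "\<dots> = (LINT t|freq. (cmod (\<phi> t))\<^sup>2 - 2 * Re (\<phi> t * cnj (?p t)) + (cmod (?p t))\<^sup>2)"
    by (rule Bochner_Integration.integral_cong) (simp_all only: cmod_diff_power2)
  also have "\<dots> = (LINT t|freq. (cmod (\<phi> t))\<^sup>2) - 2 * Re (LINT t|freq. \<phi> t * cnj (?p t)) + (LINT t|freq. (cmod (?p t))\<^sup>2)"
    using i \<phi> partial_sum_square_integrable[of b n]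
    by (simp add: square_integrable_def integral_Re del: complex_cnj_mult times_complex.sel)
  also have "\<dots> = (LINT t|freq. (cmod (\<phi> t))\<^sup>2) - 2 * pi * ?s"
    unfolding cross Parseval_partial_sum by simp
  finally show ?thesis by (simp add: b_def)
qed

lemma fourier_coeff_ell2:
  assumes \<phi>: "square_integrable \<phi>"
  shows "(\<lambda>k. fourier_coeff \<phi> (real k + 1)) \<in> ell2"
    and "2 * pi * (ell2_norm (\<lambda>k. fourier_coeff \<phi> (real k + 1)))\<^sup>2 \<le> (LINT t|freq. (cmod (\<phi> t))\<^sup>2)"
proof -
  have le: "(\<Sum>k<n. (cmod (fourier_coeff \<phi> (real k + 1)))\<^sup>2) \<le> (LINT t|freq. (cmod (\<phi> t))\<^sup>2) / (2 * pi)" for n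
    using Bessel[OF \<phi>, of n] by (simp add: field_simps)
  show e: "(\<lambda>k. fourier_coeff \<phi> (real k + 1)) \<in> ell2"
    unfolding ell2_def by (auto intro!: summableI_nonneg_bounded le)
  have "(ell2_norm (\<lambda>k. fourier_coeff \<phi> (real k + 1)))\<^sup>2 \<le> (LINT t|freq. (cmod (\<phi> t))\<^sup>2) / (2 * pi)"
    unfolding ell2_norm_power2[OF e] using e by (intro suminf_le_const le) (simp add: ell2_def)
  then show "2 * pi * (ell2_norm (\<lambda>k. fourier_coeff \<phi> (real k + 1)))\<^sup>2 \<le> (LINT t|freq. (cmod (\<phi> t))\<^sup>2)"
    by (simp add: field_simps)
qed

lemma Plancherel:
  assumes \<phi>: "square_integrable \<phi>" and c: "c \<in> ell2"
  shows "ell2_inner (\<lambda>k. fourier_coeff \<phi> (real k + 1)) c = (LINT t|freq. \<phi> t * cnj (fourier_sum c t)) / of_real (2 * pi)"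
proof -
  have "(\<lambda>n. (LINT t|freq. \<phi> t * cnj (partial_sum c n t)) / of_real (2 * pi))
      \<longlonglongrightarrow> (LINT t|freq. \<phi> t * cnj (fourier_sum c t)) / of_real (2 * pi)"
    by (intro tendsto_divide integral_fourier_sum_limit(2) c \<phi> tendsto_const) simp
  then have "(\<lambda>k. fourier_coeff \<phi> (real k + 1) * cnj (c k)) sums
      ((LINT t|freq. \<phi> t * cnj (fourier_sum c t)) / of_real (2 * pi))"
    unfolding sums_def by (simp add: integral_cnj_partial_sum[OF square_integrable_imp_integrable[OF \<phi>]])
  then show ?thesis unfolding ell2_inner_def by (rule sums_unique[symmetric])
qed

section \<open>Toeplitz matrices and bounds for their symbols\<close>

definition toeplitz :: "(real \<Rightarrow> real) \<Rightarrow> nat \<Rightarrow> nat \<Rightarrow> complex" where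
  "toeplitz w l k = (LINT t|freq. cis (t * (real k - real l)) * of_real (w t)) / of_real (2 * pi)"

lemma P_mat_toeplitz: "P_mat f g = toeplitz (\<lambda>t. 1 / (f t + g t))"
  by (simp add: fun_eq_iff P_mat_def toeplitz_def)

text \<open>
  In \<open>Q\<close> the sign of the frequency is opposite to that in \<open>P\<close>, so the indices are exchanged.
\<close>
lemma Q_mat_toeplitz: "Q_mat f g = (\<lambda>l k. toeplitz (\<lambda>t. f t * g t / (f t + g t)) k l)"
  by (simp add: fun_eq_iff Q_mat_def toeplitz_def)

lemma toeplitz_cnj: "cnj (toeplitz w l k) = toeplitz w k l"
proof -
  have "cnj (LINT t|freq. cis (t * (real k - real l)) * of_real (w t))
      = (LINT t|freq. cnj (cis (t * (real k - real l)) * of_real (w t)))"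
    by (rule Bochner_Integration.integral_cnj[symmetric])
  then show ?thesis unfolding toeplitz_def by (simp add: cis_cnj right_diff_distrib)
qed

text \<open>
  A Toeplitz matrix acts as multiplication by its symbol followed by projection to the positive
  frequencies.
\<close>
lemma toeplitz_partial_sum:
  assumes w: "integrable freq w"
  shows "(\<Sum>k<n. toeplitz w l k * x k) = fourier_coeff (\<lambda>t. of_real (w t) * partial_sum x n t) (real l + 1)"
proof -
  have "(LINT t|freq. cis (- t * (real l + 1)) * (of_real (w t) * partial_sum x n t))
      = (LINT t|freq. (\<Sum>k<n. x k * (cis (t * (real k - real l)) * of_real (w t))))"
  proof (rule Bochner_Integration.integral_cong[OF refl])
    fix t
    have "cis (- t * (real l + 1)) * cis (t * (real k + 1)) = cis (t * (real k - real l))" for k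
      by (simp add: cis_mult algebra_simps)
    then have "cis (- t * (real l + 1)) * (of_real (w t) * (x k * cis (t * (real k + 1))))
        = x k * (cis (t * (real k - real l)) * of_real (w t))" for k
      by (metis mult.assoc mult.commute)
    then show "cis (- t * (real l + 1)) * (of_real (w t) * partial_sum x n t)
        = (\<Sum>k<n. x k * (cis (t * (real k - real l)) * of_real (w t)))"
      unfolding partial_sum_def sum_distrib_left by (intro sum.cong refl)
  qed
  also have "\<dots> = (\<Sum>k<n. x k * (LINT t|freq. cis (t * (real k - real l)) * of_real (w t)))"
    using cis_mult_integrable(2)[of "\<lambda>t. complex_of_real (w t)"] w
    by (simp add: Bochner_Integration.integral_sum)
  finally show ?thesis
    by (simp add: fourier_coeff_def toeplitz_def sum_divide_distrib mult.commute)
qed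

lemma mat_apply_finite_support:
  assumes "\<And>k. n \<le> k \<Longrightarrow> x k = 0"
  shows "mat_apply M x l = (\<Sum>k<n. M l k * x k)"
  unfolding mat_apply_def using assms by (intro suminf_finite) auto

lemma ell2_inner_finite_support:
  assumes "\<And>k. n \<le> k \<Longrightarrow> x k = 0"
  shows "ell2_inner x y = (\<Sum>k<n. x k * cnj (y k))" "ell2_inner y x = (\<Sum>k<n. y k * cnj (x k))"
  unfolding ell2_inner_def using assms by (auto intro!: suminf_finite simp: not_le[symmetric])

lemma toeplitz_form:
  assumes w: "integrable freq w" and x: "\<And>k. n \<le> k \<Longrightarrow> x k = 0"
  shows "ell2_inner (mat_apply (toeplitz w) x) x = of_real ((LINT t|freq. (cmod (partial_sum x n t))\<^sup>2 * w t) / (2 * pi))"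
proof -
  let ?\<phi> = "\<lambda>t. of_real (w t) * partial_sum x n t"
  have i: "integrable freq ?\<phi>"
    using integrable_mult_bounded[of freq "\<lambda>t. complex_of_real (w t)" "partial_sum x n" "\<Sum>k<n. cmod (x k)"] w
    by (simp add: mult.commute partial_sum_def norm_mult order_trans[OF norm_sum] sum_mono)
  have "ell2_inner (mat_apply (toeplitz w) x) x = (\<Sum>l<n. fourier_coeff ?\<phi> (real l + 1) * cnj (x l))"
    by (simp add: ell2_inner_finite_support(2)[OF x] mat_apply_finite_support[OF x] toeplitz_partial_sum[OF w])
  also have "\<dots> = (LINT t|freq. ?\<phi> t * cnj (partial_sum x n t)) / of_real (2 * pi)"
    by (subst integral_cnj_partial_sum[OF i]) simp
  also have "(LINT t|freq. ?\<phi> t * cnj (partial_sum x n t)) = (LINT t|freq. of_real ((cmod (partial_sum x n t))\<^sup>2 * w t))"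
    by (rule Bochner_Integration.integral_cong) (simp_all add: complex_norm_square mult_ac del: of_real_power)
  also have "\<dots> = of_real (LINT t|freq. (cmod (partial_sum x n t))\<^sup>2 * w t)" by (rule integral_complex_of_real)
  finally show ?thesis by simp
qed

text \<open>
  The symbol is real, so the matrix is Hermitian. One argument has finite support, and only then
  are the two summations certain to commute: boundedness of the operator is to be deduced from this.
\<close>
lemma toeplitz_selfadjoint:
  assumes acts: "acts_on_ell2 (toeplitz w)" and x: "\<And>k. n \<le> k \<Longrightarrow> x k = 0" and y: "y \<in> ell2"
  shows "ell2_inner (mat_apply (toeplitz w) x) y = ell2_inner x (mat_apply (toeplitz w) y)"
proof -
  have s: "(\<lambda>l. toeplitz w k l * y l) sums mat_apply (toeplitz w) y k" for k
    using acts y unfolding acts_on_ell2_def mat_apply_def by (auto intro: summable_sums)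
  have s': "(\<lambda>l. x k * cnj (toeplitz w k l * y l)) sums (x k * cnj (mat_apply (toeplitz w) y k))" for k
    by (rule sums_mult) (simp only: sums_cnj s)
  have "ell2_inner (mat_apply (toeplitz w) x) y = (\<Sum>l. \<Sum>k<n. x k * cnj (toeplitz w k l * y l))"
    unfolding ell2_inner_def
    by (simp add: mat_apply_finite_support[of n x, OF x] sum_distrib_left sum_distrib_right toeplitz_cnj mult_ac)
  also have "\<dots> = (\<Sum>k<n. \<Sum>l. x k * cnj (toeplitz w k l * y l))"
    by (rule suminf_sum) (rule sums_summable[OF s'])
  also have "\<dots> = (\<Sum>k<n. x k * cnj (mat_apply (toeplitz w) y k))"
    by (intro sum.cong refl sums_unique[symmetric] s')
  also have "\<dots> = ell2_inner x (mat_apply (toeplitz w) y)"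
    by (rule ell2_inner_finite_support(1)[OF x, symmetric])
  finally show ?thesis .
qed

lemma mat_apply_scale_finite_support:
  assumes "\<And>k. n \<le> k \<Longrightarrow> x k = 0"
  shows "mat_apply M (\<lambda>k. c * x k) = (\<lambda>l. c * mat_apply M x l)"
proof
  fix l
  show "mat_apply M (\<lambda>k. c * x k) l = c * mat_apply M x l"
    using assms by (simp add: mat_apply_finite_support[of n] sum_distrib_left mult_ac)
qed

definition truncate :: "nat \<Rightarrow> (nat \<Rightarrow> complex) \<Rightarrow> nat \<Rightarrow> complex" where
  "truncate n c k = (if k < n then c k else 0)"

lemma truncate_zero: "n \<le> k \<Longrightarrow> truncate n c k = 0"
  by (simp add: truncate_def)

lemma truncate_ell2: "truncate n c \<in> ell2"
  by (rule ell2_finite_support[OF truncate_zero])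

lemma ell2_norm_truncate: "(ell2_norm (truncate n c))\<^sup>2 = (\<Sum>k<n. (cmod (c k))\<^sup>2)"
proof -
  have "(\<Sum>k. (cmod (truncate n c k))\<^sup>2) = (\<Sum>k<n. (cmod (truncate n c k))\<^sup>2)"
    by (rule suminf_finite) (auto simp: truncate_def)
  then show ?thesis by (simp add: ell2_norm_power2[OF truncate_ell2] truncate_def)
qed

lemma partial_sum_truncate: "partial_sum (truncate n c) n = partial_sum c n"
  by (simp add: partial_sum_def truncate_def fun_eq_iff)

lemma AE_nonneg_of_partial_sum:
  assumes w: "integrable freq w"
    and pos: "\<And>c n. 0 \<le> (LINT t|freq. (cmod (partial_sum c n t))\<^sup>2 * w t)"
  shows "AE t in freq. 0 \<le> w t"
  by (rule AE_nonneg_of_trig_poly[OF w]) (use pos in \<open>simp add: cmod_partial_sum\<close>)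

lemma partial_sum_bound: "cmod (partial_sum c n t) \<le> (\<Sum>k<n. cmod (c k))"
  unfolding partial_sum_def by (intro order_trans[OF norm_sum] sum_mono) (simp add: norm_mult)

lemma partial_sum_weight_integrable:
  assumes "integrable freq w"
  shows "integrable freq (\<lambda>t. (cmod (partial_sum c n t))\<^sup>2 * w t)"
  by (rule integrable_mult_bounded[OF assms, where B = "(\<Sum>k<n. cmod (c k))\<^sup>2"])
    (auto intro!: AE_I2 power_mono partial_sum_bound)

text \<open>
  The idea is that of the Hellinger--Toeplitz theorem. By symmetry the images of the finitely
  supported vectors of norm at most \<open>1\<close> are weakly bounded, hence bounded in norm by some \<open>K\<close>. So the quadratic form of
  the symbol \<open>K - w\<close> is nonnegative on trigonometric polynomials, and \<open>w \<le> K\<close> follows.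
\<close>
lemma toeplitz_symbol_bounded:
  assumes w: "integrable freq w" and acts: "acts_on_ell2 (toeplitz w)"
  shows "\<exists>M\<ge>0. AE t in freq. w t \<le> M"
proof -
  let ?T = "mat_apply (toeplitz w)"
  let ?S = "{?T (truncate n c) | n c. ell2_norm (truncate n c) \<le> 1}"
  have Te: "?T y \<in> ell2" if "y \<in> ell2" for y using acts that by (auto simp: acts_on_ell2_def)
  have "\<exists>K. \<forall>z\<in>?S. ell2_norm z \<le> K"
  proof (rule ell2_uniform_boundedness)
    show "?S \<subseteq> ell2" using Te truncate_ell2 by auto
    fix y assume y: "y \<in> ell2"
    have "cmod (ell2_inner (?T (truncate n c)) y) \<le> ell2_norm (?T y)" if "ell2_norm (truncate n c) \<le> 1" for n c
    proof -
      have "cmod (ell2_inner (?T (truncate n c)) y) \<le> ell2_norm (truncate n c) * ell2_norm (?T y)"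
        using ell2_Cauchy_Schwarz(2)[OF truncate_ell2 Te[OF y]]
        by (simp add: toeplitz_selfadjoint[OF acts truncate_zero y])
      also have "\<dots> \<le> 1 * ell2_norm (?T y)"
        using that by (rule mult_right_mono) (rule ell2_norm_nonneg[OF Te[OF y]])
      finally show ?thesis by simp
    qed
    then show "\<exists>B. \<forall>x\<in>?S. cmod (ell2_inner x y) \<le> B" by blast
  qed
  then obtain K where K: "\<And>n c. ell2_norm (truncate n c) \<le> 1 \<Longrightarrow> ell2_norm (?T (truncate n c)) \<le> K"
    by blast
  have K0: "0 \<le> K"
  proof -
    have "ell2_norm (truncate 0 (\<lambda>_. 0)) \<le> 1" by (simp add: truncate_def ell2_norm_def)
    from K[OF this] ell2_norm_nonneg[OF Te[OF truncate_ell2]] show ?thesis by (meson order_trans)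
  qed
  have form: "(LINT t|freq. (cmod (partial_sum c n t))\<^sup>2 * w t) \<le> K * (2 * pi * (\<Sum>k<n. (cmod (c k))\<^sup>2))" for c n
  proof -
    let ?x = "truncate n c"
    let ?N = "ell2_norm ?x"
    have "ell2_inner (?T ?x) ?x = of_real ((LINT t|freq. (cmod (partial_sum c n t))\<^sup>2 * w t) / (2 * pi))"
      using toeplitz_form[OF w, of n "truncate n c", OF truncate_zero] by (simp add: partial_sum_truncate)
    then have "\<bar>(LINT t|freq. (cmod (partial_sum c n t))\<^sup>2 * w t) / (2 * pi)\<bar> = cmod (ell2_inner (?T ?x) ?x)"
      by (simp only: norm_of_real)
    also have "\<dots> \<le> ell2_norm (?T ?x) * ?N"
      by (rule ell2_Cauchy_Schwarz(2)[OF Te[OF truncate_ell2] truncate_ell2])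
    also have "\<dots> \<le> K * ?N\<^sup>2"
    proof (cases "?N = 0")
      case False
      then have N: "0 < ?N" using ell2_norm_nonneg[OF truncate_ell2, of n c] by linarith
      define r where "r = 1 / ?N"
      have r: "0 < r" "r * ?N = 1" using N by (auto simp: r_def)
      have tr: "(\<lambda>k. of_real r * ?x k) = truncate n (\<lambda>k. of_real r * c k)"
        by (auto simp: truncate_def)
      have "ell2_norm (\<lambda>k. of_real r * ?x k) \<le> 1"
        using r by (simp add: ell2_norm_scale[OF truncate_ell2])
      then have "ell2_norm (?T (\<lambda>k. of_real r * ?x k)) \<le> K" unfolding tr by (rule K)
      then have "1 / ?N * ell2_norm (?T ?x) \<le> K"
        using r(1) by (simp add: mat_apply_scale_finite_support[OF truncate_zero] ell2_norm_scale[OF Te[OF truncate_ell2]])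
          (simp add: r_def)
      then have "ell2_norm (?T ?x) \<le> K * ?N" using N by (simp add: field_simps)
      then show ?thesis using N by (simp add: power2_eq_square mult_right_mono mult.assoc[symmetric])
    qed simp
    finally show ?thesis unfolding ell2_norm_truncate by (simp add: field_simps abs_le_iff)
  qed
  have "AE t in freq. 0 \<le> K - w t"
  proof (rule AE_nonneg_of_partial_sum)
    show "0 \<le> (LINT t|freq. (cmod (partial_sum c n t))\<^sup>2 * (K - w t))" for c n
    proof -
      have "(LINT t|freq. (cmod (partial_sum c n t))\<^sup>2 * (K - w t))
          = (LINT t|freq. K * (cmod (partial_sum c n t))\<^sup>2 - (cmod (partial_sum c n t))\<^sup>2 * w t)"
        by (simp add: algebra_simps)
      also have "\<dots> = K * (LINT t|freq. (cmod (partial_sum c n t))\<^sup>2) - (LINT t|freq. (cmod (partial_sum c n t))\<^sup>2 * w t)"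
        using partial_sum_weight_integrable[OF w, of c n] partial_sum_square_integrable[of c n]
        by (simp add: square_integrable_def)
      finally show ?thesis using form[of c n] by (simp add: Parseval_partial_sum)
    qed
  qed (use w in simp)
  then show ?thesis using K0 by (intro exI[of _ K]) auto
qed

lemma toeplitz_bounded_symbol:
  assumes w: "integrable freq w" and M: "AE t in freq. \<bar>w t\<bar> \<le> M" and x: "x \<in> ell2"
  shows "(\<lambda>k. toeplitz w l k * x k) sums fourier_coeff (\<lambda>t. of_real (w t) * fourier_sum x t) (real l + 1)"
    and "mat_apply (toeplitz w) x = (\<lambda>l. fourier_coeff (\<lambda>t. of_real (w t) * fourier_sum x t) (real l + 1))"
proof -
  have [measurable]: "w \<in> borel_measurable freq" using w by simp
  show s: "(\<lambda>k. toeplitz w l k * x k) sums fourier_coeff (\<lambda>t. of_real (w t) * fourier_sum x t) (real l + 1)" for l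
  proof -
    let ?\<phi> = "\<lambda>t. cis (- t * (real l + 1)) * of_real (w t)"
    have "square_integrable ?\<phi>"
    proof (rule square_integrable_bounded)
      show "AE t in freq. cmod (?\<phi> t) \<le> M" using M by eventually_elim (simp add: norm_mult)
    qed measurable
    from tendsto_divide[OF integral_fourier_sum_limit(1)[OF x this] tendsto_const[of "of_real (2 * pi)"]]
    show ?thesis unfolding sums_def toeplitz_partial_sum[OF w] fourier_coeff_def by (simp add: mult.assoc)
  qed
  show "mat_apply (toeplitz w) x = (\<lambda>l. fourier_coeff (\<lambda>t. of_real (w t) * fourier_sum x t) (real l + 1))"
    unfolding mat_apply_def using sums_unique[OF s] by auto
qed

lemma square_integrable_symbol_mult:
  assumes w: "integrable freq w" and M: "AE t in freq. \<bar>w t\<bar> \<le> M" and \<phi>: "square_integrable \<phi>"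
  shows "square_integrable (\<lambda>t. of_real (w t) * \<phi> t)"
  using w M by (intro square_integrable_mult_bounded[OF \<phi>, where B = M]) auto

text \<open>
  The transposed matrix is the entrywise conjugate, so it acts by conjugating before and after.
\<close>
lemma acts_on_ell2_toeplitz:
  assumes w: "integrable freq w" and M: "AE t in freq. \<bar>w t\<bar> \<le> M"
  shows "acts_on_ell2 (toeplitz w)" "acts_on_ell2 (\<lambda>l k. toeplitz w k l)"
proof -
  show T: "acts_on_ell2 (toeplitz w)"
    unfolding acts_on_ell2_def
  proof (intro ballI conjI allI)
    fix x l assume x: "x \<in> ell2"
    show "summable (\<lambda>k. toeplitz w l k * x k)" by (rule sums_summable[OF toeplitz_bounded_symbol(1)[OF w M x]])
    show "mat_apply (toeplitz w) x \<in> ell2"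
      unfolding toeplitz_bounded_symbol(2)[OF w M x]
      by (rule fourier_coeff_ell2(1)[OF square_integrable_symbol_mult[OF w M fourier_sum_square_integrable[OF x]]])
  qed
  show "acts_on_ell2 (\<lambda>l k. toeplitz w k l)"
    unfolding acts_on_ell2_def
  proof (intro ballI conjI allI)
    fix x assume x: "x \<in> ell2"
    have s: "(\<lambda>k. toeplitz w l k * cnj (x k)) sums mat_apply (toeplitz w) (\<lambda>k. cnj (x k)) l" for l
      using T ell2_cnj[OF x] unfolding acts_on_ell2_def mat_apply_def by (auto intro: summable_sums)
    have s': "(\<lambda>k. toeplitz w k l * x k) sums cnj (mat_apply (toeplitz w) (\<lambda>k. cnj (x k)) l)" for l
      using sums_cnj[THEN iffD2, OF s[of l]] by (simp add: toeplitz_cnj)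
    show "summable (\<lambda>k. toeplitz w k l * x k)" for l by (rule sums_summable[OF s'])
    have "mat_apply (\<lambda>l k. toeplitz w k l) x = (\<lambda>l. cnj (mat_apply (toeplitz w) (\<lambda>k. cnj (x k)) l))"
      unfolding mat_apply_def[of "\<lambda>l k. toeplitz w k l"] using sums_unique[OF s'] by auto
    also have "\<dots> \<in> ell2" using T ell2_cnj[OF x] by (intro ell2_cnj) (auto simp: acts_on_ell2_def)
    finally show "mat_apply (\<lambda>l k. toeplitz w k l) x \<in> ell2" .
  qed
qed

text \<open>
  Since every vector is of the form \<open>T z\<close>, symmetry shows that the finitely supported \<open>x\<close> with
  \<open>\<parallel>T x\<parallel> \<le> 1\<close> are weakly bounded, so that \<open>\<parallel>x\<parallel> \<le> K * \<parallel>T x\<parallel>\<close>. With \<open>M\<close> an upper bound of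
  \<open>w\<close>, Bessel's inequality and \<open>w\<^sup>2 \<le> M * w\<close> bound \<open>\<parallel>T x\<parallel>\<^sup>2\<close> by \<open>M\<close> times the quadratic form of
  \<open>w\<close>. The form of \<open>w - d\<close> is then nonnegative for a small constant \<open>d\<close>.
\<close>
lemma toeplitz_symbol_bounded_below:
  assumes w: "integrable freq w" and w0: "AE t in freq. 0 \<le> w t" and inv: "invertible_on_ell2 (toeplitz w)"
  shows "\<exists>d>0. AE t in freq. d \<le> w t"
proof -
  let ?T = "mat_apply (toeplitz w)"
  have acts: "acts_on_ell2 (toeplitz w)" and bij: "bij_betw ?T ell2 ell2"
    using inv by (auto simp: invertible_on_ell2_def)
  obtain M where M0: "0 \<le> M" and M: "AE t in freq. w t \<le> M" using toeplitz_symbol_bounded[OF w acts] by blast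
  have Te: "?T y \<in> ell2" if "y \<in> ell2" for y using acts that by (auto simp: acts_on_ell2_def)
  let ?S = "{truncate n c | n c. ell2_norm (?T (truncate n c)) \<le> 1}"
  have "\<exists>K. \<forall>z\<in>?S. ell2_norm z \<le> K"
  proof (rule ell2_uniform_boundedness)
    show "?S \<subseteq> ell2" using truncate_ell2 by auto
    fix y assume y: "y \<in> ell2"
    then obtain z where z: "z \<in> ell2" "y = ?T z" using bij by (auto simp: bij_betw_def image_iff)
    have "cmod (ell2_inner (truncate n c) y) \<le> ell2_norm z" if "ell2_norm (?T (truncate n c)) \<le> 1" for n c
    proof -
      have "cmod (ell2_inner (truncate n c) y) \<le> ell2_norm (?T (truncate n c)) * ell2_norm z"
        using ell2_Cauchy_Schwarz(2)[OF Te[OF truncate_ell2] z(1), of n c]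
        by (simp add: z(2) toeplitz_selfadjoint[OF acts truncate_zero z(1)])
      also have "\<dots> \<le> 1 * ell2_norm z"
        using that by (rule mult_right_mono) (rule ell2_norm_nonneg[OF z(1)])
      finally show ?thesis by simp
    qed
    then show "\<exists>B. \<forall>x\<in>?S. cmod (ell2_inner x y) \<le> B" by blast
  qed
  then obtain K' where K': "\<And>n c. ell2_norm (?T (truncate n c)) \<le> 1 \<Longrightarrow> ell2_norm (truncate n c) \<le> K'"
    by blast
  define K where "K = max 0 K'"
  have K0: "0 \<le> K" and K: "\<And>n c. ell2_norm (?T (truncate n c)) \<le> 1 \<Longrightarrow> ell2_norm (truncate n c) \<le> K"
    using K' by (auto simp: K_def le_max_iff_disj)
  have lower: "ell2_norm (truncate n c) \<le> K * ell2_norm (?T (truncate n c))" for n c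
  proof (rule ccontr)
    let ?x = "truncate n c"
    assume "\<not> ?thesis"
    then have less: "K * ell2_norm (?T ?x) < ell2_norm ?x" by simp
    have nn: "0 \<le> ell2_norm (?T ?x)" by (rule ell2_norm_nonneg[OF Te[OF truncate_ell2]])
    have N: "0 < ell2_norm ?x" using less mult_nonneg_nonneg[OF K0 nn] by linarith
    \<comment> \<open>A multiple of \<open>?x\<close> that lies in \<open>?S\<close> but is longer than \<open>K\<close>; if \<open>?T ?x\<close> vanishes, all multiples lie in \<open>?S\<close>.\<close>
    define r where "r = (if ell2_norm (?T ?x) = 0 then (K + 1) / ell2_norm ?x else 1 / ell2_norm (?T ?x))"
    have r: "0 < r" "r * ell2_norm (?T ?x) \<le> 1" "K < r * ell2_norm ?x"
      using N nn less K0 by (auto simp: r_def field_simps)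
    have tr: "(\<lambda>k. of_real r * ?x k) = truncate n (\<lambda>k. of_real r * c k)"
      by (auto simp: truncate_def)
    have "ell2_norm (?T (\<lambda>k. of_real r * ?x k)) \<le> 1"
      using r by (simp add: mat_apply_scale_finite_support[OF truncate_zero] ell2_norm_scale[OF Te[OF truncate_ell2]])
    then have "ell2_norm (\<lambda>k. of_real r * ?x k) \<le> K" unfolding tr by (rule K)
    then show False using r by (simp add: ell2_norm_scale[OF truncate_ell2])
  qed
  let ?q = "\<lambda>c n. LINT t|freq. (cmod (partial_sum c n t))\<^sup>2 * w t"
  have form: "2 * pi * (\<Sum>k<n. (cmod (c k))\<^sup>2) \<le> K\<^sup>2 * M * ?q c n" for c n
  proof -
    let ?x = "truncate n c"
    let ?\<phi> = "\<lambda>t. of_real (w t) * partial_sum c n t"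
    have "AE t in freq. \<bar>w t\<bar> \<le> M" using w0 M by eventually_elim simp
    from square_integrable_symbol_mult[OF w this partial_sum_square_integrable]
    have sq: "square_integrable ?\<phi>" .
    have Tx: "?T ?x = (\<lambda>l. fourier_coeff ?\<phi> (real l + 1))"
      by (simp add: fun_eq_iff mat_apply_finite_support[OF truncate_zero] toeplitz_partial_sum[OF w] partial_sum_truncate)
    have "2 * pi * (ell2_norm (?T ?x))\<^sup>2 \<le> (LINT t|freq. (cmod (?\<phi> t))\<^sup>2)"
      unfolding Tx by (rule fourier_coeff_ell2(2)[OF sq])
    also have "\<dots> \<le> (LINT t|freq. M * ((cmod (partial_sum c n t))\<^sup>2 * w t))"
    proof (rule integral_mono_AE)
      show "AE t in freq. (cmod (?\<phi> t))\<^sup>2 \<le> M * ((cmod (partial_sum c n t))\<^sup>2 * w t)"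
        using w0 M
      proof eventually_elim
        case (elim t)
        have "(cmod (?\<phi> t))\<^sup>2 = w t * ((cmod (partial_sum c n t))\<^sup>2 * w t)"
          using elim by (simp add: norm_mult power_mult_distrib power2_eq_square)
        also have "\<dots> \<le> M * ((cmod (partial_sum c n t))\<^sup>2 * w t)"
          using elim by (intro mult_right_mono) auto
        finally show ?case .
      qed
    qed (use sq partial_sum_weight_integrable[OF w, of c n] in \<open>auto simp: square_integrable_def\<close>)
    finally have 1: "2 * pi * (ell2_norm (?T ?x))\<^sup>2 \<le> M * ?q c n" by simp
    have "(ell2_norm ?x)\<^sup>2 \<le> (K * ell2_norm (?T ?x))\<^sup>2"
      by (intro power_mono lower ell2_norm_nonneg[OF truncate_ell2])
    then have "2 * pi * (\<Sum>k<n. (cmod (c k))\<^sup>2) \<le> 2 * pi * (K * ell2_norm (?T ?x))\<^sup>2"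
      unfolding ell2_norm_truncate by simp
    also have "\<dots> = K\<^sup>2 * (2 * pi * (ell2_norm (?T ?x))\<^sup>2)" by (simp add: power_mult_distrib)
    also have "\<dots> \<le> K\<^sup>2 * (M * ?q c n)" using 1 by (rule mult_left_mono) simp
    finally show ?thesis by (simp add: mult.assoc)
  qed
  \<comment> \<open>Adding \<open>1\<close> keeps the constant finite when \<open>K\<close> or \<open>M\<close> is zero.\<close>
  let ?d = "1 / (K\<^sup>2 * M + 1)"
  have KM: "0 < K\<^sup>2 * M + 1" using M0 by (simp add: add_nonneg_pos)
  have "AE t in freq. 0 \<le> w t - ?d"
  proof (rule AE_nonneg_of_partial_sum)
    show "0 \<le> (LINT t|freq. (cmod (partial_sum c n t))\<^sup>2 * (w t - ?d))" for c n
    proof -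
      have "(LINT t|freq. (cmod (partial_sum c n t))\<^sup>2 * (w t - ?d))
          = (LINT t|freq. (cmod (partial_sum c n t))\<^sup>2 * w t - ?d * (cmod (partial_sum c n t))\<^sup>2)"
        by (rule Bochner_Integration.integral_cong) (simp_all add: right_diff_distrib)
      also have "\<dots> = ?q c n - ?d * (2 * pi * (\<Sum>k<n. (cmod (c k))\<^sup>2))"
        using partial_sum_weight_integrable[OF w, of c n] partial_sum_square_integrable[of c n]
        by (subst Bochner_Integration.integral_diff)
          (simp_all add: square_integrable_def Parseval_partial_sum)
      finally have eq: "(LINT t|freq. (cmod (partial_sum c n t))\<^sup>2 * (w t - ?d)) = \<dots>" .
      have "0 \<le> ?q c n" using w0 by (intro integral_nonneg_AE) auto
      then have "2 * pi * (\<Sum>k<n. (cmod (c k))\<^sup>2) \<le> (K\<^sup>2 * M + 1) * ?q c n"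
        using form[where c = c and n = n] by (simp add: distrib_right)
      then have "?d * (2 * pi * (\<Sum>k<n. (cmod (c k))\<^sup>2)) \<le> ?q c n"
        using KM by (simp add: field_simps)
      then show ?thesis unfolding eq by simp
    qed
  qed (use w in simp)
  then show ?thesis using KM by (intro exI[of _ ?d]) auto
qed

section \<open>The error of the optimal spectral characteristic\<close>

lemma cis_mult_left: "cis x * (cis y * z) = cis (x + y) * z"
  by (simp add: mult.assoc[symmetric] cis_mult)

lemma mult_cnj_scaled: "z * cnj (z * of_real r) = of_real ((cmod z)\<^sup>2 * r)"
  by (simp only: of_real_mult complex_norm_square complex_cnj_mult complex_cnj_complex_of_real mult.assoc)

text \<open>
  The theorem of Pythagoras before integration. In the application \<open>x\<close> and \<open>y\<close> are the values of
  the two densities and \<open>C\<close> is the residual of \<open>h\<close>; the last term vanishes after integration when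
  \<open>p - h\<close> is orthogonal to \<open>C\<close>.
\<close>
lemma error_around_projection:
  fixes A h p C :: complex and x y :: real
  assumes "C = of_real x * (A - h) - of_real y * h"
  shows "(cmod (A - p))\<^sup>2 * x + (cmod p)\<^sup>2 * y
    = ((cmod (A - h))\<^sup>2 * x + (cmod h)\<^sup>2 * y) + (cmod (p - h))\<^sup>2 * (x + y) - 2 * Re ((p - h) * cnj C)"
  unfolding assms cmod_power2 by (simp add: power2_eq_square algebra_simps)

lemma Re_scaled_diff: "Re (of_real r * (of_real p * z - of_real q)) = r * (p * Re z - q)"
  by simp

lemma mult_diff_divide_self: "x * (T - x) / T = x - x * x / T" if "T \<noteq> 0" for x T :: real
  using that by (simp add: diff_divide_distrib right_diff_distrib)

lemma expand_quadratic_over: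
  fixes A c r x S :: real
  assumes "S \<noteq> 0"
  shows "(x\<^sup>2 * A - 2 * x * r + c) / S\<^sup>2 * S = A * (x * x / S) - c * (1 / S) - 2 * ((x * r - c) / S)"
  using assms by (simp add: power2_eq_square field_simps)

lemma ennreal_linear_combination:
  "ennreal (p * x + q * y) = ennreal p * ennreal x + ennreal q * ennreal y"
  if "0 \<le> p" "0 \<le> x" "0 \<le> q" "0 \<le> y"
  using that by (simp add: ennreal_mult)

lemma A_fun_sums:
  assumes "summable (\<lambda>k. cmod (a k))"
  shows "(\<lambda>k. a k * cis (- t * real k)) sums A_fun a t"
  unfolding A_fun_def
  by (rule summable_sums, rule summable_norm_cancel) (use assms in \<open>simp add: norm_mult\<close>)

lemma A_fun_measurable [measurable]: "A_fun a \<in> borel_measurable freq"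
  unfolding A_fun_def by measurable

lemma A_fun_bounded:
  assumes "summable (\<lambda>k. cmod (a k))"
  shows "cmod (A_fun a t) \<le> (\<Sum>k. cmod (a k))"
  unfolding A_fun_def
  by (rule order_trans[OF summable_norm]) (use assms in \<open>simp_all add: norm_mult\<close>)

lemma A_fun_integral:
  assumes a: "summable (\<lambda>k. cmod (a k))" and \<phi>: "integrable freq \<phi>"
  shows "(\<lambda>k. a k * (LINT t|freq. cis (- t * real k) * \<phi> t)) sums (LINT t|freq. A_fun a t * \<phi> t)"
proof -
  have [measurable]: "\<phi> \<in> borel_measurable freq" using \<phi> by simp
  let ?s = "\<lambda>n t. (\<Sum>k<n. a k * cis (- t * real k)) * \<phi> t"
  have "(\<lambda>n. LINT t|freq. ?s n t) \<longlonglongrightarrow> (LINT t|freq. A_fun a t * \<phi> t)"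
  proof (rule integral_dominated_convergence[where w = "\<lambda>t. (\<Sum>k. cmod (a k)) * cmod (\<phi> t)"])
    show "AE t in freq. (\<lambda>n. ?s n t) \<longlonglongrightarrow> A_fun a t * \<phi> t"
      using A_fun_sums[OF a] unfolding sums_def by (intro AE_I2 tendsto_mult_right)
    show "AE t in freq. norm (?s n t) \<le> (\<Sum>k. cmod (a k)) * cmod (\<phi> t)" for n
    proof (rule AE_I2)
      fix t
      have "cmod (\<Sum>k<n. a k * cis (- t * real k)) \<le> (\<Sum>k<n. cmod (a k))"
        by (rule order_trans[OF norm_sum]) (simp add: norm_mult)
      also have "\<dots> \<le> (\<Sum>k. cmod (a k))" using a by (intro sum_le_suminf) auto
      finally show "norm (?s n t) \<le> (\<Sum>k. cmod (a k)) * cmod (\<phi> t)"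
        unfolding norm_mult by (rule mult_right_mono) simp
    qed
  qed (use \<phi> in \<open>measurable, auto\<close>)
  moreover have "(LINT t|freq. ?s n t) = (\<Sum>k<n. a k * (LINT t|freq. cis (- t * real k) * \<phi> t))" for n
    using cis_mult_integrable(1)[OF \<phi>]
    by (simp add: sum_distrib_right mult.assoc Bochner_Integration.integral_sum del: mult_minus_left)
  ultimately show ?thesis unfolding sums_def by simp
qed

lemma orthogonal_fourier_sum:
  assumes \<phi>: "square_integrable \<phi>" and co: "\<And>l. fourier_coeff \<phi> (real l + 1) = 0" and c: "c \<in> ell2"
  shows "(LINT t|freq. \<phi> t * cnj (fourier_sum c t)) = 0"
  using Plancherel[OF \<phi> c] by (simp add: co ell2_inner_def)

lemma fourier_coeff_past_poly:
  "fourier_coeff (\<lambda>t. \<Sum>k<n. c k * cis (- t * real k)) (real l + 1) = 0"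
proof -
  have "(LINT t|freq. cis (- t * (real l + 1)) * (\<Sum>k<n. c k * cis (- t * real k)))
      = (LINT t|freq. (\<Sum>k<n. c k * cis (t * of_int (- int l - 1 - int k))))"
  proof (rule Bochner_Integration.integral_cong[OF refl])
    fix t
    have "- t * (real l + 1) + - t * real k = t * of_int (- int l - 1 - int k)" for k :: nat
      by (simp add: algebra_simps)
    then have "cis (- t * (real l + 1)) * cis (- t * real k) = cis (t * of_int (- int l - 1 - int k))" for k
      by (simp only: cis_mult)
    then show "cis (- t * (real l + 1)) * (\<Sum>k<n. c k * cis (- t * real k))
        = (\<Sum>k<n. c k * cis (t * of_int (- int l - 1 - int k)))"
      unfolding sum_distrib_left by (intro sum.cong[OF refl]) (metis mult.left_commute)
  qed
  also have "\<dots> = (\<Sum>k<n. c k * (LINT t|freq. cis (t * of_int (- int l - 1 - int k))))"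
    using freq_integrable_bounded[of "\<lambda>t. cis (t * of_int (- int l - 1 - int k))" 1 for k]
    by (subst Bochner_Integration.integral_sum) auto
  also have "\<dots> = 0"
  proof (rule sum.neutral, rule ballI)
    fix k
    have "- int l - 1 - int k \<noteq> 0" by linarith
    then show "c k * (LINT t|freq. cis (t * of_int (- int l - 1 - int k))) = 0"
      by (simp only: integral_cis_int if_False mult_zero_right)
  qed
  finally show ?thesis by (simp add: fourier_coeff_def)
qed

text \<open>
  The Fejer means of \<open>h\<close> are polynomials in the past, share the bound of \<open>h\<close> and converge to \<open>h\<close> almost
  everywhere along a subsequence. Dominated convergence then works in \<open>L\<^sub>2(w)\<close> for every integrable
  weight at once. This puts the characteristic into the space of each density of the class, not only of those
  for which the operators make sense.
\<close>
lemma L2_past_of_bounded: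
  assumes h [measurable]: "h \<in> borel_measurable freq" and B: "AE t in freq. cmod (h t) \<le> B"
    and co: "\<And>l. fourier_coeff h (real l + 1) = 0"
    and w: "integrable freq w" "AE t in freq. 0 \<le> w t"
  shows "h \<in> L2_past w"
proof -
  have [measurable]: "w \<in> borel_measurable freq" using w by simp
  define B' where "B' = max 0 B"
  have B': "0 \<le> B'" "AE t in freq. cmod (h t) \<le> B'"
    using B by (auto simp: B'_def)
  have ih: "integrable freq h" by (rule freq_integrable_bounded[OF h B])
  have wi: "integrable freq (\<lambda>t. (cmod (\<psi> t))\<^sup>2 * w t)" if "\<psi> \<in> borel_measurable freq" "AE t in freq. cmod (\<psi> t) \<le> K" for \<psi> :: "real \<Rightarrow> complex" and K
  proof (rule integrable_mult_bounded[OF w(1), where B = "K\<^sup>2"])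
    show "AE t in freq. norm ((cmod (\<psi> t))\<^sup>2) \<le> K\<^sup>2"
      using that(2) by eventually_elim (auto intro: power_mono)
  qed (use that in simp)
  obtain r where r: "AE s in freq. (\<lambda>n. fejer_mean (r n) h s) \<longlonglongrightarrow> h s"
    using fejer_AE_subseq[OF ih] by blast
  let ?p = "\<lambda>n. fejer_mean (r n) h"
  have pm [measurable]: "?p n \<in> borel_measurable freq" for n by (rule fejer_mean_measurable[OF ih])
  have diff: "AE t in freq. cmod (h t - ?p n t) \<le> 2 * B'" for n
    using B'(2)
  proof eventually_elim
    case (elim t)
    then show ?case
      using norm_triangle_ineq4[of "h t" "?p n t"] fejer_mean_bounded[OF ih B'(2,1), of "r n" t] by linarith
  qed
  have "(\<lambda>n. LINT t|freq. (cmod (h t - ?p n t))\<^sup>2 * w t) \<longlonglongrightarrow> (LINT t|freq. 0)"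
  proof (rule integral_dominated_convergence[where w = "\<lambda>t. (2 * B')\<^sup>2 * w t"])
    show "AE t in freq. (\<lambda>n. (cmod (h t - ?p n t))\<^sup>2 * w t) \<longlonglongrightarrow> 0"
      using r
    proof eventually_elim
      case (elim t)
      from tendsto_mult_right[OF tendsto_power[OF tendsto_norm[OF tendsto_diff[OF tendsto_const[of "h t"] elim]], of 2], of "w t"]
      show ?case by simp
    qed
    show "AE t in freq. norm ((cmod (h t - ?p n t))\<^sup>2 * w t) \<le> (2 * B')\<^sup>2 * w t" for n
      using diff[of n] w(2)
    proof eventually_elim
      case (elim t)
      have "(cmod (h t - ?p n t))\<^sup>2 * w t \<le> (2 * B')\<^sup>2 * w t"
        using elim by (intro mult_right_mono power_mono) auto
      then show ?case using elim by simp
    qed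
  qed (use w in \<open>measurable, auto\<close>)
  then have lim: "(\<lambda>n. ennreal (LINT t|freq. (cmod (h t - ?p n t))\<^sup>2 * w t)) \<longlonglongrightarrow> 0"
    using tendsto_ennrealI by fastforce
  have nn: "(\<integral>\<^sup>+t. ennreal ((cmod (h t - ?p n t))\<^sup>2 * w t) \<partial>freq)
      = ennreal (LINT t|freq. (cmod (h t - ?p n t))\<^sup>2 * w t)" for n
    using wi[OF _ diff[of n]] w(2) by (intro nn_integral_eq_integral) (auto elim!: eventually_mono)
  have "\<exists>n c. (\<integral>\<^sup>+t. ennreal ((cmod (h t - (\<Sum>k<n. c k * cis (- t * real k))))\<^sup>2 * w t) \<partial>freq) < e"
    if "0 < e" for e
  proof -
    have "\<forall>\<^sub>F n in sequentially. ennreal (LINT t|freq. (cmod (h t - ?p n t))\<^sup>2 * w t) < e"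
      by (rule order_tendstoD(2)[OF lim that])
    then obtain n where n: "ennreal (LINT t|freq. (cmod (h t - ?p n t))\<^sup>2 * w t) < e"
      using eventually_happens' by force
    obtain c where c: "\<And>s. ?p n s = (\<Sum>k<r n. c k * cis (- s * real k))"
      using fejer_mean_past_poly[OF ih co] by blast
    have "(\<integral>\<^sup>+t. ennreal ((cmod (h t - (\<Sum>k<r n. c k * cis (- t * real k))))\<^sup>2 * w t) \<partial>freq) < e"
      using n unfolding nn[of n, symmetric] by (simp only: c)
    then show ?thesis by blast
  qed
  moreover have "(\<integral>\<^sup>+t. ennreal ((cmod (h t))\<^sup>2 * w t) \<partial>freq) < \<infinity>"
    using wi[OF h B] w(2) by (subst nn_integral_eq_integral) (auto elim!: eventually_mono)
  ultimately show ?thesis unfolding L2_past_def by simp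
qed

lemma mse_eq_nn_integral:
  assumes [measurable]: "h \<in> borel_measurable freq" "f \<in> borel_measurable freq" "g \<in> borel_measurable freq"
    and f: "AE t in freq. 0 \<le> f t" and g: "AE t in freq. 0 \<le> g t"
  shows "mse a h f g = (\<integral>\<^sup>+t. ennreal ((cmod (A_fun a t - h t))\<^sup>2 * f t + (cmod (h t))\<^sup>2 * g t) \<partial>freq) / ennreal (2 * pi)"
proof -
  have "(\<integral>\<^sup>+t. ennreal ((cmod (A_fun a t - h t))\<^sup>2 * f t + (cmod (h t))\<^sup>2 * g t) \<partial>freq)
      = (\<integral>\<^sup>+t. ennreal ((cmod (A_fun a t - h t))\<^sup>2 * f t) + ennreal ((cmod (h t))\<^sup>2 * g t) \<partial>freq)"
    by (rule nn_integral_cong_AE) (use f g in \<open>eventually_elim, simp\<close>)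
  also have "\<dots> = (\<integral>\<^sup>+t. ennreal ((cmod (A_fun a t - h t))\<^sup>2 * f t) \<partial>freq)
      + (\<integral>\<^sup>+t. ennreal ((cmod (h t))\<^sup>2 * g t) \<partial>freq)"
    by (rule nn_integral_add) measurable
  finally show ?thesis unfolding mse_def by (simp add: divide_ennreal_def distrib_right)
qed

lemma mse_eq_integral:
  assumes "h \<in> borel_measurable freq" "f \<in> borel_measurable freq" "g \<in> borel_measurable freq"
    and f: "AE t in freq. 0 \<le> f t" and g: "AE t in freq. 0 \<le> g t"
    and i: "integrable freq (\<lambda>t. (cmod (A_fun a t - h t))\<^sup>2 * f t + (cmod (h t))\<^sup>2 * g t)"
  shows "mse a h f g = ennreal ((LINT t|freq. (cmod (A_fun a t - h t))\<^sup>2 * f t + (cmod (h t))\<^sup>2 * g t) / (2 * pi))"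
proof -
  have nn: "AE t in freq. 0 \<le> (cmod (A_fun a t - h t))\<^sup>2 * f t + (cmod (h t))\<^sup>2 * g t"
    using f g by eventually_elim simp
  show ?thesis
    unfolding mse_eq_nn_integral[OF assms(1-5)] nn_integral_eq_integral[OF i nn]
    by (rule divide_ennreal) (use nn in \<open>auto intro: integral_nonneg_AE\<close>)
qed

lemma acts_on_ell2_scale:
  assumes "acts_on_ell2 M"
  shows "acts_on_ell2 (\<lambda>l k. q * M l k)"
    and "x \<in> ell2 \<Longrightarrow> mat_apply (\<lambda>l k. q * M l k) x = (\<lambda>l. q * mat_apply M x l)"
proof -
  show eq: "mat_apply (\<lambda>l k. q * M l k) x = (\<lambda>l. q * mat_apply M x l)" if "x \<in> ell2" for x
    using assms that unfolding acts_on_ell2_def mat_apply_def by (simp add: mult.assoc suminf_mult)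
  show "acts_on_ell2 (\<lambda>l k. q * M l k)"
    using assms unfolding acts_on_ell2_def
    by (auto simp: eq[unfolded acts_on_ell2_def] mult.assoc intro: summable_mult ell2_scale)
qed

lemma invertible_on_ell2_scale:
  assumes inv: "invertible_on_ell2 M" and q: "q \<noteq> 0"
  shows "invertible_on_ell2 (\<lambda>l k. q * M l k)"
proof -
  have acts: "acts_on_ell2 M" and bij: "bij_betw (mat_apply M) ell2 ell2"
    using inv by (auto simp: invertible_on_ell2_def)
  have "bij_betw (\<lambda>y l. q * y l) ell2 ell2"
    by (rule bij_betw_byWitness[where f' = "\<lambda>y l. inverse q * y l"])
      (use q in \<open>auto simp: ell2_scale mult.assoc[symmetric]\<close>)
  from bij_betw_trans[OF bij this] have "bij_betw (mat_apply (\<lambda>l k. q * M l k)) ell2 ell2"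
    by (subst bij_betw_cong[where g = "(\<lambda>y l. q * y l) \<circ> mat_apply M"])
      (simp_all add: acts_on_ell2_scale(2)[OF acts])
  then show ?thesis using acts_on_ell2_scale(1)[OF acts] by (simp add: invertible_on_ell2_def)
qed

lemma spectral_density_AE_nonneg: "spectral_density f \<Longrightarrow> AE t in freq. 0 \<le> f t"
  by (rule AE_I2) (simp add: spectral_density_def space_freq)

lemma spectral_density_add: "spectral_density f \<Longrightarrow> spectral_density g \<Longrightarrow> spectral_density (\<lambda>t. f t + g t)"
  by (simp add: spectral_density_def)

lemma integrable_dominated_nonneg:
  fixes w v :: "'a \<Rightarrow> real"
  assumes "integrable M v" "w \<in> borel_measurable M" "AE t in M. 0 \<le> w t \<and> w t \<le> v t"
  shows "integrable M w"
  by (rule Bochner_Integration.integrable_bound[OF assms(1,2)]) (use assms(3) in \<open>eventually_elim, auto\<close>)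

text \<open>
  A pair of densities for which \<open>h(f, g)\<close> is defined. With \<open>u = 1 / (f + g)\<close> one has
  \<open>h = (A f - C) u\<close>, where \<open>C\<close> is the Fourier series with coefficients \<open>P\<inverse> R a\<close>.
\<close>
locale filtering_pair =
  fixes a :: "nat \<Rightarrow> complex" and f g :: "real \<Rightarrow> real"
  assumes a_summable: "summable (\<lambda>k. cmod (a k))"
    and f_density: "spectral_density f" and g_density: "spectral_density g"
    and adm: "admissible f g"
begin

abbreviation u :: "real \<Rightarrow> real" where "u t \<equiv> 1 / (f t + g t)"

definition coef :: "nat \<Rightarrow> complex" where
  "coef = mat_inv_apply (P_mat f g) (mat_apply (R_mat f g) a)"

abbreviation C :: "real \<Rightarrow> complex" where "C \<equiv> correction a f g"
abbreviation h :: "real \<Rightarrow> complex" where "h \<equiv> spectral_char a f g"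

lemma f_int [simp]: "integrable freq f" and g_int [simp]: "integrable freq g"
  using f_density g_density by (auto simp: spectral_density_def)

lemma f_meas [measurable]: "f \<in> borel_measurable freq" and g_meas [measurable]: "g \<in> borel_measurable freq"
  by (rule borel_measurable_integrable, simp)+

lemmas f_nonneg = spectral_density_AE_nonneg[OF f_density]
lemmas g_nonneg = spectral_density_AE_nonneg[OF g_density]

lemma sum_pos: "AE t in freq. 0 < f t + g t"
proof -
  have "(\<integral>\<^sup>+t. 1 / ennreal (f t + g t) \<partial>freq) \<noteq> \<infinity>"
    using adm by (simp add: admissible_def inverse_integrable_def less_top[symmetric])
  then have "AE t in freq. 1 / ennreal (f t + g t) \<noteq> \<infinity>"
    by (intro nn_integral_PInf_AE) measurable
  then show ?thesis
  proof eventually_elim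
    case (elim t)
    then show ?case by (cases "0 < f t + g t") (auto simp: ennreal_neg not_less divide_ennreal_def)
  qed
qed

lemma u_int: "integrable freq u"
proof (rule integrableI_bounded)
  have "(\<integral>\<^sup>+t. ennreal (norm (u t)) \<partial>freq) = (\<integral>\<^sup>+t. 1 / ennreal (f t + g t) \<partial>freq)"
  proof (rule nn_integral_cong_AE)
    show "AE t in freq. ennreal (norm (u t)) = 1 / ennreal (f t + g t)"
      using sum_pos
    proof eventually_elim
      case (elim t)
      then show ?case using divide_ennreal[of 1 "f t + g t"] by simp
    qed
  qed
  also have "\<dots> < \<infinity>" using adm by (simp add: admissible_def inverse_integrable_def)
  finally show "(\<integral>\<^sup>+t. ennreal (norm (u t)) \<partial>freq) < \<infinity>" .
qed measurable

text \<open>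
  This is what invertibility of \<open>P\<close> gives: its symbol \<open>u\<close> is bounded and bounded away from \<open>0\<close>.
\<close>
lemma u_bounds: "\<exists>d M. 0 < d \<and> 0 \<le> M \<and> (AE t in freq. d \<le> u t \<and> \<bar>u t\<bar> \<le> M)"
proof -
  have inv: "invertible_on_ell2 (toeplitz u)" and acts: "acts_on_ell2 (toeplitz u)"
    using adm by (auto simp: admissible_def P_mat_toeplitz)
  have u0: "AE t in freq. 0 \<le> u t" using sum_pos by eventually_elim simp
  obtain M where M: "0 \<le> M" "AE t in freq. u t \<le> M" using toeplitz_symbol_bounded[OF u_int acts] by blast
  obtain d where d: "0 < d" "AE t in freq. d \<le> u t" using toeplitz_symbol_bounded_below[OF u_int u0 inv] by blast
  have "AE t in freq. d \<le> u t \<and> \<bar>u t\<bar> \<le> M"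
    using u0 M(2) d(2) by eventually_elim simp
  then show ?thesis using d(1) M(1) by blast
qed

lemma u_bounded: "\<exists>M. AE t in freq. \<bar>u t\<bar> \<le> M"
  using u_bounds by (auto elim: eventually_mono)

lemma sum_bounded: "\<exists>K. AE t in freq. f t + g t \<le> K"
proof -
  obtain d M where d: "0 < d" "AE t in freq. d \<le> u t \<and> \<bar>u t\<bar> \<le> M" using u_bounds by blast
  have "AE t in freq. f t + g t \<le> 1 / d"
    using d(2) sum_pos
  proof eventually_elim
    case (elim t)
    then have "d * (f t + g t) \<le> 1" by (simp add: field_simps)
    then show ?case using d(1) by (simp add: field_simps)
  qed
  then show ?thesis by blast
qed

lemma a_ell2: "a \<in> ell2"
  by (rule ell2_summable_cmod[OF a_summable])

lemma R_apply:
  "mat_apply (R_mat f g) a = (\<lambda>l. fourier_coeff (\<lambda>t. A_fun a t * of_real (f t / (f t + g t))) (real l + 1))"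
proof
  fix l
  let ?\<phi> = "\<lambda>t. cis (- t * (real l + 1)) * of_real (f t / (f t + g t))"
  have "integrable freq ?\<phi>"
  proof (rule freq_integrable_bounded)
    show "AE t in freq. norm (?\<phi> t) \<le> 1"
      using sum_pos f_nonneg g_nonneg
      by eventually_elim (simp add: norm_mult del: of_real_divide of_real_add)
  qed measurable
  from sums_divide[OF A_fun_integral[OF a_summable this], of "of_real (2 * pi)"]
  have "(\<lambda>m. a m * (LINT t|freq. cis (- t * real m) * ?\<phi> t) / of_real (2 * pi)) sums
      ((LINT t|freq. A_fun a t * ?\<phi> t) / of_real (2 * pi))" .
  moreover have "a m * (LINT t|freq. cis (- t * real m) * ?\<phi> t) / of_real (2 * pi) = R_mat f g l m * a m" for m
  proof -
    have "cis (- t * real m) * ?\<phi> t = cis (- t * (real l + 1 + real m)) * of_real (f t / (f t + g t))" for t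
    proof -
      have "- t * real m + - t * (real l + 1) = - t * (real l + 1 + real m)" by (simp add: algebra_simps)
      then show ?thesis by (simp only: cis_mult_left)
    qed
    then show ?thesis by (simp only: R_mat_def) simp
  qed
  moreover have "(LINT t|freq. A_fun a t * ?\<phi> t) / of_real (2 * pi) = fourier_coeff (\<lambda>t. A_fun a t * of_real (f t / (f t + g t))) (real l + 1)"
    unfolding fourier_coeff_def by (simp add: mult_ac)
  ultimately show "mat_apply (R_mat f g) a l = fourier_coeff (\<lambda>t. A_fun a t * of_real (f t / (f t + g t))) (real l + 1)"
    unfolding mat_apply_def by (simp add: sums_iff)
qed

lemma coef_ell2: "coef \<in> ell2" and P_coef: "mat_apply (P_mat f g) coef = mat_apply (R_mat f g) a"
proof -
  have Ra: "mat_apply (R_mat f g) a \<in> ell2"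
    using adm a_ell2 by (auto simp: admissible_def acts_on_ell2_def)
  have bij: "bij_betw (mat_apply (P_mat f g)) ell2 ell2"
    using adm by (auto simp: admissible_def invertible_on_ell2_def)
  then have im: "mat_apply (R_mat f g) a \<in> mat_apply (P_mat f g) ` ell2"
    using Ra by (simp add: bij_betw_def)
  show "coef \<in> ell2" unfolding coef_def mat_inv_apply_def by (rule inv_into_into[OF im])
  show "mat_apply (P_mat f g) coef = mat_apply (R_mat f g) a"
    unfolding coef_def mat_inv_apply_def by (rule f_inv_into_f[OF im])
qed

lemma C_eq: "C = fourier_sum coef"
  by (simp add: correction_def coef_def)

lemma C_sq: "square_integrable C"
  unfolding C_eq by (rule fourier_sum_square_integrable[OF coef_ell2])

lemma C_meas [measurable]: "C \<in> borel_measurable freq"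
  by (rule square_integrable_measurable[OF C_sq])

lemma uC_sq: "square_integrable (\<lambda>t. of_real (u t) * C t)"
proof -
  obtain M where "AE t in freq. \<bar>u t\<bar> \<le> M" using u_bounded by blast
  then show ?thesis by (rule square_integrable_symbol_mult[OF u_int _ C_sq])
qed

lemma Afu_sq: "square_integrable (\<lambda>t. A_fun a t * of_real (f t / (f t + g t)))"
proof (rule square_integrable_bounded)
  show "AE t in freq. cmod (A_fun a t * of_real (f t / (f t + g t))) \<le> (\<Sum>k. cmod (a k))"
    using sum_pos f_nonneg g_nonneg
  proof eventually_elim
    case (elim t)
    have "cmod (A_fun a t) * (f t / (f t + g t)) \<le> (\<Sum>k. cmod (a k)) * 1"
      using elim A_fun_bounded[OF a_summable, of t]
      by (intro mult_mono) (auto intro: suminf_nonneg a_summable)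
    then show ?case using elim by (simp add: norm_mult del: of_real_divide)
  qed
qed measurable

lemma h_alt: "h = (\<lambda>t. A_fun a t * of_real (f t / (f t + g t)) - of_real (u t) * C t)"
  by (simp add: fun_eq_iff spectral_char_def)

lemma h_sq: "square_integrable h"
  unfolding h_alt by (rule square_integrable_diff[OF Afu_sq uC_sq])

lemma h_meas [measurable]: "h \<in> borel_measurable freq"
  by (rule square_integrable_measurable[OF h_sq])

text \<open>
  Read as \<open>(A - h) f - h g = C\<close>, this identifies \<open>C\<close> as the residual of the least squares problem.
\<close>
lemma h_times: "AE t in freq. h t * of_real (f t + g t) = A_fun a t * of_real (f t) - C t"
  using sum_pos by eventually_elim (simp add: h_alt field_simps flip: of_real_add)

lemma P_coef_coeff: "mat_apply (P_mat f g) coef = (\<lambda>l. fourier_coeff (\<lambda>t. of_real (u t) * C t) (real l + 1))"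
proof -
  obtain M where "AE t in freq. \<bar>u t\<bar> \<le> M" using u_bounded by blast
  from toeplitz_bounded_symbol(2)[OF u_int this coef_ell2] show ?thesis
    by (simp add: P_mat_toeplitz C_eq)
qed

text \<open>
  This is the equation \<open>P c = R a\<close>: the two sides are the positive-frequency coefficients of
  \<open>C u\<close> and of \<open>A f u\<close>, whose difference is \<open>h\<close>.
\<close>
lemma h_coeff: "fourier_coeff h (real l + 1) = 0"
proof -
  let ?x = "\<lambda>t. A_fun a t * of_real (f t / (f t + g t))" and ?y = "\<lambda>t. of_real (u t) * C t"
  have "fourier_coeff h x = fourier_coeff ?x x - fourier_coeff ?y x" for x
    unfolding fourier_coeff_def h_alt
    using cis_mult_integrable(1)[OF square_integrable_imp_integrable[OF Afu_sq]]
      cis_mult_integrable(1)[OF square_integrable_imp_integrable[OF uC_sq]]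
    by (simp only: right_diff_distrib Bochner_Integration.integral_diff diff_divide_distrib)
  moreover have "fourier_coeff ?y (real l + 1) = fourier_coeff ?x (real l + 1)"
    using fun_cong[OF P_coef[unfolded P_coef_coeff R_apply], of l] .
  ultimately show ?thesis by (simp only: diff_self)
qed

text \<open>
  \<open>C\<close> has only positive frequencies, so it is orthogonal to everything that has none.
\<close>
lemma orthogonal_C:
  assumes "square_integrable \<phi>" "\<And>l. fourier_coeff \<phi> (real l + 1) = 0"
  shows "(LINT t|freq. \<phi> t * cnj (C t)) = 0"
  unfolding C_eq by (rule orthogonal_fourier_sum[OF assms coef_ell2])

lemma C2u_int: "integrable freq (\<lambda>t. (cmod (C t))\<^sup>2 * u t)"
proof -
  obtain M where M: "AE t in freq. \<bar>u t\<bar> \<le> M" using u_bounded by blast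
  have "integrable freq (\<lambda>t. u t * (cmod (C t))\<^sup>2)"
    by (rule integrable_mult_bounded[where B = M]) (use C_sq M in \<open>auto simp: square_integrable_def\<close>)
  then show ?thesis by (simp add: mult.commute)
qed

lemma A2_int:
  assumes w: "w \<in> borel_measurable freq" and le: "AE t in freq. 0 \<le> w t \<and> w t \<le> f t"
  shows "integrable freq (\<lambda>t. (cmod (A_fun a t))\<^sup>2 * w t)"
proof (rule integrable_mult_bounded[where B = "(\<Sum>k. cmod (a k))\<^sup>2"])
  show "integrable freq w"
    by (rule integrable_dominated_nonneg[OF f_int w le])
qed (auto intro!: AE_I2 power_mono A_fun_bounded[OF a_summable])

lemma fgu_le: "AE t in freq. 0 \<le> f t * g t / (f t + g t) \<and> f t * g t / (f t + g t) \<le> f t"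
  using sum_pos f_nonneg g_nonneg
  by eventually_elim (auto simp: field_simps)

lemma ffu_le: "AE t in freq. 0 \<le> f t * f t / (f t + g t) \<and> f t * f t / (f t + g t) \<le> f t"
  using sum_pos f_nonneg g_nonneg
  by eventually_elim (auto simp: field_simps)

lemma Q_form:
  "ell2_inner (mat_apply (Q_mat f g) a) a = of_real ((LINT t|freq. (cmod (A_fun a t))\<^sup>2 * (f t * g t / (f t + g t))) / (2 * pi))"
proof -
  let ?w = "\<lambda>t. f t * g t / (f t + g t)"
  have wm: "?w \<in> borel_measurable freq" by measurable
  have wi: "integrable freq ?w"
    by (rule integrable_dominated_nonneg[OF f_int wm fgu_le])
  have Awi: "integrable freq (\<lambda>t. A_fun a t * of_real (?w t))"
    by (rule integrable_mult_bounded[where B = "\<Sum>k. cmod (a k)"])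
      (use wi A_fun_bounded[OF a_summable] in \<open>auto simp del: of_real_divide of_real_mult\<close>)
  have row: "mat_apply (Q_mat f g) a l = (LINT t|freq. cis (t * real l) * (A_fun a t * of_real (?w t))) / of_real (2 * pi)" for l
  proof -
    let ?\<phi> = "\<lambda>t. cis (t * real l) * of_real (?w t)"
    have "integrable freq ?\<phi>" by (rule cis_mult_integrable(2)) (use wi in \<open>simp del: of_real_divide of_real_mult\<close>)
    from sums_divide[OF A_fun_integral[OF a_summable this], of "of_real (2 * pi)"]
    have "(\<lambda>m. a m * (LINT t|freq. cis (- t * real m) * ?\<phi> t) / of_real (2 * pi)) sums
        ((LINT t|freq. A_fun a t * ?\<phi> t) / of_real (2 * pi))" .
    moreover have "a m * (LINT t|freq. cis (- t * real m) * ?\<phi> t) / of_real (2 * pi) = Q_mat f g l m * a m" for m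
    proof -
      have "cis (- t * real m) * ?\<phi> t = cis (t * (real l - real m)) * of_real (?w t)" for t
      proof -
        have "- t * real m + t * real l = t * (real l - real m)" by (simp add: algebra_simps)
        then show ?thesis by (simp only: cis_mult_left)
      qed
      then show ?thesis by (simp only: Q_mat_def) simp
    qed
    moreover have "(LINT t|freq. A_fun a t * ?\<phi> t) = (LINT t|freq. cis (t * real l) * (A_fun a t * of_real (?w t)))"
      by (simp only: mult.left_commute)
    ultimately show ?thesis unfolding mat_apply_def by (simp add: sums_iff)
  qed
  let ?\<psi> = "\<lambda>t. cnj (A_fun a t * of_real (?w t))"
  have "integrable freq ?\<psi>" using Awi by (simp only: integrable_cnj)
  from sums_divide[OF A_fun_integral[OF a_summable this], of "of_real (2 * pi)"]
  have "(\<lambda>l. cnj (a l * (LINT t|freq. cis (- t * real l) * ?\<psi> t) / of_real (2 * pi))) sums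
      cnj ((LINT t|freq. A_fun a t * ?\<psi> t) / of_real (2 * pi))" by (simp only: sums_cnj)
  moreover have "cnj (a l * (LINT t|freq. cis (- t * real l) * ?\<psi> t) / of_real (2 * pi)) = mat_apply (Q_mat f g) a l * cnj (a l)" for l
  proof -
    have "cnj (LINT t|freq. cis (- t * real l) * ?\<psi> t) = (LINT t|freq. cnj (cis (- t * real l) * ?\<psi> t))"
      by (rule Bochner_Integration.integral_cnj[symmetric])
    also have "\<dots> = (LINT t|freq. cis (t * real l) * (A_fun a t * of_real (?w t)))"
      by (simp add: cis_cnj)
    finally show ?thesis unfolding row by (simp add: mult.commute)
  qed
  ultimately have "ell2_inner (mat_apply (Q_mat f g) a) a = cnj ((LINT t|freq. A_fun a t * ?\<psi> t) / of_real (2 * pi))"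
    unfolding ell2_inner_def by (simp add: sums_iff)
  also have "(LINT t|freq. A_fun a t * ?\<psi> t) = (LINT t|freq. of_real ((cmod (A_fun a t))\<^sup>2 * ?w t))"
    by (rule Bochner_Integration.integral_cong[OF refl])
      (rule mult_cnj_scaled)
  also have "\<dots> = of_real (LINT t|freq. (cmod (A_fun a t))\<^sup>2 * ?w t)" by (rule integral_complex_of_real)
  finally show ?thesis by simp
qed

lemma P_form:
  "ell2_inner (mat_apply (R_mat f g) a) coef = of_real ((LINT t|freq. (cmod (C t))\<^sup>2 * u t) / (2 * pi))"
proof -
  have "ell2_inner (mat_apply (R_mat f g) a) coef = (LINT t|freq. of_real (u t) * C t * cnj (C t)) / of_real (2 * pi)"
    unfolding P_coef[symmetric] P_coef_coeff using Plancherel[OF uC_sq coef_ell2] by (simp add: C_eq)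
  also have "(LINT t|freq. of_real (u t) * C t * cnj (C t)) = (LINT t|freq. of_real ((cmod (C t))\<^sup>2 * u t))"
    by (rule Bochner_Integration.integral_cong) (simp_all add: complex_norm_square mult_ac del: of_real_power)
  also have "\<dots> = of_real (LINT t|freq. (cmod (C t))\<^sup>2 * u t)" by (rule integral_complex_of_real)
  finally show ?thesis by simp
qed

lemma objective_eq:
  "operator_objective a f g = (LINT t|freq. (cmod (A_fun a t))\<^sup>2 * (f t * g t / (f t + g t)) + (cmod (C t))\<^sup>2 * u t) / (2 * pi)"
proof -
  have "(LINT t|freq. (cmod (A_fun a t))\<^sup>2 * (f t * g t / (f t + g t)) + (cmod (C t))\<^sup>2 * u t)
      = (LINT t|freq. (cmod (A_fun a t))\<^sup>2 * (f t * g t / (f t + g t))) + (LINT t|freq. (cmod (C t))\<^sup>2 * u t)"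
    by (rule Bochner_Integration.integral_add[OF A2_int[OF _ fgu_le] C2u_int]) measurable
  then show ?thesis
    unfolding operator_objective_def coef_def[symmetric] P_form Q_form
    by (simp add: add_divide_distrib add.commute)
qed

text \<open>
  The mixed terms of the two squares cancel because they carry the weights \<open>f g\<close> and \<open>- f g\<close>.
\<close>
lemma h_integrand:
  "AE t in freq. (cmod (A_fun a t - h t))\<^sup>2 * f t + (cmod (h t))\<^sup>2 * g t
      = (cmod (A_fun a t))\<^sup>2 * (f t * g t / (f t + g t)) + (cmod (C t))\<^sup>2 * u t"
  using sum_pos
proof eventually_elim
  case (elim t)
  let ?s = "f t + g t" and ?A = "A_fun a t" and ?C = "C t"
  let ?r = "Re (?A * cnj ?C)"
  have h: "h t = (of_real (f t) * ?A - ?C) / of_real ?s" by (simp add: h_alt diff_divide_distrib mult.commute)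
  have Ah: "?A - h t = (of_real (g t) * ?A + ?C) / of_real ?s"
  proof -
    have "complex_of_real ?s \<noteq> 0" using elim by (simp only: of_real_eq_0_iff)
    then show ?thesis unfolding h by (simp add: field_simps)
  qed
  have "(cmod (of_real (f t) * ?A - ?C))\<^sup>2 = (f t)\<^sup>2 * (cmod ?A)\<^sup>2 - 2 * f t * ?r + (cmod ?C)\<^sup>2"
    by (simp add: cmod_diff_power2 norm_mult power_mult_distrib mult.assoc)
  then have 1: "(cmod (h t))\<^sup>2 = ((f t)\<^sup>2 * (cmod ?A)\<^sup>2 - 2 * f t * ?r + (cmod ?C)\<^sup>2) / ?s\<^sup>2"
    unfolding h by (simp only: norm_divide power_divide norm_of_real power2_abs)
  have "(cmod (of_real (g t) * ?A + ?C))\<^sup>2 = (g t)\<^sup>2 * (cmod ?A)\<^sup>2 + 2 * g t * ?r + (cmod ?C)\<^sup>2"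
    using cmod_diff_power2[of "of_real (g t) * ?A" "- ?C"]
    by (simp add: norm_mult power_mult_distrib mult.assoc)
  then have 2: "(cmod (?A - h t))\<^sup>2 = ((g t)\<^sup>2 * (cmod ?A)\<^sup>2 + 2 * g t * ?r + (cmod ?C)\<^sup>2) / ?s\<^sup>2"
    unfolding Ah by (simp only: norm_divide power_divide norm_of_real power2_abs)
  have "((g t)\<^sup>2 * (cmod ?A)\<^sup>2 + 2 * g t * ?r + (cmod ?C)\<^sup>2) * f t
      + ((f t)\<^sup>2 * (cmod ?A)\<^sup>2 - 2 * f t * ?r + (cmod ?C)\<^sup>2) * g t
      = ((cmod ?A)\<^sup>2 * (f t * g t) + (cmod ?C)\<^sup>2) * ?s"
    by (simp add: power2_eq_square algebra_simps)
  then have "(cmod (?A - h t))\<^sup>2 * f t + (cmod (h t))\<^sup>2 * g t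
      = ((cmod ?A)\<^sup>2 * (f t * g t) + (cmod ?C)\<^sup>2) * ?s / ?s\<^sup>2"
    unfolding 1 2 by (simp only: times_divide_eq_left add_divide_distrib[symmetric])
  also have "\<dots> = (cmod ?A)\<^sup>2 * (f t * g t / ?s) + (cmod ?C)\<^sup>2 * u t"
    using elim by (simp add: power2_eq_square add_divide_distrib)
  finally show ?case .
qed

lemma h_integrand_int: "integrable freq (\<lambda>t. (cmod (A_fun a t - h t))\<^sup>2 * f t + (cmod (h t))\<^sup>2 * g t)"
proof (subst integrable_cong_AE[OF _ _ h_integrand])
  show "integrable freq (\<lambda>t. (cmod (A_fun a t))\<^sup>2 * (f t * g t / (f t + g t)) + (cmod (C t))\<^sup>2 * u t)"
    by (rule Bochner_Integration.integrable_add[OF A2_int[OF _ fgu_le] C2u_int]) measurable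
qed measurable

lemma mse_h: "mse a h f g = ennreal (operator_objective a f g)"
proof -
  have "(LINT t|freq. (cmod (A_fun a t - h t))\<^sup>2 * f t + (cmod (h t))\<^sup>2 * g t)
      = (LINT t|freq. (cmod (A_fun a t))\<^sup>2 * (f t * g t / (f t + g t)) + (cmod (C t))\<^sup>2 * u t)"
    by (rule integral_cong_AE[OF _ _ h_integrand]) measurable
  then show ?thesis
    unfolding objective_eq mse_eq_integral[OF h_meas f_meas g_meas f_nonneg g_nonneg h_integrand_int] by simp
qed

text \<open>
  Expanding \<open>|A f - C|\<^sup>2 u\<close> leaves a mixed term that \<open>h \<bottom> C\<close> evaluates. The right-hand side is the
  derivative of the objective along the perturbation below.
\<close>
lemma weighted_square_norm_h:
  "(LINT t|freq. (cmod (h t))\<^sup>2 * (f t + g t))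
      = (LINT t|freq. (cmod (A_fun a t))\<^sup>2 * (f t * f t / (f t + g t))) - (LINT t|freq. (cmod (C t))\<^sup>2 * u t)"
proof -
  let ?F = "\<lambda>t. (cmod (A_fun a t))\<^sup>2 * (f t * f t / (f t + g t))" and ?G = "\<lambda>t. (cmod (C t))\<^sup>2 * u t"
  have hC: "integrable freq (\<lambda>t. h t * cnj (C t))"
    by (rule square_integrable_prod[OF h_sq square_integrable_cnj[OF C_sq]])
  have F: "integrable freq ?F" by (rule A2_int[OF _ ffu_le]) measurable
  have "AE t in freq. (cmod (h t))\<^sup>2 * (f t + g t) = ?F t - ?G t - 2 * Re (h t * cnj (C t))"
    using sum_pos
  proof eventually_elim
    case (elim t)
    let ?s = "f t + g t" and ?A = "A_fun a t" and ?C = "C t"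
    have h: "h t = (of_real (f t) * ?A - ?C) / of_real ?s"
      by (simp add: h_alt diff_divide_distrib mult.commute)
    have "(cmod (of_real (f t) * ?A - ?C))\<^sup>2 = (f t)\<^sup>2 * (cmod ?A)\<^sup>2 - 2 * f t * Re (?A * cnj ?C) + (cmod ?C)\<^sup>2"
      by (simp add: cmod_diff_power2 norm_mult power_mult_distrib mult.assoc)
    then have 1: "(cmod (h t))\<^sup>2 = ((f t)\<^sup>2 * (cmod ?A)\<^sup>2 - 2 * f t * Re (?A * cnj ?C) + (cmod ?C)\<^sup>2) / ?s\<^sup>2"
      unfolding h by (simp only: norm_divide power_divide norm_of_real power2_abs)
    have "h t * cnj ?C = of_real (1 / ?s) * (of_real (f t) * (?A * cnj ?C) - of_real ((cmod ?C)\<^sup>2))"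
      unfolding h complex_norm_square by (simp add: left_diff_distrib mult.assoc)
    then have 2: "Re (h t * cnj ?C) = (f t * Re (?A * cnj ?C) - (cmod ?C)\<^sup>2) / ?s"
      by (simp only: Re_scaled_diff) simp
    show ?case unfolding 1 2 using elim by (intro expand_quadratic_over) simp
  qed
  then have "(LINT t|freq. (cmod (h t))\<^sup>2 * (f t + g t)) = (LINT t|freq. ?F t - ?G t - 2 * Re (h t * cnj (C t)))"
    by (intro integral_cong_AE) measurable
  also have "\<dots> = (LINT t|freq. ?F t) - (LINT t|freq. ?G t) - 2 * Re (LINT t|freq. h t * cnj (C t))"
    using F C2u_int hC by (simp only: Bochner_Integration.integral_diff Bochner_Integration.integrable_diff
        integral_mult_right_zero integrable_mult_right integrable_Re integral_Re)
  finally show ?thesis using orthogonal_C[OF h_sq h_coeff] by simp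
qed

text \<open>
  The direction \<open>f + g\<close> is chosen because it multiplies \<open>f + g\<close> by \<open>1 + s\<close>. Then \<open>P\<close> and \<open>R\<close> are
  merely rescaled, \<open>P\<close> stays invertible, and \<open>C\<close> does not change.
\<close>
definition perturbed :: "real \<Rightarrow> real \<Rightarrow> real" where
  "perturbed s t = g t + s * (f t + g t)"

lemma perturbed_density: "0 \<le> s \<Longrightarrow> spectral_density (perturbed s)"
  unfolding perturbed_def using f_density g_density
  by (simp add: spectral_density_def)

lemma perturbed_sum: "f t + perturbed s t = (1 + s) * (f t + g t)"
  by (simp add: perturbed_def algebra_simps)

lemma P_mat_perturbed: "P_mat f (perturbed s) = (\<lambda>l k. of_real (1 / (1 + s)) * P_mat f g l k)"
proof -
  have "cis x / of_real (f t + perturbed s t) = of_real (1 / (1 + s)) * (cis x / of_real (f t + g t))" for x t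
    unfolding perturbed_sum by simp
  then have "P_mat f (perturbed s) l k = of_real (1 / (1 + s)) * P_mat f g l k" for l k
    unfolding P_mat_def by (simp only: integral_mult_right_zero) simp
  then show ?thesis by (intro ext)
qed

lemma R_mat_perturbed: "R_mat f (perturbed s) = (\<lambda>l k. of_real (1 / (1 + s)) * R_mat f g l k)"
proof -
  have "cis x * of_real (f t / (f t + perturbed s t)) = of_real (1 / (1 + s)) * (cis x * of_real (f t / (f t + g t)))" for x t
    unfolding perturbed_sum by simp
  then show ?thesis unfolding R_mat_def by (simp only: integral_mult_right_zero times_divide_eq_right)
qed

text \<open>
  Only the action of \<open>Q\<close> is not inherited by scaling. Its symbol lies below \<open>f\<close>, which is bounded
  because \<open>u\<close> is bounded away from \<open>0\<close>.
\<close>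
lemma perturbed_admissible:
  assumes s: "0 < s"
  shows "admissible f (perturbed s)"
proof -
  have q: "complex_of_real (1 / (1 + s)) \<noteq> 0" using s by (simp only: of_real_eq_0_iff) simp
  have ii: "inverse_integrable f (perturbed s)"
  proof -
    have "(\<integral>\<^sup>+t. 1 / ennreal (f t + perturbed s t) \<partial>freq) = (\<integral>\<^sup>+t. ennreal (1 / (1 + s) * u t) \<partial>freq)"
    proof (rule nn_integral_cong_AE)
      show "AE t in freq. 1 / ennreal (f t + perturbed s t) = ennreal (1 / (1 + s) * u t)"
        using sum_pos
      proof eventually_elim
        case (elim t)
        then show ?case unfolding perturbed_sum
          using s divide_ennreal[of 1 "(1 + s) * (f t + g t)"] by simp
      qed
    qed
    also have "\<dots> < \<infinity>"
    proof -
      have i: "integrable freq (\<lambda>t. 1 / (1 + s) * u t)" using u_int by (rule integrable_mult_right)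
      have "AE t in freq. 0 \<le> 1 / (1 + s) * u t" using sum_pos s by (auto elim!: eventually_mono)
      from nn_integral_eq_integral[OF i this] show ?thesis by simp
    qed
    finally show ?thesis unfolding inverse_integrable_def .
  qed
  have "acts_on_ell2 (Q_mat f (perturbed s))"
  proof -
    let ?w = "\<lambda>t. f t * perturbed s t / (f t + perturbed s t)"
    obtain K where K: "AE t in freq. f t + g t \<le> K" using sum_bounded by blast
    have le: "AE t in freq. 0 \<le> ?w t \<and> ?w t \<le> f t"
      using sum_pos f_nonneg g_nonneg
    proof eventually_elim
      case (elim t)
      have p: "0 \<le> perturbed s t" using elim s by (simp add: perturbed_def)
      have "0 < f t + perturbed s t" unfolding perturbed_sum using elim s by simp
      then show ?case using p elim by (auto simp: field_simps)
    qed
    have wm: "?w \<in> borel_measurable freq" unfolding perturbed_def by measurable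
    have wi: "integrable freq ?w" by (rule integrable_dominated_nonneg[OF f_int wm le])
    have "AE t in freq. \<bar>?w t\<bar> \<le> K"
      using le K g_nonneg
    proof eventually_elim
      case (elim t)
      then show ?case by (simp only: abs_of_nonneg) linarith
    qed
    from acts_on_ell2_toeplitz(2)[OF wi this] show ?thesis by (simp only: Q_mat_toeplitz)
  qed
  then show ?thesis
    using adm ii unfolding admissible_def P_mat_perturbed R_mat_perturbed
    by (blast intro: acts_on_ell2_scale(1) invertible_on_ell2_scale[OF _ q])
qed

lemma perturbed_correction:
  assumes s: "0 < s"
  shows "correction a f (perturbed s) = C"
proof -
  let ?q = "complex_of_real (1 / (1 + s))"
  have actsP: "acts_on_ell2 (P_mat f g)" and actsR: "acts_on_ell2 (R_mat f g)" using adm by (auto simp: admissible_def)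
  have "mat_apply (P_mat f (perturbed s)) coef = mat_apply (R_mat f (perturbed s)) a"
    unfolding P_mat_perturbed R_mat_perturbed acts_on_ell2_scale(2)[OF actsP coef_ell2]
      acts_on_ell2_scale(2)[OF actsR a_ell2] P_coef ..
  moreover have "inj_on (mat_apply (P_mat f (perturbed s))) ell2"
    using perturbed_admissible[OF s] by (simp add: admissible_def invertible_on_ell2_def bij_betw_def)
  ultimately have "mat_inv_apply (P_mat f (perturbed s)) (mat_apply (R_mat f (perturbed s)) a) = coef"
    unfolding mat_inv_apply_def by (metis inv_into_f_f coef_ell2)
  then show ?thesis by (simp add: correction_def coef_def)
qed

text \<open>
  By the formula for the objective, with \<open>C\<close> unchanged, the difference is explicit in \<open>s\<close>. It is
  nonnegative, and zero only if \<open>h\<close> vanishes.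
\<close>
lemma objective_perturbed:
  assumes s: "0 < s"
  shows "operator_objective a f (perturbed s) - operator_objective a f g
      = s / (1 + s) * (LINT t|freq. (cmod (h t))\<^sup>2 * (f t + g t)) / (2 * pi)"
proof -
  interpret pert: filtering_pair a f "perturbed s"
    using a_summable f_density perturbed_density perturbed_admissible[OF s] s by unfold_locales auto
  let ?F = "\<lambda>t. (cmod (A_fun a t))\<^sup>2 * (f t * f t / (f t + g t))" and ?G = "\<lambda>t. (cmod (C t))\<^sup>2 * u t"
  let ?H = "\<lambda>t. (cmod (A_fun a t))\<^sup>2 * (f t * g t / (f t + g t)) + ?G t"
  have F: "integrable freq ?F" by (rule A2_int[OF _ ffu_le]) measurable
  have H: "integrable freq ?H"
    by (rule Bochner_Integration.integrable_add[OF A2_int[OF _ fgu_le] C2u_int]) measurable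
  have "AE t in freq. (cmod (A_fun a t))\<^sup>2 * (f t * perturbed s t / (f t + perturbed s t)) + (cmod (C t))\<^sup>2 * (1 / (f t + perturbed s t))
      = ?H t + s / (1 + s) * (?F t - ?G t)"
    using sum_pos
  proof eventually_elim
    case (elim t)
    define S where "S = f t + g t"
    have g: "g t = S - f t" and p: "perturbed s t = (1 + s) * S - f t" by (simp_all add: S_def perturbed_def algebra_simps)
    have S: "S \<noteq> 0" "1 + s \<noteq> 0" using elim s by (auto simp: S_def)
    have T: "(1 + s) * S \<noteq> 0" using S by simp
    have pS: "f t + perturbed s t = (1 + s) * S" and gS: "f t + g t = S" unfolding p g by simp_all
    have 1: "f t * perturbed s t / (f t + perturbed s t) = f t - f t * f t / S / (1 + s)"
      unfolding pS unfolding p mult_diff_divide_self[OF T] by (simp add: mult.commute)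
    have 2: "f t * g t / (f t + g t) = f t - f t * f t / S"
      unfolding gS unfolding g mult_diff_divide_self[OF S(1)] ..
    have 3: "1 / (f t + perturbed s t) = 1 / S / (1 + s)"
      unfolding pS by (simp add: mult.commute)
    have 4: "x / (1 + s) = x - s / (1 + s) * x" for x
      using S by (simp add: field_simps)
    show ?case unfolding 1 2 3 unfolding S_def[symmetric] 4[of "f t * f t / S"] 4[of "1 / S"]
      by (simp add: algebra_simps)
  qed
  then have "(LINT t|freq. (cmod (A_fun a t))\<^sup>2 * (f t * perturbed s t / (f t + perturbed s t)) + (cmod (C t))\<^sup>2 * (1 / (f t + perturbed s t)))
      = (LINT t|freq. ?H t + s / (1 + s) * (?F t - ?G t))"
    by (intro integral_cong_AE) (simp_all add: perturbed_def)
  also have "\<dots> = (LINT t|freq. ?H t) + s / (1 + s) * ((LINT t|freq. ?F t) - (LINT t|freq. ?G t))"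
    using F H C2u_int by (simp only: Bochner_Integration.integral_add Bochner_Integration.integral_diff
        Bochner_Integration.integrable_diff integral_mult_right_zero integrable_mult_right)
  finally show ?thesis
    unfolding pert.objective_eq objective_eq perturbed_correction[OF s] weighted_square_norm_h
    by (simp only: add_divide_distrib add_diff_cancel_left')
qed

text \<open>
  A polynomial \<open>p\<close> in the past and \<open>h\<close> both have no positive frequencies, so \<open>p - h\<close> is orthogonal to
  the residual \<open>C\<close>.
\<close>
lemma mse_h_le_past_poly:
  assumes B: "AE t in freq. cmod (h t) \<le> B"
  shows "mse a h f g \<le> mse a (\<lambda>t. \<Sum>k<n. c k * cis (- t * real k)) f g"
proof -
  let ?p = "\<lambda>t. \<Sum>k<n. c k * cis (- t * real k)"
  have pm [measurable]: "?p \<in> borel_measurable freq" by measurable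
  have pb: "cmod (?p t) \<le> (\<Sum>k<n. cmod (c k))" for t
    by (rule order_trans[OF norm_sum]) (simp add: norm_mult)
  have p_sq: "square_integrable ?p"
    by (rule square_integrable_bounded[OF pm]) (rule AE_I2, rule pb)
  let ?\<phi> = "\<lambda>t. ?p t - h t"
  have \<phi>_sq: "square_integrable ?\<phi>" by (rule square_integrable_diff[OF p_sq h_sq])
  have \<phi>_co: "fourier_coeff ?\<phi> (real l + 1) = 0" for l
  proof -
    have "fourier_coeff ?\<phi> x = fourier_coeff ?p x - fourier_coeff h x" for x
      unfolding fourier_coeff_def
      using cis_mult_integrable(1)[OF square_integrable_imp_integrable[OF p_sq]]
        cis_mult_integrable(1)[OF square_integrable_imp_integrable[OF h_sq]]
      by (simp only: right_diff_distrib Bochner_Integration.integral_diff diff_divide_distrib)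
    then show ?thesis by (simp only: fourier_coeff_past_poly h_coeff diff_0_right)
  qed
  have cross_int: "integrable freq (\<lambda>t. ?\<phi> t * cnj (C t))"
    by (rule square_integrable_prod[OF \<phi>_sq square_integrable_cnj[OF C_sq]])
  have cross: "(LINT t|freq. ?\<phi> t * cnj (C t)) = 0" by (rule orthogonal_C[OF \<phi>_sq \<phi>_co])
  let ?E = "\<lambda>t. (cmod (A_fun a t - h t))\<^sup>2 * f t + (cmod (h t))\<^sup>2 * g t"
  let ?D = "\<lambda>t. (cmod (?\<phi> t))\<^sup>2 * (f t + g t)"
  have D: "integrable freq ?D"
  proof (rule integrable_mult_bounded[where B = "((\<Sum>k<n. cmod (c k)) + B)\<^sup>2"])
    show "AE t in freq. norm ((cmod (?\<phi> t))\<^sup>2) \<le> ((\<Sum>k<n. cmod (c k)) + B)\<^sup>2"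
      using B
    proof eventually_elim
      case (elim t)
      have "cmod (?\<phi> t) \<le> (\<Sum>k<n. cmod (c k)) + B"
        using norm_triangle_ineq4[of "?p t" "h t"] pb[of t] elim by linarith
      then show ?case by (simp add: power_mono)
    qed
  qed (use f_int g_int in auto)
  have eq: "AE t in freq. (cmod (A_fun a t - ?p t))\<^sup>2 * f t + (cmod (?p t))\<^sup>2 * g t
      = ?E t + ?D t - 2 * Re (?\<phi> t * cnj (C t))"
    using h_times
  proof eventually_elim
    case (elim t)
    have "C t = of_real (f t) * (A_fun a t - h t) - of_real (g t) * h t"
      using elim by (simp add: algebra_simps)
    then show ?case by (rule error_around_projection)
  qed
  have int: "integrable freq (\<lambda>t. ?E t + ?D t - 2 * Re (?\<phi> t * cnj (C t)))"
    by (rule Bochner_Integration.integrable_diff[OF Bochner_Integration.integrable_add[OF h_integrand_int D]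
        integrable_mult_right[OF integrable_Re[OF cross_int]]])
  have pint: "integrable freq (\<lambda>t. (cmod (A_fun a t - ?p t))\<^sup>2 * f t + (cmod (?p t))\<^sup>2 * g t)"
    by (subst integrable_cong_AE[OF _ _ eq]) (use int in measurable)
  have "(LINT t|freq. (cmod (A_fun a t - ?p t))\<^sup>2 * f t + (cmod (?p t))\<^sup>2 * g t)
      = (LINT t|freq. ?E t + ?D t - 2 * Re (?\<phi> t * cnj (C t)))"
    by (rule integral_cong_AE[OF _ _ eq]) measurable
  also have "\<dots> = (LINT t|freq. ?E t) + (LINT t|freq. ?D t) - 2 * Re (LINT t|freq. ?\<phi> t * cnj (C t))"
    unfolding Bochner_Integration.integral_diff[OF Bochner_Integration.integrable_add[OF h_integrand_int D]
        integrable_mult_right[OF integrable_Re[OF cross_int]]]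
      Bochner_Integration.integral_add[OF h_integrand_int D] integral_mult_right_zero integral_Re[OF cross_int] ..
  also have "\<dots> = (LINT t|freq. ?E t) + (LINT t|freq. ?D t)" unfolding cross by simp
  finally have "(LINT t|freq. ?E t) \<le> (LINT t|freq. (cmod (A_fun a t - ?p t))\<^sup>2 * f t + (cmod (?p t))\<^sup>2 * g t)"
    using f_nonneg g_nonneg by (auto intro!: integral_nonneg_AE elim: eventually_elim2)
  then show ?thesis
    unfolding mse_eq_integral[OF h_meas f_meas g_meas f_nonneg g_nonneg h_integrand_int]
      mse_eq_integral[OF pm f_meas g_meas f_nonneg g_nonneg pint]
    by (intro ennreal_leI divide_right_mono) auto
qed

text \<open>
  The constant in front of the first square can be brought arbitrarily close to \<open>1\<close>, as needed for
  passing to a limit in the second summand.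
\<close>
lemma cmod_add_power2_le_weighted:
  assumes "0 < d"
  shows "(cmod (x + y))\<^sup>2 \<le> (1 + d) * (cmod x)\<^sup>2 + (1 + 1 / d) * (cmod y)\<^sup>2"
proof -
  have "(cmod (x + y))\<^sup>2 \<le> (cmod x + cmod y)\<^sup>2" by (intro power_mono norm_triangle_ineq) simp
  also have "\<dots> \<le> (1 + d) * (cmod x)\<^sup>2 + (1 + 1 / d) * (cmod y)\<^sup>2"
  proof -
    have "0 \<le> (d * cmod x - cmod y)\<^sup>2 / d" using assms by simp
    also have "\<dots> = d * (cmod x)\<^sup>2 + (cmod y)\<^sup>2 / d - 2 * cmod x * cmod y"
      using assms by (simp add: field_simps power2_eq_square)
    finally show ?thesis by (simp add: power2_sum algebra_simps)
  qed
  finally show ?thesis .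
qed

text \<open>
  Every \<open>k\<close> in the past is an \<open>L\<^sub>2(f + g)\<close>-limit of polynomials, which err at least as much as \<open>h\<close>. The
  square root of the error is Lipschitz in this norm, so the inequality survives the limit.
\<close>
theorem mse_h_minimal:
  assumes B: "AE t in freq. cmod (h t) \<le> B" and k: "k \<in> L2_past (\<lambda>t. f t + g t)"
  shows "mse a h f g \<le> mse a k f g"
proof (cases "mse a k f g = \<infinity>")
  case False
  have km [measurable]: "k \<in> borel_measurable freq" using k by (simp add: L2_past_def)
  obtain y where y: "0 \<le> y" "mse a k f g = ennreal y" using False by (cases "mse a k f g") auto
  obtain x where x: "0 \<le> x" "mse a h f g = ennreal x"
    using mse_h by (cases "mse a h f g") auto
  \<comment> \<open>Approximating up to \<open>d\<^sup>2\<close> beats the factor \<open>1 + 1 / d\<close>, so both corrections vanish with \<open>d\<close>.\<close>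
  have bound: "x \<le> (1 + d) * y + (1 + 1 / d) * d\<^sup>2 / (2 * pi)" if d: "0 < d" for d
  proof -
    have "0 < ennreal (d\<^sup>2)" using d by simp
    then obtain n c where c: "(\<integral>\<^sup>+t. ennreal ((cmod (k t - (\<Sum>k<n. c k * cis (- t * real k))))\<^sup>2 * (f t + g t)) \<partial>freq) < ennreal (d\<^sup>2)"
      using k unfolding L2_past_def by blast
    let ?p = "\<lambda>t. \<Sum>k<n. c k * cis (- t * real k)"
    have pm [measurable]: "?p \<in> borel_measurable freq" by measurable
    let ?E = "\<lambda>q t. (cmod (A_fun a t - q t))\<^sup>2 * f t + (cmod (q t))\<^sup>2 * g t"
    let ?D = "\<lambda>t. (cmod (k t - ?p t))\<^sup>2 * (f t + g t)"
    have "(\<integral>\<^sup>+t. ennreal (?E ?p t) \<partial>freq)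
        \<le> (\<integral>\<^sup>+t. ennreal (1 + d) * ennreal (?E k t) + ennreal (1 + 1 / d) * ennreal (?D t) \<partial>freq)"
    proof (rule nn_integral_mono_AE)
      show "AE t in freq. ennreal (?E ?p t) \<le> ennreal (1 + d) * ennreal (?E k t) + ennreal (1 + 1 / d) * ennreal (?D t)"
        using f_nonneg g_nonneg
      proof eventually_elim
        case (elim t)
        have 1: "(cmod (A_fun a t - ?p t))\<^sup>2 \<le> (1 + d) * (cmod (A_fun a t - k t))\<^sup>2 + (1 + 1 / d) * (cmod (k t - ?p t))\<^sup>2"
          using cmod_add_power2_le_weighted[OF d, of "A_fun a t - k t" "k t - ?p t"] by simp
        have 2: "(cmod (?p t))\<^sup>2 \<le> (1 + d) * (cmod (k t))\<^sup>2 + (1 + 1 / d) * (cmod (k t - ?p t))\<^sup>2"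
          using cmod_add_power2_le_weighted[OF d, of "k t" "?p t - k t"] by (simp add: norm_minus_commute)
        have "?E ?p t \<le> (1 + d) * ?E k t + (1 + 1 / d) * ?D t"
          using add_mono[OF mult_right_mono[OF 1 elim(1)] mult_right_mono[OF 2 elim(2)]]
          by (simp only: distrib_left distrib_right mult.assoc)
        then have "ennreal (?E ?p t) \<le> ennreal ((1 + d) * ?E k t + (1 + 1 / d) * ?D t)" by (rule ennreal_leI)
        also have "\<dots> = ennreal (1 + d) * ennreal (?E k t) + ennreal (1 + 1 / d) * ennreal (?D t)"
          using d elim by (intro ennreal_linear_combination) auto
        finally show ?case .
      qed
    qed
    also have "\<dots> = ennreal (1 + d) * (\<integral>\<^sup>+t. ennreal (?E k t) \<partial>freq) + ennreal (1 + 1 / d) * (\<integral>\<^sup>+t. ennreal (?D t) \<partial>freq)"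
      by (subst nn_integral_add) (simp_all add: nn_integral_cmult)
    also have "\<dots> \<le> ennreal (1 + d) * (\<integral>\<^sup>+t. ennreal (?E k t) \<partial>freq) + ennreal (1 + 1 / d) * ennreal (d\<^sup>2)"
      using c by (intro add_left_mono mult_left_mono) auto
    finally have le: "(\<integral>\<^sup>+t. ennreal (?E ?p t) \<partial>freq) \<le> \<dots>" .
    have "ennreal x \<le> mse a ?p f g" using mse_h_le_past_poly[OF B] x by simp
    also have "\<dots> \<le> (ennreal (1 + d) * (\<integral>\<^sup>+t. ennreal (?E k t) \<partial>freq) + ennreal (1 + 1 / d) * ennreal (d\<^sup>2)) / ennreal (2 * pi)"
      unfolding mse_eq_nn_integral[OF pm f_meas g_meas f_nonneg g_nonneg] by (rule divide_right_mono_ennreal[OF le])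
    also have "\<dots> = ennreal (1 + d) * mse a k f g + ennreal (1 + 1 / d) * ennreal (d\<^sup>2) / ennreal (2 * pi)"
      unfolding mse_eq_nn_integral[OF km f_meas g_meas f_nonneg g_nonneg]
      by (simp add: divide_ennreal_def distrib_right mult.assoc)
    also have "\<dots> = ennreal ((1 + d) * y + (1 + 1 / d) * d\<^sup>2 / (2 * pi))"
      unfolding y(2) using d y(1)
      by (simp add: ennreal_mult[symmetric] divide_ennreal ennreal_plus[symmetric] del: ennreal_plus)
    finally show ?thesis using d y(1) by (subst (asm) ennreal_le_iff) auto
  qed
  have bound': "x \<le> (1 + d) * y + (d + d\<^sup>2) / (2 * pi)" if d: "0 < d" for d
  proof -
    have "(1 + 1 / d) * d\<^sup>2 = d + d\<^sup>2" using d by (simp add: power2_eq_square distrib_right)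
    then show ?thesis using bound[OF d] by simp
  qed
  have "(\<lambda>n. (1 + 1 / real (Suc n)) * y + (1 / real (Suc n) + (1 / real (Suc n))\<^sup>2) / (2 * pi)) \<longlonglongrightarrow> (1 + 0) * y + (0 + 0\<^sup>2) / (2 * pi)"
    by (intro tendsto_intros LIMSEQ_Suc[OF lim_1_over_n]) auto
  moreover have "x \<le> (1 + 1 / real (Suc n)) * y + (1 / real (Suc n) + (1 / real (Suc n))\<^sup>2) / (2 * pi)" for n
    by (rule bound') simp
  ultimately have "x \<le> y" using LIMSEQ_le_const[of _ "(1 + 0) * y + (0 + 0\<^sup>2) / (2 * pi)" x] by fastforce
  then show ?thesis using x y by (simp add: ennreal_leI)
qed simp

end

section \<open>Saddle point over the contamination class\<close>

lemma contamination_class_props: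
  assumes g1: "spectral_density g1" and eps: "0 < \<epsilon>" "\<epsilon> < 1" and g: "g \<in> contamination_class g1 \<epsilon> P2"
  shows "spectral_density g" "\<And>t. t \<in> {-pi..<pi} \<Longrightarrow> (1 - \<epsilon>) * g1 t \<le> g t"
    "(LINT t|freq. g t) \<le> 2 * pi * P2"
proof -
  obtain w where w: "spectral_density w" "\<And>t. t \<in> {-pi..<pi} \<Longrightarrow> g t = (1 - \<epsilon>) * g1 t + \<epsilon> * w t"
    and P: "(LINT t|freq. g t) / (2 * pi) \<le> P2"
    using g unfolding contamination_class_def by blast
  have "integrable freq (\<lambda>t. (1 - \<epsilon>) * g1 t + \<epsilon> * w t)"
    using g1 w(1) by (simp add: spectral_density_def)
  then have "integrable freq g"
    by (subst Bochner_Integration.integrable_cong[OF refl w(2)]) (simp_all add: space_freq)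
  moreover have "\<forall>t\<in>{-pi..<pi}. 0 \<le> g t"
  proof
    fix t assume t: "t \<in> {-pi..<pi}"
    then have "0 \<le> (1 - \<epsilon>) * g1 t" "0 \<le> \<epsilon> * w t"
      using g1 w(1) eps by (auto simp: spectral_density_def)
    then show "0 \<le> g t" using w(2)[OF t] by simp
  qed
  ultimately show "spectral_density g" by (simp add: spectral_density_def)
  show "(1 - \<epsilon>) * g1 t \<le> g t" if "t \<in> {-pi..<pi}" for t
    using w(2)[OF that] w(1) that eps by (simp add: spectral_density_def)
  show "(LINT t|freq. g t) \<le> 2 * pi * P2" using P by (simp add: field_simps)
qed

context filtering_pair
begin

lemma perturbed_in_contamination_class:
  assumes g: "g \<in> contamination_class g1 \<epsilon> P2" and eps: "0 < \<epsilon>" and s: "0 \<le> s"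
    and room: "(LINT t|freq. perturbed s t) \<le> 2 * pi * P2"
  shows "perturbed s \<in> contamination_class g1 \<epsilon> P2"
proof -
  obtain w where w: "spectral_density w" "\<And>t. t \<in> {-pi..<pi} \<Longrightarrow> g t = (1 - \<epsilon>) * g1 t + \<epsilon> * w t"
    using g unfolding contamination_class_def by blast
  let ?w = "\<lambda>t. w t + s / \<epsilon> * (f t + g t)"
  have "spectral_density ?w"
    using w(1) f_density g_density eps s by (simp add: spectral_density_def)
  moreover have "perturbed s t = (1 - \<epsilon>) * g1 t + \<epsilon> * ?w t" if "t \<in> {-pi..<pi}" for t
  proof -
    have "\<epsilon> * (s / \<epsilon> * (f t + g t)) = s * (f t + g t)" using eps by simp
    then show ?thesis using w(2)[OF that] by (simp only: perturbed_def distrib_left[of \<epsilon>] add.assoc)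
  qed
  moreover have "(LINT t|freq. perturbed s t) / (2 * pi) \<le> P2" using room by (simp add: field_simps)
  ultimately show ?thesis unfolding contamination_class_def by blast
qed

text \<open>
  If the power bound is not attained, a small multiple of \<open>f + g\<close> may be added to \<open>g\<close> within the class. At
  a maximum this must not increase the objective, and the increase is a multiple of the weighted norm
  of \<open>h\<close>.
\<close>
lemma optimal_with_slack_imp_h_zero:
  assumes g: "g \<in> contamination_class g1 \<epsilon> P2" and eps: "0 < \<epsilon>"
    and slack: "(LINT t|freq. g t) < 2 * pi * P2"
    and optimal: "\<And>g'. g' \<in> contamination_class g1 \<epsilon> P2 \<Longrightarrow> admissible f g' \<Longrightarrow>
      operator_objective a f g' \<le> operator_objective a f g"
  shows "AE t in freq. h t = 0"
proof -
  let ?I = "LINT t|freq. f t + g t"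
  have I: "0 \<le> ?I" using sum_pos by (intro integral_nonneg_AE) (auto elim!: eventually_mono)
  \<comment> \<open>At most the whole slack is used up; \<open>?I + 1\<close> avoids a division by zero.\<close>
  define s where "s = (2 * pi * P2 - (LINT t|freq. g t)) / (?I + 1)"
  have s: "0 < s" using slack I by (simp add: s_def)
  have "(LINT t|freq. perturbed s t) = (LINT t|freq. g t) + s * ?I"
    unfolding perturbed_def by simp
  also have "s * ?I \<le> s * (?I + 1)" using s by simp
  also have "s * (?I + 1) = 2 * pi * P2 - (LINT t|freq. g t)" using I by (simp add: s_def)
  finally have "(LINT t|freq. perturbed s t) \<le> 2 * pi * P2" by simp
  then have "perturbed s \<in> contamination_class g1 \<epsilon> P2"
    using s by (intro perturbed_in_contamination_class[OF g eps]) auto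
  from optimal[OF this perturbed_admissible[OF s]] objective_perturbed[OF s]
  have le: "s / (1 + s) * (LINT t|freq. (cmod (h t))\<^sup>2 * (f t + g t)) / (2 * pi) \<le> 0" by linarith
  have "\<not> 0 < (LINT t|freq. (cmod (h t))\<^sup>2 * (f t + g t))"
  proof
    assume "0 < (LINT t|freq. (cmod (h t))\<^sup>2 * (f t + g t))"
    then have "0 < s / (1 + s) * (LINT t|freq. (cmod (h t))\<^sup>2 * (f t + g t)) / (2 * pi)"
      using s by (intro divide_pos_pos mult_pos_pos) auto
    then show False using le by linarith
  qed
  moreover have nn: "AE t in freq. 0 \<le> (cmod (h t))\<^sup>2 * (f t + g t)"
    using sum_pos by eventually_elim simp
  then have "0 \<le> (LINT t|freq. (cmod (h t))\<^sup>2 * (f t + g t))" by (rule integral_nonneg_AE)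
  ultimately have zero: "(LINT t|freq. (cmod (h t))\<^sup>2 * (f t + g t)) = 0" by linarith
  have "integrable freq (\<lambda>t. (cmod (h t))\<^sup>2 * (f t + g t))"
  proof -
    obtain K where K: "AE t in freq. f t + g t \<le> K" using sum_bounded by blast
    have "integrable freq (\<lambda>t. (f t + g t) * (cmod (h t))\<^sup>2)"
    proof (rule integrable_mult_bounded[where B = K])
      show "integrable freq (\<lambda>t. (cmod (h t))\<^sup>2)" using h_sq by (simp add: square_integrable_def)
      show "AE t in freq. norm (f t + g t) \<le> K" using K sum_pos by eventually_elim simp
    qed simp
    then show ?thesis by (simp add: mult.commute)
  qed
  then have "AE t in freq. (cmod (h t))\<^sup>2 * (f t + g t) = 0"
    using zero nn by (simp add: integral_nonneg_eq_0_iff_AE)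
  then show ?thesis using sum_pos
  proof eventually_elim
    case (elim t)
    then have "(cmod (h t))\<^sup>2 = 0" by (metis less_irrefl mult_eq_0_iff)
    then show ?case by simp
  qed
qed

end

theorem theorem8:
  fixes a :: "nat \<Rightarrow> complex" and f g1 g0 :: "real \<Rightarrow> real" and \<epsilon> P2 \<alpha>2 :: real
  assumes a_summable: "summable (\<lambda>k. cmod (a k))"
    and a_weighted: "summable (\<lambda>k. real (k + 1) * (cmod (a k))\<^sup>2)"
    and f: "spectral_density f"
    and g1: "spectral_density g1"
    and P2: "P2 > 0"
    and eps: "0 < \<epsilon>" "\<epsilon> < 1"
    and g0: "g0 \<in> contamination_class g1 \<epsilon> P2"
    and inv_int: "inverse_integrable f g0"
    and adm: "admissible f g0"
    and bounded: "\<exists>C. AE t in freq.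
          cmod (A_fun a t * of_real (f t) - correction a f g0 t) / (f t + g0 t) \<le> C"
    and alpha2: "\<alpha>2 > 0"
    and g0_form: "AE t in freq. g0 t = max ((1 - \<epsilon>) * g1 t)
          (\<alpha>2 * cmod (A_fun a t * of_real (f t) - correction a f g0 t) - f t)"
    and optimal: "\<And>g. g \<in> contamination_class g1 \<epsilon> P2 \<Longrightarrow> admissible f g \<Longrightarrow>
          operator_objective a f g \<le> operator_objective a f g0"
  shows "least_favorable a f (contamination_class g1 \<epsilon> P2) g0 \<and>
         minimax_robust a f (contamination_class g1 \<epsilon> P2) (spectral_char a f g0)"
proof
  let ?D = "contamination_class g1 \<epsilon> P2"
  note D = contamination_class_props[OF g1 eps]
  interpret F0: filtering_pair a f g0
    by unfold_locales (rule a_summable f D(1)[OF g0] adm)+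
  let ?h = "spectral_char a f g0"
  show "least_favorable a f ?D g0"
    unfolding least_favorable_def
  proof (intro conjI g0 adm ballI impI)
    fix g assume g: "g \<in> ?D" "admissible f g"
    interpret F: filtering_pair a f g
      by unfold_locales (rule a_summable f D(1)[OF g(1)] g(2))+
    show "mse a (spectral_char a f g) f g \<le> mse a ?h f g0"
      unfolding F.mse_h F0.mse_h by (rule ennreal_leI[OF optimal[OF g]])
  qed
  have h_le: "AE t in freq. cmod (?h t) \<le> 1 / \<alpha>2"
    and h_gain: "AE t in freq. \<forall>x. (1 - \<epsilon>) * g1 t \<le> x \<longrightarrow> (cmod (?h t))\<^sup>2 * (x - g0 t) \<le> (1 / \<alpha>2)\<^sup>2 * (x - g0 t)"
  proof -
    \<comment> \<open>Dividing the formula for \<open>g0\<close> by \<open>f + g0\<close>: the maximum is at least its second entry, and equal to it off the set where the first entry is attained.\<close>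
    have *: "AE t in freq. cmod (?h t) \<le> 1 / \<alpha>2 \<and> (g0 t = (1 - \<epsilon>) * g1 t \<or> cmod (?h t) = 1 / \<alpha>2)"
      using g0_form F0.h_times F0.sum_pos
    proof eventually_elim
      case (elim t)
      have "cmod (?h t) * (f t + g0 t) = cmod (A_fun a t * of_real (f t) - correction a f g0 t)"
        unfolding elim(2)[symmetric] norm_mult norm_of_real using elim(3) by simp
      then have g0: "g0 t = max ((1 - \<epsilon>) * g1 t) (\<alpha>2 * (cmod (?h t) * (f t + g0 t)) - f t)"
        using elim(1) by simp
      then have "(\<alpha>2 * cmod (?h t)) * (f t + g0 t) \<le> 1 * (f t + g0 t)" by (simp add: mult.assoc)
      then have "\<alpha>2 * cmod (?h t) \<le> 1" using elim(3) by (simp only: mult_le_cancel_right)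
      then have le: "cmod (?h t) \<le> 1 / \<alpha>2" using alpha2 by (simp add: field_simps)
      have "cmod (?h t) = 1 / \<alpha>2" if "g0 t \<noteq> (1 - \<epsilon>) * g1 t"
      proof -
        have "g0 t = \<alpha>2 * (cmod (?h t) * (f t + g0 t)) - f t" using g0 that by (simp add: max_def split: if_splits)
        from eq_diff_eq[THEN iffD1, OF this]
        have "(\<alpha>2 * cmod (?h t)) * (f t + g0 t) = 1 * (f t + g0 t)"
          by (simp only: mult.assoc mult_1 add.commute)
        then have "\<alpha>2 * cmod (?h t) = 1" using elim(3) by (simp only: mult_right_cancel)
        then show ?thesis using alpha2 by (simp add: field_simps)
      qed
      then show ?case using le by blast
    qed
    show "AE t in freq. cmod (?h t) \<le> 1 / \<alpha>2" using * by eventually_elim simp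
    show "AE t in freq. \<forall>x. (1 - \<epsilon>) * g1 t \<le> x \<longrightarrow> (cmod (?h t))\<^sup>2 * (x - g0 t) \<le> (1 / \<alpha>2)\<^sup>2 * (x - g0 t)"
      using *
    proof eventually_elim
      case (elim t)
      show ?case
      proof (intro allI impI)
        fix x assume x: "(1 - \<epsilon>) * g1 t \<le> x"
        show "(cmod (?h t))\<^sup>2 * (x - g0 t) \<le> (1 / \<alpha>2)\<^sup>2 * (x - g0 t)"
        \<comment> \<open>Where \<open>|h| < 1 / \<alpha>2\<close>, \<open>g0\<close> is the least value allowed in the class, so \<open>x - g0 t \<ge> 0\<close>.\<close>
        proof (cases "cmod (?h t) = 1 / \<alpha>2")
          case False
          then show ?thesis using elim x by (intro mult_right_mono power_mono) auto
        qed (simp only: order_refl)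
      qed
    qed
  qed
  have h2_int: "integrable freq (\<lambda>t. (cmod (?h t))\<^sup>2 * w t)" if "integrable freq w" for w
  proof (rule integrable_mult_bounded[OF that, where B = "(1 / \<alpha>2)\<^sup>2"])
    show "AE t in freq. norm ((cmod (?h t))\<^sup>2) \<le> (1 / \<alpha>2)\<^sup>2"
      using h_le
    proof eventually_elim
      case (elim t)
      from power_mono[OF elim norm_ge_zero, of 2] show ?case
        unfolding real_norm_def abs_of_nonneg[OF zero_le_power2] .
    qed
  qed measurable
  \<comment> \<open>If \<open>g0\<close> uses the full power, compare with the constant \<open>(1 / \<alpha>2)\<^sup>2\<close>; otherwise \<open>?h\<close> vanishes.\<close>
  have energy: "(LINT t|freq. (cmod (?h t))\<^sup>2 * g t) \<le> (LINT t|freq. (cmod (?h t))\<^sup>2 * g0 t)" if g: "g \<in> ?D" for g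
  proof (cases "(LINT t|freq. g0 t) < 2 * pi * P2")
    case True
    have "AE t in freq. ?h t = 0" by (rule F0.optimal_with_slack_imp_h_zero[OF g0 eps(1) True optimal])
    then have "AE t in freq. (cmod (?h t))\<^sup>2 * w t = 0" for w by eventually_elim simp
    then have "(LINT t|freq. (cmod (?h t))\<^sup>2 * w t) = 0" for w by (rule integral_eq_zero_AE)
    then show ?thesis by simp
  next
    case False
    have gi: "integrable freq g" using D(1)[OF g] by (simp add: spectral_density_def)
    have "(LINT t|freq. (cmod (?h t))\<^sup>2 * g t) - (LINT t|freq. (cmod (?h t))\<^sup>2 * g0 t)
        = (LINT t|freq. (cmod (?h t))\<^sup>2 * (g t - g0 t))"
      using h2_int[OF gi] h2_int[OF F0.g_int] by (simp add: right_diff_distrib)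
    also have "\<dots> \<le> (LINT t|freq. (1 / \<alpha>2)\<^sup>2 * (g t - g0 t))"
    proof (rule integral_mono_AE)
      have "AE t in freq. (1 - \<epsilon>) * g1 t \<le> g t"
        by (rule AE_I2) (simp only: space_freq D(2)[OF g])
      with h_gain show "AE t in freq. (cmod (?h t))\<^sup>2 * (g t - g0 t) \<le> (1 / \<alpha>2)\<^sup>2 * (g t - g0 t)"
        by eventually_elim blast
    qed (use gi F0.g_int in \<open>auto intro!: h2_int\<close>)
    also have "\<dots> = (1 / \<alpha>2)\<^sup>2 * ((LINT t|freq. g t) - (LINT t|freq. g0 t))"
      using gi F0.g_int by simp
    also have "\<dots> \<le> 0"
      using D(3)[OF g] False by (intro mult_nonneg_nonpos) auto
    finally show ?thesis by simp
  qed
  have mse_le: "mse a ?h f g \<le> mse a ?h f g0" if g: "g \<in> ?D" for g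
  proof -
    have nn: "(\<integral>\<^sup>+t. ennreal ((cmod (?h t))\<^sup>2 * g t) \<partial>freq) = ennreal (LINT t|freq. (cmod (?h t))\<^sup>2 * g t)" if "g \<in> ?D" for g
    proof (rule nn_integral_eq_integral)
      show "integrable freq (\<lambda>t. (cmod (?h t))\<^sup>2 * g t)"
        using D(1)[OF that] by (intro h2_int) (simp add: spectral_density_def)
      show "AE t in freq. 0 \<le> (cmod (?h t))\<^sup>2 * g t"
        using spectral_density_AE_nonneg[OF D(1)[OF that]] by eventually_elim simp
    qed
    show ?thesis
      unfolding mse_def nn[OF g] nn[OF g0]
      by (intro add_left_mono divide_right_mono_ennreal ennreal_leI energy g)
  qed
  have sup: "(SUP g\<in>?D. mse a ?h f g) = mse a ?h f g0"
    by (rule antisym) (auto intro: SUP_least mse_le SUP_upper g0)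
  have h_H: "?h \<in> H_class f ?D"
    unfolding H_class_def
  proof (rule INT_I)
    fix g assume "g \<in> ?D"
    then have "spectral_density (\<lambda>t. f t + g t)" using f D(1) by (intro spectral_density_add)
    then show "?h \<in> L2_past (\<lambda>t. f t + g t)"
      by (intro L2_past_of_bounded[OF F0.h_meas h_le F0.h_coeff] spectral_density_AE_nonneg)
        (auto simp: spectral_density_def)
  qed
  show "minimax_robust a f ?D ?h"
    unfolding minimax_robust_def
  proof (intro conjI h_H antisym)
    show "(INF h\<in>H_class f ?D. SUP g\<in>?D. mse a h f g) \<le> (SUP g\<in>?D. mse a ?h f g)"
      by (rule INF_lower[OF h_H])
    show "(SUP g\<in>?D. mse a ?h f g) \<le> (INF h\<in>H_class f ?D. SUP g\<in>?D. mse a h f g)"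
      unfolding sup
    proof (rule INF_greatest)
      fix k assume "k \<in> H_class f ?D"
      then have "k \<in> L2_past (\<lambda>t. f t + g0 t)" using g0 by (auto simp: H_class_def)
      then have "mse a ?h f g0 \<le> mse a k f g0" by (rule F0.mse_h_minimal[OF h_le])
      also have "\<dots> \<le> (SUP g\<in>?D. mse a k f g)" using g0 by (rule SUP_upper)
      finally show "mse a ?h f g0 \<le> (SUP g\<in>?D. mse a k f g)" .
    qed
  qed
qed

end
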